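(* Let $p$ be a prime and $\Gamma=G=PGL_2(\mathbb{Z}_p)$, acting on the rooted tree $\mathcal{L}/\!\approx$. (1) Let $c^{G}_n$ be the number of all $\equiv^{\Gamma}_n$-classes meeting $G$, defined with respect to the rooted tree $\mathcal{L}/\!\approx$. Then the zeta function $\sum_{n\ge 0}c^{G}_n t^n$ is $\mathbb{Q}$-rational. (2) The group $G$ has a small number of isometry types with respect to the action on $\mathcal{L}/\!\approx$, and there are continuum many $\Gamma$-types meeting $G$.
   Context: Let $L_0=\mathbb{Z}_p\times\mathbb{Z}_p$, and for $u\in L_0$ let $\nu(u)$ be the minimum of the $p$-adic valuations of the coordinates of $u$. $\mathcal{L}$ is the rooted tree (with root $L_0$) of all cosets $u+p^nL_0$, $n\ge 0$, with $\nu(u)=0$. On $\mathcal{L}$ define $u+p^nL_0\approx u'+p^lL_0$ iff $n=l$ and there is $x\in\mathbb{Z}_p^{\times}$ with $xu-u'\in p^nL_0$. The quotient $\mathcal{L}/\!\approx$ is a rooted tree whose $n$-th level consists of the classes of cosets $u+p^nL_0$; the classes of $u+p^nL_0$ and $u'+p^{n+1}L_0$ are adjacent iff $(\mathbb{Z}_p/p^n\mathbb{Z}_p)(u+p^nL_0)=(\mathbb{Z}_p/p^n\mathbb{Z}_p)(u'+p^nL_0)$ as submodules of $L_0/p^nL_0$. (This is the tree of homothety classes of lattices in $\mathbb{Q}_p\times\mathbb{Q}_p$, rooted at the class of $L_0$.) $PGL_2(\mathbb{Z}_p)=GL_2(\mathbb{Z}_p)/\mathbb{Z}_p^{\times}$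 acts on $\mathcal{L}/\!\approx$ by $g\cdot[u+p^nL_0]=[gu+p^nL_0]$ and is the stabilizer of the root in $PGL_2(\mathbb{Q}_p)$ acting on the tree of lattices; it is regarded as a subgroup of $Iso(T)$, the group of isometries of $T=\mathcal{L}/\!\approx$ fixing the root. $T_n$ is the subtree of vertices of level at most $n$. For $g,g'\in Iso(T)$: $g\equiv^{\Gamma}_n g'$ means that the restrictions of $g,g'$ to $T_n$ are conjugate by an element of the image of $\Gamma$ in $Iso(T_n)$; $g$ and $g'$ have the same $\Gamma$-type if $g'$ is the conjugate of $g$ by some element of $\Gamma$. $G$ has a small number of isometry types if it meets fewer than $2^{\aleph_0}$ conjugacy classes of $Iso(T)$. A power series is $\mathbb{Q}$-rational if it is a quotient of two polynomials in $t$ over $\mathbb{Q}$. *)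

theory Defs
  imports
    "HOL-Algebra.Bij"
    "HOL-Algebra.AbelCoset"
    "HOL-Algebra.Chinese_Remainder"
    "HOL-Computational_Algebra.Polynomial_FPS"
    "HOL-Library.Equipollence"
    "HOL-Library.Extended_Nat"
    "HOL-Number_Theory.Cong"
begin

section \<open>Rooted trees and their isometries\<close>

record 'v rooted_tree =
  verts :: "'v set"
  edges :: "('v \<times> 'v) set"
  root :: 'v

definition tree_dist :: "'v rooted_tree \<Rightarrow> 'v \<Rightarrow> 'v \<Rightarrow> nat" where
  "tree_dist T v w = (LEAST k. (v, w) \<in> edges T ^^ k)"

definition truncate_tree :: "'v rooted_tree \<Rightarrow> nat \<Rightarrow> 'v rooted_tree" where
  "truncate_tree T n =
     (let V = {v \<in> verts T. tree_dist T (root T) v \<le> n}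
      in \<lparr>verts = V, edges = edges T \<inter> V \<times> V, root = root T\<rparr>)"

definition Iso :: "'v rooted_tree \<Rightarrow> ('v \<Rightarrow> 'v) monoid" where
  "Iso T = (BijGroup (verts T))
     \<lparr>carrier := {f \<in> Bij (verts T). f (root T) = root T \<and>
        (\<forall>v\<in>verts T. \<forall>w\<in>verts T. tree_dist T (f v) (f w) = tree_dist T v w)}\<rparr>"

definition restr :: "'v rooted_tree \<Rightarrow> nat \<Rightarrow> ('v \<Rightarrow> 'v) \<Rightarrow> ('v \<Rightarrow> 'v)" where
  "restr T n g = restrict g (verts (truncate_tree T n))"


section \<open>Types and the zeta function\<close>

definition conj_rel :: "('a, 'b) monoid_scheme \<Rightarrow> 'a set \<Rightarrow> ('a \<times> 'a) set" where
  "conj_rel K H = {(g, g'). g \<in> carrier K \<and> g' \<in> carrier K \<and>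
     (\<exists>h\<in>H. g' = h \<otimes>\<^bsub>K\<^esub> g \<otimes>\<^bsub>K\<^esub> inv\<^bsub>K\<^esub> h)}"

definition level_equiv :: "'v rooted_tree \<Rightarrow> ('v \<Rightarrow> 'v) set \<Rightarrow> nat \<Rightarrow> (('v \<Rightarrow> 'v) \<times> ('v \<Rightarrow> 'v)) set" where
  "level_equiv T \<Gamma> n = {(g, g'). g \<in> carrier (Iso T) \<and> g' \<in> carrier (Iso T) \<and>
     (restr T n g, restr T n g') \<in> conj_rel (Iso (truncate_tree T n)) (restr T n ` \<Gamma>)}"

definition classes_meeting :: "'a set \<Rightarrow> ('a \<times> 'a) set \<Rightarrow> 'a set \<Rightarrow> 'a set set" where
  "classes_meeting A r G = {X \<in> A // r. X \<inter> G \<noteq> {}}"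

definition level_count :: "'v rooted_tree \<Rightarrow> ('v \<Rightarrow> 'v) set \<Rightarrow> ('v \<Rightarrow> 'v) set \<Rightarrow> nat \<Rightarrow> nat" where
  "level_count T \<Gamma> G n = card (classes_meeting (carrier (Iso T)) (level_equiv T \<Gamma> n) G)"

definition zeta_series :: "'v rooted_tree \<Rightarrow> ('v \<Rightarrow> 'v) set \<Rightarrow> ('v \<Rightarrow> 'v) set \<Rightarrow> rat fps" where
  "zeta_series T \<Gamma> G = Abs_fps (\<lambda>n. of_nat (level_count T \<Gamma> G n))"

text \<open>Division on \<^typ>\<open>rat fps\<close> truncates when the denominator has the higher order at 0, so the
  quotient is expressed by clearing the denominator.\<close>
definition Q_rational :: "rat fps \<Rightarrow> bool" where
  "Q_rational f \<longleftrightarrow> (\<exists>P Q. Q \<noteq> 0 \<and> f * fps_of_poly Q = fps_of_poly P)"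

definition types_meeting :: "'v rooted_tree \<Rightarrow> ('v \<Rightarrow> 'v) set \<Rightarrow> ('v \<Rightarrow> 'v) set \<Rightarrow> ('v \<Rightarrow> 'v) set set" where
  "types_meeting T \<Gamma> G = classes_meeting (carrier (Iso T)) (conj_rel (Iso T) \<Gamma>) G"

definition small_isometry_types :: "'v rooted_tree \<Rightarrow> ('v \<Rightarrow> 'v) set \<Rightarrow> bool" where
  "small_isometry_types T G \<longleftrightarrow> types_meeting T (carrier (Iso T)) G \<prec> (UNIV :: real set)"


section \<open>The $p$-adic integers\<close>

text \<open>The inverse limit of the rings of integers modulo \<open>p ^ n\<close>: the \<open>n\<close>-th entry is the reduced
  residue modulo \<open>p ^ n\<close>.\<close>

type_synonym padic = "nat \<Rightarrow> int"

definition Zp :: "nat \<Rightarrow> padic ring" where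
  "Zp p = \<lparr>
     carrier = {x. \<forall>n. x n \<in> {0..<int p ^ n} \<and> [x (Suc n) = x n] (mod int p ^ n)},
     monoid.mult = (\<lambda>x y n. (x n * y n) mod int p ^ n),
     one = (\<lambda>n. 1 mod int p ^ n),
     zero = (\<lambda>n. 0),
     add = (\<lambda>x y n. (x n + y n) mod int p ^ n)\<rparr>"

lemma cong_mod_pow: "[a mod int p ^ Suc n = a] (mod int p ^ n)"
  by (simp add: cong_def mod_mod_cancel)

lemma Zp_cring:
  assumes p: "p > 0"
  shows "cring (Zp p)"
proof -
  let ?m = "\<lambda>n. int p ^ n"
  have pos: "?m n > 0" for n using p by simp
  have memI: "(\<lambda>n. f n mod ?m n) \<in> carrier (Zp p)" if "\<And>n. [f (Suc n) = f n] (mod ?m n)" for f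
  proof -
    have "[f (Suc n) mod ?m (Suc n) = f n mod ?m n] (mod ?m n)" for n
      using cong_trans[OF cong_mod_pow that] by (simp add: cong_def)
    thus ?thesis using pos by (auto simp add: Zp_def)
  qed
  have memD: "[x (Suc n) = x n] (mod ?m n)" "x n mod ?m n = x n" if "x \<in> carrier (Zp p)" for x n
    using that by (auto simp: Zp_def)
  have add: "x \<oplus>\<^bsub>Zp p\<^esub> y = (\<lambda>n. (x n + y n) mod ?m n)" for x y by (simp add: Zp_def)
  have mul: "x \<otimes>\<^bsub>Zp p\<^esub> y = (\<lambda>n. (x n * y n) mod ?m n)" for x y by (simp add: Zp_def)
  have z: "\<zero>\<^bsub>Zp p\<^esub> = (\<lambda>n. 0)" and o: "\<one>\<^bsub>Zp p\<^esub> = (\<lambda>n. 1 mod ?m n)" by (simp_all add: Zp_def)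
  show ?thesis
  proof (rule cringI)
    show "abelian_group (Zp p)"
    proof (rule abelian_groupI)
      fix x y assume "x \<in> carrier (Zp p)" "y \<in> carrier (Zp p)"
      thus "x \<oplus>\<^bsub>Zp p\<^esub> y \<in> carrier (Zp p)" unfolding add by (intro memI cong_add memD)
    next
      show "\<zero>\<^bsub>Zp p\<^esub> \<in> carrier (Zp p)" using pos by (auto simp: Zp_def)
    next
      fix x assume x: "x \<in> carrier (Zp p)"
      have "(\<lambda>n. (- x n) mod ?m n) \<in> carrier (Zp p)"
        by (intro memI) (simp add: cong_minus_minus_iff memD(1)[OF x])
      moreover have "(\<lambda>n. (- x n) mod ?m n) \<oplus>\<^bsub>Zp p\<^esub> x = \<zero>\<^bsub>Zp p\<^esub>"
        by (simp add: add z mod_simps)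
      ultimately show "\<exists>y\<in>carrier (Zp p). y \<oplus>\<^bsub>Zp p\<^esub> x = \<zero>\<^bsub>Zp p\<^esub>" by blast
    next
      fix x assume x: "x \<in> carrier (Zp p)"
      show "\<zero>\<^bsub>Zp p\<^esub> \<oplus>\<^bsub>Zp p\<^esub> x = x" using memD(2)[OF x] by (simp add: add z)
    qed (auto simp: add mod_simps algebra_simps)
    show "comm_monoid (Zp p)"
    proof (rule comm_monoidI)
      fix x y assume "x \<in> carrier (Zp p)" "y \<in> carrier (Zp p)"
      thus "x \<otimes>\<^bsub>Zp p\<^esub> y \<in> carrier (Zp p)" unfolding mul by (intro memI cong_mult memD)
    next
      show "\<one>\<^bsub>Zp p\<^esub> \<in> carrier (Zp p)" unfolding o by (intro memI) simp
    next
      fix x assume x: "x \<in> carrier (Zp p)"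
      show "\<one>\<^bsub>Zp p\<^esub> \<otimes>\<^bsub>Zp p\<^esub> x = x" using memD(2)[OF x] by (simp add: mul o mod_simps)
    qed (auto simp: mul mod_simps algebra_simps)
  qed (auto simp: add mul mod_simps algebra_simps)
qed

definition padic_val :: "nat \<Rightarrow> padic \<Rightarrow> enat" where
  "padic_val p x = Sup {enat k | k. \<exists>y\<in>carrier (Zp p). x = add_pow (Zp p) (p ^ k) y}"


section \<open>The tree of classes of cosets\<close>

type_synonym vec = "padic \<times> padic"

definition L0 :: "nat \<Rightarrow> vec ring" where
  "L0 p = RDirProd (Zp p) (Zp p)"

definition smult :: "nat \<Rightarrow> padic \<Rightarrow> vec \<Rightarrow> vec" where
  "smult p x u = (x \<otimes>\<^bsub>Zp p\<^esub> fst u, x \<otimes>\<^bsub>Zp p\<^esub> snd u)"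

definition nu :: "nat \<Rightarrow> vec \<Rightarrow> enat" where
  "nu p u = min (padic_val p (fst u)) (padic_val p (snd u))"

definition primitive :: "nat \<Rightarrow> vec \<Rightarrow> bool" where
  "primitive p u \<longleftrightarrow> u \<in> carrier (L0 p) \<and> nu p u = 0"

definition pL :: "nat \<Rightarrow> nat \<Rightarrow> vec set" where
  "pL p n = {add_pow (L0 p) (p ^ n) u | u. u \<in> carrier (L0 p)}"

definition coset :: "nat \<Rightarrow> nat \<Rightarrow> vec \<Rightarrow> vec set" where
  "coset p n u = u <+\<^bsub>L0 p\<^esub> pL p n"

definition cosets :: "nat \<Rightarrow> vec set set" where
  "cosets p = {coset p n u | n u. primitive p u}"

definition homothetic :: "nat \<Rightarrow> (vec set \<times> vec set) set" where
  "homothetic p = {(coset p n u, coset p n u') | n u u'. primitive p u \<and> primitive p u' \<and>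
     (\<exists>x\<in>Units (Zp p). smult p x u \<ominus>\<^bsub>L0 p\<^esub> u' \<in> pL p n)}"

definition coset_class :: "nat \<Rightarrow> nat \<Rightarrow> vec \<Rightarrow> vec set set" where
  "coset_class p n u = homothetic p `` {coset p n u}"

text \<open>The submodule of \<open>L0 / p^n L0\<close> generated by \<open>u + p^n L0\<close>: the scalar \<open>x + p^n Zp\<close> takes
  \<open>u + p^n L0\<close> to \<open>x u + p^n L0\<close>.\<close>
definition line :: "nat \<Rightarrow> nat \<Rightarrow> vec \<Rightarrow> vec set set" where
  "line p n u = {coset p n (smult p x u) | x. x \<in> carrier (Zp p)}"

definition child_rel :: "nat \<Rightarrow> (vec set set \<times> vec set set) set" where
  "child_rel p = {(coset_class p n u, coset_class p (Suc n) u') | n u u'.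
     primitive p u \<and> primitive p u' \<and> line p n u = line p n u'}"

text \<open>There is only one coset of \<open>p^0 L0\<close>, namely \<open>L0\<close> itself, so its class is the root.\<close>
definition lattice_tree :: "nat \<Rightarrow> vec set set rooted_tree" where
  "lattice_tree p = \<lparr>
     verts = cosets p // homothetic p,
     edges = child_rel p \<union> (child_rel p)\<inverse>,
     root = homothetic p `` {carrier (L0 p)}\<rparr>"


section \<open>The action of the projective linear group\<close>

text \<open>The pair \<open>((a, b), (c, d))\<close> is the matrix with rows \<open>(a, b)\<close> and \<open>(c, d)\<close>.\<close>

type_synonym 'a mat2 = "('a \<times> 'a) \<times> ('a \<times> 'a)"

definition M2 :: "('a, 'm) ring_scheme \<Rightarrow> 'a mat2 monoid" where
  "M2 R = \<lparr>
     carrier = (carrier R \<times> carrier R) \<times> (carrier R \<times> carrier R),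
     monoid.mult = (\<lambda>((a, b), (c, d)) ((a', b'), (c', d')).
       ((a \<otimes>\<^bsub>R\<^esub> a' \<oplus>\<^bsub>R\<^esub> b \<otimes>\<^bsub>R\<^esub> c', a \<otimes>\<^bsub>R\<^esub> b' \<oplus>\<^bsub>R\<^esub> b \<otimes>\<^bsub>R\<^esub> d'),
        (c \<otimes>\<^bsub>R\<^esub> a' \<oplus>\<^bsub>R\<^esub> d \<otimes>\<^bsub>R\<^esub> c', c \<otimes>\<^bsub>R\<^esub> b' \<oplus>\<^bsub>R\<^esub> d \<otimes>\<^bsub>R\<^esub> d'))),
     one = ((\<one>\<^bsub>R\<^esub>, \<zero>\<^bsub>R\<^esub>), (\<zero>\<^bsub>R\<^esub>, \<one>\<^bsub>R\<^esub>))\<rparr>"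

definition GL2 :: "('a, 'm) ring_scheme \<Rightarrow> 'a mat2 monoid" where
  "GL2 R = units_of (M2 R)"

definition scalars :: "('a, 'm) ring_scheme \<Rightarrow> 'a mat2 set" where
  "scalars R = {((x, \<zero>\<^bsub>R\<^esub>), (\<zero>\<^bsub>R\<^esub>, x)) | x. x \<in> Units R}"

definition PGL2 :: "('a, 'm) ring_scheme \<Rightarrow> 'a mat2 set monoid" where
  "PGL2 R = GL2 R Mod scalars R"

definition mat_app :: "('a, 'm) ring_scheme \<Rightarrow> 'a mat2 \<Rightarrow> 'a \<times> 'a \<Rightarrow> 'a \<times> 'a" where
  "mat_app R = (\<lambda>((a, b), (c, d)) (x, y).
     (a \<otimes>\<^bsub>R\<^esub> x \<oplus>\<^bsub>R\<^esub> b \<otimes>\<^bsub>R\<^esub> y, c \<otimes>\<^bsub>R\<^esub> x \<oplus>\<^bsub>R\<^esub> d \<otimes>\<^bsub>R\<^esub> y))"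

definition PGL2_act :: "nat \<Rightarrow> padic mat2 set \<Rightarrow> vec set set \<Rightarrow> vec set set" where
  "PGL2_act p X = (\<lambda>v\<in>verts (lattice_tree p). THE w. \<exists>A\<in>X. \<exists>n u. primitive p u \<and>
     v = coset_class p n u \<and> w = coset_class p n (mat_app (Zp p) A u))"

text \<open>The subgroup of isometries through which the projective linear group acts.\<close>
definition PGL2_Iso :: "nat \<Rightarrow> (vec set set \<Rightarrow> vec set set) set" where
  "PGL2_Iso p = PGL2_act p ` carrier (PGL2 (Zp p))"

end

(* Two matrices act in the same way on level n of the tree exactly when they are proportional modulo
p^n, so c_n is the number of conjugacy classes of PGL_2(Z/p^n). A matrix that is scalar exactly modulo
p^k is projectively of the form 1 + p^k B with B not scalar modulo p, and such a B is determined up to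
conjugacy by its trace and determinant. Burnside's lemma then counts pairs (trace, determinant)
up to the substitutions that preserve the form 1 + p^k B, and yields c_{n+1} = c_n + K p^n for
n >= 3, whence rationality (for p = 2 as well as for odd p).

By Hensel's lemma every element is conjugate under PGL_2(Z_p) to some x + y C, where C is one of the countably
many companion matrices with integer entries. If a power of such an element has a C-coordinate of exact
valuation j >= 2, then the closed group it generates modulo scalars is open in the torus of C and depends only on
the residues modulo p^(j+1). Elements that generate the same closed group have the same orbits on
every level and are conjugate in Iso(T). The remaining elements are torsion and are
determined by their residues modulo p^2. Hence G meets only countably many classes of Iso(T). On the other hand
trace^2/determinant separates continuum many classes under PGL_2(Z_p). *)
theory Submission
  imports Defs "HOL-Analysis.Abstract_Topology_2"
begin

section \<open>Integer matrices\<close>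

text \<open>The prime 2 shapes the proof. Completing the square would replace the pair (trace,
  determinant) by a discriminant, but only where 2 is invertible. The pairs are therefore kept and
  their orbits counted through fixed points, with separate values for \<open>p = 2\<close> at
  \<open>k = 0\<close>, \<open>k = 1\<close> and \<open>k \<ge> 2\<close>. The bound 2 on the
  valuation \<open>j\<close> comes from expanding \<open>(x + y C) ^ p\<close>: its C-coordinate is
  \<open>p * x ^ (p - 1) * y\<close> plus a multiple of \<open>y ^ 2\<close>, and the second term is
  negligible once \<open>2 * j \<ge> j + 2\<close>. From there on each p-th power raises the
  valuation by exactly one. Hence the powers of one element can correct every further digit, and an
  element that is scalar modulo \<open>p ^ 2\<close> cannot be torsion unless it is scalar. For the
  passage to Iso(T), equal orbits on each level are not yet a conjugacy: the representatives of the
  orbits must also be chosen compatibly from level to level. Integer matrices represent residues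
  modulo all \<open>p ^ n\<close> at once. Scalars act trivially, so the adjugate serves as an
  inverse and the determinant need not be divided out.\<close>

datatype imat = Mat (m11: int) (m12: int) (m21: int) (m22: int)

instantiation imat :: ring_1
begin

definition "0 = Mat 0 0 0 0"
definition "1 = Mat 1 0 0 1"
definition "A + B = Mat (m11 A + m11 B) (m12 A + m12 B) (m21 A + m21 B) (m22 A + m22 B)"
definition "A - B = Mat (m11 A - m11 B) (m12 A - m12 B) (m21 A - m21 B) (m22 A - m22 B)"
definition "- A = Mat (- m11 A) (- m12 A) (- m21 A) (- m22 A)"
definition "A * B = Mat (m11 A * m11 B + m12 A * m21 B) (m11 A * m12 B + m12 A * m22 B)
  (m21 A * m11 B + m22 A * m21 B) (m21 A * m12 B + m22 A * m22 B)"

lemmas imat_defs = zero_imat_def one_imat_def plus_imat_def minus_imat_def uminus_imat_def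
  times_imat_def

instance
  by standard (auto simp: imat_defs algebra_simps)

end

lemma imat_sel [simp]:
  "m11 0 = 0" "m12 0 = 0" "m21 0 = 0" "m22 0 = 0"
  "m11 1 = 1" "m12 1 = 0" "m21 1 = 0" "m22 1 = 1"
  "m11 (A + B) = m11 A + m11 B" "m12 (A + B) = m12 A + m12 B"
  "m21 (A + B) = m21 A + m21 B" "m22 (A + B) = m22 A + m22 B"
  "m11 (A - B) = m11 A - m11 B" "m12 (A - B) = m12 A - m12 B"
  "m21 (A - B) = m21 A - m21 B" "m22 (A - B) = m22 A - m22 B"
  "m11 (- A) = - m11 A" "m12 (- A) = - m12 A" "m21 (- A) = - m21 A" "m22 (- A) = - m22 A"
  "m11 (A * B) = m11 A * m11 B + m12 A * m21 B" "m12 (A * B) = m11 A * m12 B + m12 A * m22 B"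
  "m21 (A * B) = m21 A * m11 B + m22 A * m21 B" "m22 (A * B) = m21 A * m12 B + m22 A * m22 B"
  by (simp_all add: imat_defs)

lemma imat_eqI: "m11 A = m11 B \<Longrightarrow> m12 A = m12 B \<Longrightarrow> m21 A = m21 B \<Longrightarrow> m22 A = m22 B \<Longrightarrow> A = B"
  by (cases A; cases B) auto

lemma of_nat_imat: "of_nat n = Mat (int n) 0 0 (int n)"
  by (induction n) (auto simp: imat_defs)

lemma of_int_imat: "of_int k = Mat k 0 0 k"
proof (cases k)
  case (nonneg n) thus ?thesis by (simp add: of_nat_imat)
next
  case (neg n) thus ?thesis by (simp add: of_nat_imat uminus_imat_def del: of_nat_Suc)
qed

lemma of_int_sel [simp]: "m11 (of_int k) = k" "m12 (of_int k) = 0" "m21 (of_int k) = 0" "m22 (of_int k) = k"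
  by (simp_all add: of_int_imat)

definition mdet :: "imat \<Rightarrow> int" where "mdet A = m11 A * m22 A - m12 A * m21 A"
definition mtr :: "imat \<Rightarrow> int" where "mtr A = m11 A + m22 A"
definition madj :: "imat \<Rightarrow> imat" where "madj A = Mat (m22 A) (- m12 A) (- m21 A) (m11 A)"
definition mapp :: "imat \<Rightarrow> int \<times> int \<Rightarrow> int \<times> int" where
  "mapp A w = (m11 A * fst w + m12 A * snd w, m21 A * fst w + m22 A * snd w)"
definition vdet :: "int \<times> int \<Rightarrow> int \<times> int \<Rightarrow> int" where
  "vdet u w = fst u * snd w - snd u * fst w"

definition companion :: "int \<Rightarrow> int \<Rightarrow> imat" where "companion t d = Mat 0 (- d) 1 t"

text \<open>The columns are \<open>u\<close> and \<open>B u\<close>: this is the change to the basis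
  in which \<open>B\<close> becomes a companion matrix, provided that \<open>u\<close> is a cyclic
  vector.\<close>

definition basis_mat :: "int \<times> int \<Rightarrow> imat \<Rightarrow> imat" where
  "basis_mat u B = (let w = mapp B u in Mat (fst u) (fst w) (snd u) (snd w))"

lemma madj_sel [simp]: "m11 (madj A) = m22 A" "m12 (madj A) = - m12 A"
  "m21 (madj A) = - m21 A" "m22 (madj A) = m11 A"
  by (simp_all add: madj_def)

lemma companion_sel [simp]: "m11 (companion t d) = 0" "m12 (companion t d) = - d" "m21 (companion t d) = 1" "m22 (companion t d) = t"
  by (simp_all add: companion_def)

lemma mdet_mult: "mdet (A * B) = mdet A * mdet B"
  by (simp add: mdet_def algebra_simps)

lemma mdet_power: "mdet (A ^ n) = mdet A ^ n"
  by (induction n) (simp_all add: mdet_mult, simp add: mdet_def)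

lemma mdet_madj [simp]: "mdet (madj A) = mdet A"
  by (simp add: mdet_def)

lemma madj_mult [simp]: "madj A * A = of_int (mdet A)" "A * madj A = of_int (mdet A)"
  by (auto intro!: imat_eqI simp: mdet_def algebra_simps)

lemma mapp_mult: "mapp (A * B) w = mapp A (mapp B w)"
  by (simp add: mapp_def algebra_simps)

lemma vdet_mapp: "vdet (mapp A u) (mapp A w) = mdet A * vdet u w"
  by (simp add: vdet_def mapp_def mdet_def algebra_simps)

text \<open>The first column is immediate; the second is Cayley-Hamilton,
  \<open>B (B u) = mtr B * B u - mdet B * u\<close>.\<close>

lemma basis_mat_companion: "B * basis_mat u B = basis_mat u B * companion (mtr B) (mdet B)"
  by (intro imat_eqI) (simp_all add: basis_mat_def mapp_def mtr_def mdet_def Let_def algebra_simps)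

lemma mdet_basis_mat: "mdet (basis_mat u B) = vdet u (mapp B u)"
  by (simp add: basis_mat_def mdet_def vdet_def Let_def algebra_simps)

lemma mtr_mult_commute: "mtr (A * B) = mtr (B * A)"
  by (simp add: mtr_def algebra_simps)

lemma of_int_mult_commute_imat: "of_int k * (A :: imat) = A * of_int k"
  by (intro imat_eqI) (simp_all add: algebra_simps)

lemma mtr_of_int_mult [simp]: "mtr (of_int k * A) = k * mtr A"
  by (simp add: mtr_def algebra_simps)

lemma mdet_of_int_mult [simp]: "mdet (of_int k * A) = k^2 * mdet A"
  by (simp add: mdet_def algebra_simps power2_eq_square)

lemma of_int_mult_cancel_imat:
  assumes "k \<noteq> 0" "of_int k * A = of_int k * (B :: imat)"
  shows "A = B"
  using assms by (auto intro!: imat_eqI dest: arg_cong[where f = m11] arg_cong[where f = m12]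
      arg_cong[where f = m21] arg_cong[where f = m22])

lemma of_nat_power_sel [simp]:
  "m11 (of_nat a ^ k) = int a ^ k" "m12 (of_nat a ^ k) = 0" "m21 (of_nat a ^ k) = 0" "m22 (of_nat a ^ k) = int a ^ k"
proof -
  have "(of_nat a ^ k :: imat) = of_int (int a ^ k)" by simp
  thus "m11 (of_nat a ^ k) = int a ^ k" "m12 (of_nat a ^ k) = 0" "m21 (of_nat a ^ k) = 0" "m22 (of_nat a ^ k) = int a ^ k"
    by (simp_all only: of_int_sel)
qed

lemma mdet_of_int [simp]: "mdet (of_int k) = k^2"
  by (simp add: mdet_def power2_eq_square)

lemma mtr_mult_of_int [simp]: "mtr (A * of_int k) = k * mtr A"
  by (simp add: mtr_def algebra_simps)

subsection \<open>Congruence\<close>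

definition mcong :: "int \<Rightarrow> imat \<Rightarrow> imat \<Rightarrow> bool" where
  "mcong N A B \<longleftrightarrow> N dvd m11 A - m11 B \<and> N dvd m12 A - m12 B \<and> N dvd m21 A - m21 B \<and> N dvd m22 A - m22 B"

lemma mcong_iff: "mcong N A B \<longleftrightarrow> (\<exists>K. A = B + of_int N * K)"
proof
  assume "mcong N A B"
  then obtain a b c d where "m11 A - m11 B = N * a" "m12 A - m12 B = N * b"
    "m21 A - m21 B = N * c" "m22 A - m22 B = N * d"
    unfolding mcong_def dvd_def by blast
  hence "A = B + of_int N * Mat a b c d" by (intro imat_eqI) auto
  thus "\<exists>K. A = B + of_int N * K" by blast
qed (auto simp: mcong_def)

lemma mcong_refl [simp, intro]: "mcong N A A" by (simp add: mcong_def)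
lemma mcong_sym: "mcong N A B \<Longrightarrow> mcong N B A" by (simp add: mcong_def dvd_diff_commute)
lemma mcong_trans [trans]: "mcong N A B \<Longrightarrow> mcong N B C \<Longrightarrow> mcong N A C"
  unfolding mcong_def by (metis dvd_add diff_add_cancel add_diff_eq)
lemma mcong_1 [simp]: "mcong 1 A B" by (simp add: mcong_def)
lemma mcong_add: "mcong N A B \<Longrightarrow> mcong N C D \<Longrightarrow> mcong N (A + C) (B + D)"
  unfolding mcong_def by (metis (no_types, lifting) add_diff_add dvd_add imat_sel(9-12))
lemma mcong_mult:
  assumes "mcong N A B" "mcong N C D" shows "mcong N (A * C) (B * D)"
proof -
  obtain K L where "A = B + of_int N * K" "C = D + of_int N * L" using assms by (auto simp: mcong_iff)
  hence "A * C = B * D + of_int N * (K * D + B * L + of_int N * (K * L))"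
    by (intro imat_eqI) (simp_all add: algebra_simps)
  thus ?thesis by (auto simp: mcong_iff)
qed
lemma mcong_power: "mcong N A B \<Longrightarrow> mcong N (A ^ i) (B ^ i)"
  by (induction i) (auto intro: mcong_mult)
lemma mcong_madj: "mcong N A B \<Longrightarrow> mcong N (madj A) (madj B)"
  by (auto simp: mcong_def dvd_diff_commute)
lemma mcong_dvd: "mcong N A B \<Longrightarrow> M dvd N \<Longrightarrow> mcong M A B"
  unfolding mcong_def by (meson dvd_trans)
lemma mcong_of_int: "[k = l] (mod N) \<Longrightarrow> mcong N (of_int k) (of_int l)"
  by (simp add: mcong_def cong_iff_dvd_diff)
lemma mcong_mtr: "mcong N A B \<Longrightarrow> [mtr A = mtr B] (mod N)"
  unfolding mcong_def mtr_def by (auto simp: cong_iff_dvd_diff[symmetric] intro: cong_add)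
lemma mcong_mdet: "mcong N A B \<Longrightarrow> [mdet A = mdet B] (mod N)"
  unfolding mcong_def mdet_def by (auto simp: cong_iff_dvd_diff[symmetric] intro: cong_diff cong_mult)
lemma mcong_companion: "[t = t'] (mod N) \<Longrightarrow> [d = d'] (mod N) \<Longrightarrow> mcong N (companion t d) (companion t' d')"
  unfolding mcong_def by (simp add: cong_iff_dvd_diff dvd_diff_commute)

lemma mcong_cancel:
  assumes "mcong N (of_int k * A) (of_int k * B)" "coprime k N"
  shows "mcong N A B"
  using assms unfolding mcong_def
  by (simp add: right_diff_distrib[symmetric] coprime_dvd_mult_right_iff coprime_commute)

definition scalar_mod :: "int \<Rightarrow> imat \<Rightarrow> bool" where
  "scalar_mod N A \<longleftrightarrow> N dvd m12 A \<and> N dvd m21 A \<and> N dvd m11 A - m22 A"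

text \<open>The quadratic form \<open>vdet u (mapp B u)\<close> has the coefficients
  \<open>m21 B\<close>, \<open>m22 B - m11 B\<close> and \<open>- m12 B\<close>. Its values at the
  three vectors determine them, so if \<open>N\<close> divided all three values, \<open>B\<close>
  would be scalar modulo \<open>N\<close>.\<close>

lemma cyclic_vector:
  assumes "\<not> scalar_mod N B"
  obtains u where "u \<in> {(1,0),(0,1),(1,1)}" "\<not> N dvd vdet u (mapp B u)"
proof -
  have "vdet (1,0) (mapp B (1,0)) = m21 B" "vdet (0,1) (mapp B (0,1)) = - m12 B"
    "vdet (1,1) (mapp B (1,1)) = m21 B + m22 B - m11 B - m12 B"
    by (simp_all add: vdet_def mapp_def)
  moreover have "N dvd m11 B - m22 B" if "N dvd m21 B" "N dvd m12 B" "N dvd m21 B + m22 B - m11 B - m12 B"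
  proof -
    have "m11 B - m22 B = m21 B - m12 B - (m21 B + m22 B - m11 B - m12 B)" by simp
    thus ?thesis using that by (metis dvd_diff)
  qed
  ultimately show ?thesis using assms that unfolding scalar_mod_def by (metis dvd_minus_iff insertCI)
qed

lemma scalar_mod_mcong: "mcong N A B \<Longrightarrow> scalar_mod N A \<longleftrightarrow> scalar_mod N B"
proof -
  have "scalar_mod N B" if "mcong N A B" "scalar_mod N A" for A B
  proof -
    have "m12 B = m12 A - (m12 A - m12 B)" "m21 B = m21 A - (m21 A - m21 B)"
      "m11 B - m22 B = (m11 A - m22 A) - (m11 A - m11 B) + (m22 A - m22 B)" by simp_all
    thus ?thesis using that unfolding scalar_mod_def mcong_def by (metis dvd_diff dvd_add)
  qed
  thus "mcong N A B \<Longrightarrow> ?thesis" using mcong_sym by blast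
qed

lemma scalar_mod_iff: "scalar_mod N A \<longleftrightarrow> mcong N A (of_int (m11 A))"
  by (auto simp: scalar_mod_def mcong_def dvd_diff_commute)

lemma scalar_mod_iff_ex: "scalar_mod N A \<longleftrightarrow> (\<exists>a. mcong N A (of_int a))"
  using scalar_mod_iff scalar_mod_mcong by (metis scalar_mod_def of_int_sel diff_self dvd_0_right)

text \<open>Both matrices are conjugate to the same companion matrix.\<close>
lemma cyclic_conj:
  fixes u u' :: "int \<times> int"
  assumes u: "mcong N (companion (mtr B) (mdet B)) (companion (mtr B') (mdet B'))" and nz: "mdet (basis_mat u B) \<noteq> 0"
  assumes H_def: "H = basis_mat u' B' * madj (basis_mat u B)"
  shows "mcong N (H * B) (B' * H)" "mdet H = mdet (basis_mat u' B') * mdet (basis_mat u B)"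
proof -
  let ?K = "basis_mat u B" and ?K' = "basis_mat u' B'"
  let ?C = "companion (mtr B) (mdet B)" and ?C' = "companion (mtr B') (mdet B')"
  \<comment> \<open>The exact identity \<open>B * K = K * C\<close> is multiplied by the adjugate on
    both sides, and the nonzero integer \<open>mdet K\<close> is cancelled. The modulus enters only
    when one companion matrix replaces the other.\<close>
  have "madj ?K * (B * ?K) * madj ?K = madj ?K * (?K * ?C) * madj ?K" by (simp add: basis_mat_companion)
  moreover have "madj ?K * (B * ?K) * madj ?K = (madj ?K * B) * (?K * madj ?K)"
    "madj ?K * (?K * ?C) * madj ?K = (madj ?K * ?K) * (?C * madj ?K)"
    by (simp_all only: mult.assoc)
  ultimately have "of_int (mdet ?K) * (madj ?K * B) = of_int (mdet ?K) * (?C * madj ?K)"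
    using of_int_mult_commute_imat[of "mdet ?K" "madj ?K * B"] by (simp only: madj_mult)
  hence "madj ?K * B = ?C * madj ?K" using nz of_int_mult_cancel_imat by blast
  hence "H * B = ?K' * (?C * madj ?K)" by (simp add: H_def mult.assoc)
  moreover have "B' * H = ?K' * (?C' * madj ?K)"
    by (simp add: H_def basis_mat_companion mult.assoc[symmetric])
  ultimately show "mcong N (H * B) (B' * H)" using u by (metis mcong_mult mcong_refl)
  show "mdet H = mdet (basis_mat u' B') * mdet (basis_mat u B)" by (simp add: H_def mdet_mult)
qed

section \<open>Isometries of layered trees\<close>

lemma group_Iso:
  assumes root: "root T \<in> verts T"
  shows "group (Iso T)"
proof -
  let ?S = "verts T" and ?H = "carrier (Iso T)"
  have sub: "subgroup ?H (BijGroup ?S)"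
  proof (rule group.subgroupI[OF group_BijGroup])
    show "?H \<subseteq> carrier (BijGroup ?S)" by (auto simp: Iso_def BijGroup_def)
    have "(\<lambda>x\<in>?S. x) \<in> ?H" using root by (auto simp: Iso_def id_Bij)
    thus "?H \<noteq> {}" by blast
  next
    fix f assume f: "f \<in> ?H"
    hence B: "f \<in> Bij ?S" and fr: "f (root T) = root T"
      and d: "\<And>v w. v \<in> ?S \<Longrightarrow> w \<in> ?S \<Longrightarrow> tree_dist T (f v) (f w) = tree_dist T v w"
      by (auto simp: Iso_def)
    let ?g = "\<lambda>x\<in>?S. inv_into ?S f x"
    have bij: "bij_betw f ?S ?S" using B by (simp add: Bij_def)
    have fg: "f (?g v) = v" "?g v \<in> ?S" if "v \<in> ?S" for v
      using that bij by (auto simp: bij_betw_inv_into_right Bij_inv_into_mem[OF B])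
    have "?g (root T) = root T"
      using root fr bij by (simp add: bij_betw_inv_into_left[OF bij root, unfolded fr])
    moreover have "tree_dist T (?g v) (?g w) = tree_dist T v w" if "v \<in> ?S" "w \<in> ?S" for v w
      using d[OF fg(2)[OF that(1)] fg(2)[OF that(2)]] by (simp only: fg(1)[OF that(1)] fg(1)[OF that(2)])
    ultimately have "?g \<in> ?H" using restrict_inv_into_Bij[OF B] by (simp add: Iso_def)
    thus "inv\<^bsub>BijGroup ?S\<^esub> f \<in> ?H" by (simp only: inv_BijGroup[OF B])
  next
    fix f g assume fg: "f \<in> ?H" "g \<in> ?H"
    hence "f \<in> Bij ?S" "g \<in> Bij ?S" by (auto simp: Iso_def)
    moreover from fg have "g v \<in> ?S" if "v \<in> ?S" for v
      using that by (auto simp: Iso_def dest: Bij_imp_funcset)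
    ultimately show "f \<otimes>\<^bsub>BijGroup ?S\<^esub> g \<in> ?H"
      using fg root by (auto simp: Iso_def BijGroup_def compose_Bij compose_eq)
  qed
  show ?thesis using subgroup.subgroup_is_group[OF sub group_BijGroup] by (simp add: Iso_def)
qed

lemma Iso_mult:
  assumes "f \<in> carrier (Iso T)" "g \<in> carrier (Iso T)"
  shows "f \<otimes>\<^bsub>Iso T\<^esub> g = compose (verts T) f g"
  using assms by (simp add: Iso_def BijGroup_def)

text \<open>A bijection that preserves and reflects adjacency does so for walks of each length
  \<open>k\<close>. The predicates under \<open>LEAST\<close> in \<open>tree_dist\<close> then
  coincide, whether or not a walk exists.\<close>

lemma IsoI:
  assumes f: "f \<in> Bij (verts T)" and root: "f (root T) = root T"
    and sub: "edges T \<subseteq> verts T \<times> verts T"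
    and iff: "\<And>v w. v \<in> verts T \<Longrightarrow> w \<in> verts T \<Longrightarrow> (f v, f w) \<in> edges T \<longleftrightarrow> (v, w) \<in> edges T"
  shows "f \<in> carrier (Iso T)"
proof -
  have bij: "bij_betw f (verts T) (verts T)" using f by (simp add: Bij_def)
  have "(f v, f w) \<in> edges T ^^ k \<longleftrightarrow> (v, w) \<in> edges T ^^ k" if "v \<in> verts T" "w \<in> verts T" for v w k
    using that(2)
  proof (induction k arbitrary: w)
    case 0
    thus ?case using that(1) bij by (auto simp: bij_betw_def inj_on_def)
  next
    case (Suc k)
    have "(f v, f w) \<in> edges T ^^ Suc k \<longleftrightarrow> (\<exists>y\<in>verts T. (f v, y) \<in> edges T ^^ k \<and> (y, f w) \<in> edges T)"
      using sub by auto
    also have "\<dots> \<longleftrightarrow> (\<exists>y\<in>f ` verts T. (f v, y) \<in> edges T ^^ k \<and> (y, f w) \<in> edges T)"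
      using bij by (simp only: bij_betw_def)
    also have "\<dots> \<longleftrightarrow> (\<exists>y\<in>verts T. (f v, f y) \<in> edges T ^^ k \<and> (f y, f w) \<in> edges T)"
      by simp
    also have "\<dots> \<longleftrightarrow> (\<exists>y\<in>verts T. (v, y) \<in> edges T ^^ k \<and> (y, w) \<in> edges T)"
      using Suc iff by blast
    also have "\<dots> \<longleftrightarrow> (v, w) \<in> edges T ^^ Suc k"
      using sub by auto
    finally show ?case .
  qed
  thus ?thesis using f root by (simp add: Iso_def tree_dist_def)
qed

text \<open>An equation between products can be checked on matrices without inverting
  \<open>h\<close>.\<close>

lemma (in group) conj_rel_iff:
  assumes "subgroup H G"
  shows "(g, g') \<in> conj_rel G H \<longleftrightarrow>
    g \<in> carrier G \<and> g' \<in> carrier G \<and> (\<exists>h\<in>H. g' \<otimes> h = h \<otimes> g)"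
proof -
  have "g' = h \<otimes> g \<otimes> inv h \<longleftrightarrow> g' \<otimes> h = h \<otimes> g"
    if "g \<in> carrier G" "g' \<in> carrier G" "h \<in> H" for h
  proof -
    have h: "h \<in> carrier G" using subgroup.mem_carrier[OF assms that(3)] .
    show ?thesis using that h inv_solve_right' inv_solve_right by (metis m_closed)
  qed
  thus ?thesis by (auto simp: conj_rel_def)
qed

lemma (in group) sym_conj_rel: "subgroup H G \<Longrightarrow> sym (conj_rel G H)"
proof (rule symI)
  fix g g' assume H: "subgroup H G" and "(g, g') \<in> conj_rel G H"
  then obtain h where *: "g \<in> carrier G" "g' \<in> carrier G" "h \<in> H" "g' \<otimes> h = h \<otimes> g"
    by (auto simp: conj_rel_iff)
  have h: "h \<in> carrier G" using subgroup.mem_carrier[OF H *(3)] .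
  have "inv h \<otimes> (g' \<otimes> h) \<otimes> inv h = inv h \<otimes> (h \<otimes> g) \<otimes> inv h" using * by simp
  hence "inv h \<otimes> g' = g \<otimes> inv h"
    using h *(1,2) by (simp add: m_assoc) (simp add: m_assoc[symmetric])
  thus "(g', g) \<in> conj_rel G H"
    using * subgroup.m_inv_closed[OF H *(3)] by (auto simp: conj_rel_iff[OF H] intro!: bexI[of _ "inv h"])
qed

lemma (in group) trans_conj_rel: "subgroup H G \<Longrightarrow> trans (conj_rel G H)"
proof (rule transI)
  fix g g' g'' assume H: "subgroup H G" and "(g, g') \<in> conj_rel G H" "(g', g'') \<in> conj_rel G H"
  then obtain h h' where *: "g \<in> carrier G" "g' \<in> carrier G" "g'' \<in> carrier G"
    "h \<in> H" "g' \<otimes> h = h \<otimes> g" "h' \<in> H" "g'' \<otimes> h' = h' \<otimes> g'"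
    by (auto simp: conj_rel_iff)
  have hh: "h \<in> carrier G" "h' \<in> carrier G" using subgroup.mem_carrier[OF H] * by blast+
  have "g'' \<otimes> (h' \<otimes> h) = (g'' \<otimes> h') \<otimes> h" using *(1-3) hh by (simp add: m_assoc)
  also have "\<dots> = h' \<otimes> (g' \<otimes> h)" unfolding *(7) using *(1-3) hh by (simp add: m_assoc)
  also have "\<dots> = h' \<otimes> h \<otimes> g" unfolding *(5) using *(1-3) hh by (simp add: m_assoc)
  finally show "(g, g'') \<in> conj_rel G H"
    using * subgroup.m_closed[OF H *(6,4)] by (auto simp: conj_rel_iff[OF H])
qed

lemma classes_meeting_eq:
  assumes "sym r" "trans r" "G \<subseteq> A" "\<And>g. g \<in> G \<Longrightarrow> (g, g) \<in> r"
  shows "classes_meeting A r G = (\<lambda>g. r `` {g}) ` G"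
proof (intro equalityI subsetI)
  fix X assume "X \<in> classes_meeting A r G"
  then obtain a g where "X = r `` {a}" "g \<in> X" "g \<in> G"
    by (auto simp: classes_meeting_def quotient_def)
  moreover from this have "X = r `` {g}" using assms(1,2) by (auto dest: symD transD)
  ultimately show "X \<in> (\<lambda>g. r `` {g}) ` G" by blast
next
  fix X assume "X \<in> (\<lambda>g. r `` {g}) ` G"
  then obtain g where "g \<in> G" "X = r `` {g}" by blast
  thus "X \<in> classes_meeting A r G" using assms(3,4)
    by (auto simp: classes_meeting_def quotient_def)
qed

lemma class_eq_iff:
  assumes "sym r" "trans r" "(g, g) \<in> r" "(g', g') \<in> r"
  shows "r `` {g} = r `` {g'} \<longleftrightarrow> (g, g') \<in> r"
  using assms by (auto dest: symD transD)

text \<open>The vertices of level \<open>n\<close> are the points \<open>W n w\<close>, and \<open>W n w\<close> is the parent of \<open>W (Suc n) w\<close>.\<close>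
locale layered =
  fixes W :: "nat \<Rightarrow> 'w \<Rightarrow> 'v" and P :: "'w set"
  assumes P_nonempty: "P \<noteq> {}"
    and level_unique: "\<And>n m w w'. w \<in> P \<Longrightarrow> w' \<in> P \<Longrightarrow> W n w = W m w' \<Longrightarrow> n = m"
    and parent_unique: "\<And>n w w'. w \<in> P \<Longrightarrow> w' \<in> P \<Longrightarrow> W (Suc n) w = W (Suc n) w' \<Longrightarrow> W n w = W n w'"
    and root_unique: "\<And>w w'. w \<in> P \<Longrightarrow> w' \<in> P \<Longrightarrow> W 0 w = W 0 w'"
begin

definition vts :: "nat set \<Rightarrow> 'v set" where
  "vts I = {W n w | n w. n \<in> I \<and> w \<in> P}"

definition child :: "nat set \<Rightarrow> ('v \<times> 'v) set" where
  "child I = {(W n w, W (Suc n) w) | n w. n \<in> I \<and> Suc n \<in> I \<and> w \<in> P}"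

definition tr :: "nat set \<Rightarrow> 'v rooted_tree" where
  "tr I = \<lparr>verts = vts I, edges = child I \<union> (child I)\<inverse>, root = W 0 (SOME w. w \<in> P)\<rparr>"

definition lvl :: "'v \<Rightarrow> nat" where "lvl v = (THE n. \<exists>w\<in>P. v = W n w)"

text \<open>Truncated subtraction makes the root its own parent, so \<open>aut\<close> can demand
  compatibility with \<open>par\<close> at every vertex.\<close>

definition par :: "'v \<Rightarrow> 'v" where
  "par v = (THE x. \<exists>n. \<exists>w\<in>P. v = W n w \<and> x = W (n - 1) w)"

definition aut :: "nat set \<Rightarrow> ('v \<Rightarrow> 'v) \<Rightarrow> bool" where
  "aut I f \<longleftrightarrow> f \<in> Bij (vts I) \<and> (\<forall>v\<in>vts I. lvl (f v) = lvl v \<and> f (par v) = par (f v))"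

lemma tr_simps [simp]: "verts (tr I) = vts I" "edges (tr I) = child I \<union> (child I)\<inverse>"
  by (simp_all add: tr_def)

lemma root_tr: "w \<in> P \<Longrightarrow> root (tr I) = W 0 w"
  unfolding tr_def rooted_tree.simps by (intro root_unique someI[of "\<lambda>w. w \<in> P"])

lemma lvl_W [simp]: "w \<in> P \<Longrightarrow> lvl (W n w) = n"
  unfolding lvl_def using level_unique by blast

lemma par_W: "w \<in> P \<Longrightarrow> par (W n w) = W (n - 1) w"
  unfolding par_def
proof (rule the_equality)
  fix x assume w: "w \<in> P" and "\<exists>m. \<exists>w'\<in>P. W n w = W m w' \<and> x = W (m - 1) w'"
  then obtain m w' where *: "w' \<in> P" "W n w = W m w'" "x = W (m - 1) w'" by blast
  moreover have "n = m" using level_unique w * by blast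
  ultimately show "x = W (n - 1) w" using w parent_unique[of w w' "n - 1"] by (cases n) auto
qed blast

lemma par_W_Suc [simp]: "w \<in> P \<Longrightarrow> par (W (Suc n) w) = W n w"
  by (simp add: par_W)

lemma vtsE: assumes "v \<in> vts I" obtains w where "w \<in> P" "v = W (lvl v) w" "lvl v \<in> I"
  using assms by (auto simp: vts_def)

lemma W_in_vts [intro]: "n \<in> I \<Longrightarrow> w \<in> P \<Longrightarrow> W n w \<in> vts I"
  unfolding vts_def by blast

lemma W_in_vts_iff [simp]: "w \<in> P \<Longrightarrow> W n w \<in> vts I \<longleftrightarrow> n \<in> I"
  by (metis W_in_vts lvl_W vtsE)

lemma child_iff: "(v, v') \<in> child I \<longleftrightarrow> v \<in> vts I \<and> v' \<in> vts I \<and> lvl v' = Suc (lvl v) \<and> v = par v'"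
proof
  assume R: "v \<in> vts I \<and> v' \<in> vts I \<and> lvl v' = Suc (lvl v) \<and> v = par v'"
  obtain w where w: "w \<in> P" "v' = W (lvl v') w" "lvl v' \<in> I" using R by (auto elim: vtsE)
  hence "v' = W (Suc (lvl v)) w" using R by simp
  moreover have "v = W (lvl v) w"
  proof -
    have "par v' = W (lvl v' - 1) w" using par_W[OF w(1), of "lvl v'"] w(2) by simp
    thus ?thesis using R by simp
  qed
  moreover have "lvl v \<in> I" using R by (auto elim: vtsE)
  ultimately show "(v, v') \<in> child I" unfolding child_def using w(1,3) R by auto
qed (auto simp: child_def)

lemma edges_subset: "edges (tr I) \<subseteq> verts (tr I) \<times> verts (tr I)"
  by (auto simp: child_def)

lemma par_in_vts: "v \<in> vts UNIV \<Longrightarrow> par v \<in> vts UNIV" by (fastforce simp: vts_def par_W)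
lemma lvl_par: "v \<in> vts I \<Longrightarrow> lvl (par v) = lvl v - 1" by (auto simp: vts_def par_W)

lemma aut_Iso:
  assumes "aut I f" "0 \<in> I"
  shows "f \<in> carrier (Iso (tr I))"
proof (rule IsoI)
  have B: "f \<in> Bij (vts I)" and l: "\<And>v. v \<in> vts I \<Longrightarrow> lvl (f v) = lvl v"
    and pr: "\<And>v. v \<in> vts I \<Longrightarrow> f (par v) = par (f v)"
    using assms by (auto simp: aut_def)
  have mem: "f v \<in> vts I" if "v \<in> vts I" for v using Bij_imp_funcset[OF B] that by auto
  have inj: "inj_on f (vts I)" using B by (auto simp: Bij_def bij_betw_def)
  show "f \<in> Bij (verts (tr I))" using B by simp
  obtain w where w: "w \<in> P" using P_nonempty by blast
  have "f (W 0 w) \<in> vts I" "lvl (f (W 0 w)) = 0" using mem l w assms(2) by auto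
  then obtain w' where "w' \<in> P" "f (W 0 w) = W 0 w'" by (metis vtsE)
  thus "f (root (tr I)) = root (tr I)" using root_tr[OF w, of I] root_tr[of w' I] by simp
  have "(f v, f v') \<in> child I \<longleftrightarrow> (v, v') \<in> child I" if "v \<in> vts I" "v' \<in> vts I" for v v'
  proof -
    have "par v' \<in> vts I" if "lvl v' = Suc (lvl v)"
      using that \<open>v \<in> vts I\<close> \<open>v' \<in> vts I\<close> by (metis W_in_vts par_W_Suc vtsE)
    hence "lvl v' = Suc (lvl v) \<Longrightarrow> f v = f (par v') \<longleftrightarrow> v = par v'"
      using inj that by (meson inj_onD)
    thus ?thesis unfolding child_iff using that mem l pr by metis
  qed
  thus "(f v, f v') \<in> edges (tr I) \<longleftrightarrow> (v, v') \<in> edges (tr I)" if "v \<in> verts (tr I)" "v' \<in> verts (tr I)" for v v'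
    using that by simp
qed (rule edges_subset)

text \<open>An edge changes the level by exactly one, so no walk from the root reaches level
  \<open>n\<close> in fewer than \<open>n\<close> steps. Truncation by distance thereby becomes
  truncation by level.\<close>

lemma dist_root:
  assumes "w \<in> P" "{..n} \<subseteq> I"
  shows "tree_dist (tr I) (root (tr I)) (W n w) = n"
  unfolding tree_dist_def
proof (rule Least_equality)
  show "(root (tr I), W n w) \<in> edges (tr I) ^^ n"
    using assms(2)
  proof (induction n)
    case 0 thus ?case using root_tr[OF assms(1)] by simp
  next
    case (Suc n)
    have "(W n w, W (Suc n) w) \<in> edges (tr I)" using Suc.prems assms(1) by (auto simp: child_iff)
    moreover have "(root (tr I), W n w) \<in> edges (tr I) ^^ n"
      using Suc.prems by (intro Suc.IH) auto
    ultimately show ?case by auto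
  qed
next
  fix k assume "(root (tr I), W n w) \<in> edges (tr I) ^^ k"
  moreover have "lvl v' \<le> lvl v + k" if "(v, v') \<in> edges (tr I) ^^ k" for v v'
    using that
  proof (induction k arbitrary: v')
    case (Suc k)
    then obtain y where y: "(v, y) \<in> edges (tr I) ^^ k" "(y, v') \<in> edges (tr I)" by auto
    hence "lvl v' \<le> lvl y + 1" by (auto simp: child_iff)
    thus ?case using Suc.IH[OF y(1)] by simp
  qed simp
  ultimately have "lvl (W n w) \<le> lvl (root (tr I)) + k" by blast
  thus "n \<le> k" using assms(1) root_tr[OF assms(1)] by simp
qed

lemma vts_mono: "I \<subseteq> J \<Longrightarrow> vts I \<subseteq> vts J" by (auto simp: vts_def)

lemma truncate_tr: "truncate_tree (tr UNIV) n = tr {..n}"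
proof -
  have "{v \<in> verts (tr UNIV). tree_dist (tr UNIV) (root (tr UNIV)) v \<le> n} = vts {..n}"
    using dist_root[of _ _ UNIV] by (fastforce simp: vts_def)
  moreover have "edges (tr UNIV) \<inter> vts {..n} \<times> vts {..n} = edges (tr {..n})"
    using vts_mono[of "{..n}" UNIV] by (auto simp: child_iff)
  moreover have "root (tr UNIV) = root (tr {..n})" by (simp add: tr_def)
  ultimately show ?thesis by (simp add: truncate_tree_def Let_def tr_def)
qed

lemma group_Iso_tr: "0 \<in> I \<Longrightarrow> group (Iso (tr I))"
  using P_nonempty root_tr by (intro group_Iso) fastforce

lemma autD:
  assumes "aut I f" "v \<in> vts I"
  shows "f v \<in> vts I" "lvl (f v) = lvl v" "par (f v) = f (par v)"
  using assms by (auto simp: aut_def dest: Bij_imp_funcset)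

lemma aut_funpow:
  assumes "aut UNIV f" "v \<in> vts UNIV"
  shows "(f ^^ i) v \<in> vts UNIV" "lvl ((f ^^ i) v) = lvl v" "par ((f ^^ i) v) = (f ^^ i) (par v)"
proof -
  have "(f ^^ i) v \<in> vts UNIV \<and> lvl ((f ^^ i) v) = lvl v \<and> par ((f ^^ i) v) = (f ^^ i) (par v)"
    by (induction i) (use assms autD[OF assms(1)] in auto)
  thus "(f ^^ i) v \<in> vts UNIV" "lvl ((f ^^ i) v) = lvl v" "par ((f ^^ i) v) = (f ^^ i) (par v)"
    by auto
qed

lemma funpow_mult_cong:
  fixes g :: "'b \<Rightarrow> 'b"
  assumes "(g ^^ i) r = (g ^^ j) r"
  shows "(g ^^ (e * i)) r = (g ^^ (e * j)) r"
proof (induction e)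
  case (Suc e)
  have "(g ^^ (Suc e * i)) r = (g ^^ i) ((g ^^ (e * j)) r)"
    using Suc by (simp add: funpow_add)
  also have "\<dots> = (g ^^ (e * j)) ((g ^^ i) r)" by (metis add.commute comp_apply funpow_add)
  also have "\<dots> = (g ^^ (Suc e * j)) r"
    unfolding assms by (metis add.commute comp_apply funpow_add mult_Suc)
  finally show ?case .
qed simp

text \<open>If \<open>g\<close> and \<open>g'\<close> have the same orbits, choose representatives \<open>R\<close> of these orbits, compatible
  with taking parents; then \<open>g^i R \<mapsto> g'^i R\<close> is a conjugating isometry.\<close>
lemma conj_of_same_orbits:
  assumes g: "aut UNIV g" and g': "aut UNIV g'"
    and pw: "\<And>n. \<exists>e. \<forall>v\<in>vts {n}. g' v = (g ^^ e) v"
    and pw': "\<And>n. \<exists>e. \<forall>v\<in>vts {n}. g v = (g' ^^ e) v"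
    and per: "\<And>n. \<exists>e>0. \<forall>v\<in>vts {n}. (g ^^ e) v = v"
  shows "(g, g') \<in> conj_rel (Iso (tr UNIV)) (carrier (Iso (tr UNIV)))"
proof -
  let ?V = "vts UNIV"
  have lev: "v \<in> vts {lvl v}" if "v \<in> ?V" for v using that by (auto elim!: vtsE simp: vts_def)
  have pow: "\<exists>e. \<forall>i. \<forall>v\<in>?V. lvl v = n \<longrightarrow> (f' ^^ i) v = (f ^^ (e * i)) v"
    if f: "aut UNIV f" "aut UNIV f'" and ex: "\<exists>e. \<forall>v\<in>vts {n}. f' v = (f ^^ e) v" for f f' n
  proof -
    obtain e where e: "\<And>v. v \<in> vts {n} \<Longrightarrow> f' v = (f ^^ e) v" using ex by blast
    have "(f' ^^ i) v = (f ^^ (e * i)) v" if "v \<in> ?V" "lvl v = n" for i v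
    proof (induction i)
      case (Suc i)
      have "(f' ^^ i) v \<in> vts {n}" using aut_funpow[OF f(2) that(1)] that(2) lev by metis
      thus ?case using Suc e by (simp add: funpow_add)
    qed simp
    thus ?thesis by blast
  qed
  define Orb where "Orb v = {(g ^^ i) v | i. True}" for v
  have Orb_sub: "Orb u \<subseteq> Orb v" if u: "u \<in> Orb v" for u v
  proof
    fix x assume "x \<in> Orb u"
    then obtain i j where "x = (g ^^ i) ((g ^^ j) v)" using u unfolding Orb_def by blast
    hence "x = (g ^^ (i + j)) v" by (simp add: funpow_add)
    thus "x \<in> Orb v" by (auto simp: Orb_def)
  qed
  \<comment> \<open>\<open>Orb\<close> uses only nonnegative powers; the period \<open>e\<close> of
    \<open>g\<close> on the level turns \<open>g^(-i)\<close> into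
    \<open>g^(i * e - i)\<close>.\<close>
  have Orb_sym: "v \<in> Orb u" if u: "u \<in> Orb v" and v: "v \<in> ?V" for u v
  proof -
    obtain i where i: "u = (g ^^ i) v" using u by (auto simp: Orb_def)
    obtain e where e: "e > 0" "\<And>x. x \<in> vts {lvl v} \<Longrightarrow> (g ^^ e) x = x" using per by blast
    have "(g ^^ (i * e)) v = v"
      using funpow_mult_cong[where g = g and i = e and r = v and j = 0 and e = i] e(2)[OF lev[OF v]] by (simp add: mult.commute)
    moreover have "(g ^^ (i * e)) v = (g ^^ (i * e - i)) u"
    proof -
      have "i * e - i + i = i * e" using e(1) by (cases e) auto
      thus ?thesis unfolding i by (metis comp_apply funpow_add)
    qed
    ultimately show ?thesis unfolding Orb_def by force
  qed
  have Orb_eq: "Orb u = Orb v" if "u \<in> Orb v" "v \<in> ?V" for u v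
    using Orb_sub[OF that(1)] Orb_sub[OF Orb_sym[OF that]] by auto
  have Orb_mem: "u \<in> ?V" "lvl u = lvl v" "par u \<in> Orb (par v)" if "u \<in> Orb v" "v \<in> ?V" for u v
    using that aut_funpow[OF g that(2)] by (auto simp: Orb_def)
  have Orb_refl: "v \<in> Orb v" for v unfolding Orb_def by (force intro: exI[of _ 0])

  \<comment> \<open>Recursion over the level: the representative of an orbit is chosen above the
    representative of the parent's orbit. Such a point exists because a power of \<open>g\<close>
    moves the parent to its representative and carries the child along.\<close>
  define rep where "rep = rec_nat (\<lambda>v. v) (\<lambda>_ F v. SOME r. r \<in> Orb v \<and> par r = F (par v))"
  have rep_0: "rep 0 v = v" for v by (simp add: rep_def)
  have rep_Suc: "rep (Suc n) v = (SOME r. r \<in> Orb v \<and> par r = rep n (par v))" for n v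
    by (simp add: rep_def)
  have rep_Orb: "rep n v \<in> Orb v \<and> (\<forall>u\<in>Orb v. rep n u = rep n v)" if "v \<in> ?V" "lvl v = n" for n v
    using that
  proof (induction n arbitrary: v)
    case 0
    have "u = v" if "u \<in> Orb v" for u
      using Orb_mem[OF that 0(1)] 0 root_unique by (metis vtsE)
    thus ?case using Orb_refl by (simp add: rep_0)
  next
    case (Suc n)
    have pv: "par v \<in> ?V" "lvl (par v) = n" using Suc.prems par_in_vts lvl_par by auto
    obtain i where "rep n (par v) = (g ^^ i) (par v)" using Suc.IH[OF pv] by (auto simp: Orb_def)
    hence "(g ^^ i) v \<in> Orb v \<and> par ((g ^^ i) v) = rep n (par v)"
      using aut_funpow[OF g Suc.prems(1)] by (auto simp: Orb_def)
    hence "rep (Suc n) v \<in> Orb v" unfolding rep_Suc by (rule someI2) blast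
    moreover have "rep (Suc n) u = rep (Suc n) v" if "u \<in> Orb v" for u
      using Orb_eq[OF that Suc.prems(1)] Suc.IH[OF pv] Orb_mem(3)[OF that Suc.prems(1)]
      by (simp add: rep_Suc)
    ultimately show ?case by blast
  qed
  have rep_par: "par (rep (Suc n) v) = rep n (par v)" if "v \<in> ?V" "lvl v = Suc n" for n v
  proof -
    have pv: "par v \<in> ?V" "lvl (par v) = n" using that par_in_vts lvl_par by auto
    obtain i where "rep n (par v) = (g ^^ i) (par v)" using rep_Orb[OF pv] by (auto simp: Orb_def)
    hence "(g ^^ i) v \<in> Orb v \<and> par ((g ^^ i) v) = rep n (par v)"
      using aut_funpow[OF g that(1)] by (auto simp: Orb_def)
    thus ?thesis unfolding rep_Suc by (rule someI2) blast
  qed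

  define R where "R v = rep (lvl v) v" for v
  have R_Orb: "R v \<in> Orb v" if "v \<in> ?V" for v using rep_Orb[OF that refl] by (simp add: R_def)
  have R_V: "R v \<in> ?V" "lvl (R v) = lvl v" if "v \<in> ?V" for v
    using Orb_mem[OF R_Orb[OF that] that] by auto
  have R_eq: "R u = R v" if "u \<in> Orb v" "v \<in> ?V" for u v
    using rep_Orb[OF that(2) refl] that Orb_mem(2)[OF that] by (auto simp: R_def)
  have R_par: "par (R v) = R (par v)" if v: "v \<in> ?V" for v
  proof (cases "lvl v")
    case 0
    hence "v = W 0 w" if "w \<in> P" for w using v that root_unique by (metis vtsE)
    moreover obtain w where "w \<in> P" using P_nonempty by blast
    ultimately show ?thesis by (simp add: R_def rep_0 par_W)
  next
    case (Suc n)
    thus ?thesis using rep_par[OF v Suc] lvl_par[OF v] by (simp add: R_def)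
  qed
  \<comment> \<open>A coincidence of \<open>g\<close>-powers at \<open>r\<close> passes to
    \<open>g'\<close>, because on the level of \<open>r\<close> the map \<open>g'\<close> is one
    fixed power \<open>g^e\<close>. The converse, \<open>wd'\<close>, will give injectivity.\<close>
  have wd: "(g' ^^ i) r = (g' ^^ j) r" if "(g ^^ i) r = (g ^^ j) r" "r \<in> ?V" for i j r
    using pow[OF g g' pw, of "lvl r"] funpow_mult_cong[OF that(1)] that(2) by metis
  have wd': "(g ^^ i) r = (g ^^ j) r" if "(g' ^^ i) r = (g' ^^ j) r" "r \<in> ?V" for i j r
    using pow[OF g' g pw', of "lvl r"] funpow_mult_cong[OF that(1)] that(2) by metis

  define \<phi> where "\<phi> = (\<lambda>v\<in>?V. (g' ^^ (SOME i. v = (g ^^ i) (R v))) (R v))"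
  have ex: "\<exists>i. v = (g ^^ i) (R v)" if "v \<in> ?V" for v
    using Orb_sym[OF R_Orb[OF that] that] by (auto simp: Orb_def)
  have \<phi>: "\<phi> v = (g' ^^ i) (R v)" if v: "v \<in> ?V" and i: "v = (g ^^ i) (R v)" for v i
  proof -
    have "v = (g ^^ (SOME i. v = (g ^^ i) (R v))) (R v)" using i by (rule someI)
    hence "(g ^^ (SOME i. v = (g ^^ i) (R v))) (R v) = (g ^^ i) (R v)" using i by simp
    from wd[OF this R_V(1)[OF v]] show ?thesis using v by (simp add: \<phi>_def)
  qed
  have \<phi>_V: "\<phi> v \<in> ?V" "lvl (\<phi> v) = lvl v" if v: "v \<in> ?V" for v
  proof -
    obtain i where "v = (g ^^ i) (R v)" using ex[OF v] by blast
    from \<phi>[OF v this] show "\<phi> v \<in> ?V" "lvl (\<phi> v) = lvl v"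
      using aut_funpow[OF g' R_V(1)[OF v]] R_V(2)[OF v] by auto
  qed
  have \<phi>_Orb: "\<phi> v \<in> Orb v" if v: "v \<in> ?V" for v
  proof -
    obtain i where "v = (g ^^ i) (R v)" using ex[OF v] by blast
    moreover obtain e where "(g' ^^ i) (R v) = (g ^^ (e * i)) (R v)"
      using pow[OF g g' pw, of "lvl (R v)"] R_V(1)[OF v] by metis
    ultimately have "\<phi> v \<in> Orb (R v)" using \<phi>[OF v] by (auto simp: Orb_def)
    thus ?thesis using Orb_eq[OF R_Orb[OF v] that] by simp
  qed
  have \<phi>_g: "\<phi> (g v) = g' (\<phi> v)" if v: "v \<in> ?V" for v
  proof -
    obtain i where i: "v = (g ^^ i) (R v)" using ex[OF v] by blast
    have "g v \<in> Orb v" unfolding Orb_def by (force intro: exI[of _ 1])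
    hence "R (g v) = R v" using R_eq v by blast
    moreover from this have "g v = (g ^^ Suc i) (R (g v))" using i by simp
    ultimately show ?thesis using \<phi>[OF autD(1)[OF g v], of "Suc i"] \<phi>[OF v i] by simp
  qed
  have \<phi>_par: "\<phi> (par v) = par (\<phi> v)" if v: "v \<in> ?V" for v
  proof -
    obtain i where i: "v = (g ^^ i) (R v)" using ex[OF v] by blast
    have "par v = (g ^^ i) (R (par v))"
      using i aut_funpow(3)[OF g R_V(1)[OF v]] R_par[OF v] by metis
    from \<phi>[OF par_in_vts[OF v] this] \<phi>[OF v i] show ?thesis
      using aut_funpow(3)[OF g' R_V(1)[OF v]] R_par[OF v] by metis
  qed
  have "bij_betw \<phi> ?V ?V"
  proof (rule bij_betwI')
    fix u v assume uv: "u \<in> ?V" "v \<in> ?V"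
    show "\<phi> u = \<phi> v \<longleftrightarrow> u = v"
    proof
      assume eq: "\<phi> u = \<phi> v"
      have "Orb u = Orb v" using \<phi>_Orb[OF uv(1)] \<phi>_Orb[OF uv(2)] uv Orb_eq eq by metis
      hence R: "R u = R v" using Orb_refl R_eq uv by blast
      obtain i j where ij: "u = (g ^^ i) (R u)" "v = (g ^^ j) (R v)" using ex uv by metis
      have "(g' ^^ i) (R u) = (g' ^^ j) (R u)" using \<phi>[OF uv(1) ij(1)] \<phi>[OF uv(2) ij(2)] eq R by simp
      from wd'[OF this R_V(1)[OF uv(1)]] show "u = v" using ij R by metis
    qed simp
  next
    fix v assume v: "v \<in> ?V"
    show "\<phi> v \<in> ?V" using \<phi>_V v by blast
    obtain i where i: "v = (g ^^ i) (R v)" using ex[OF v] by blast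
    \<comment> \<open>Once \<open>v\<close> is written as a power of \<open>g'\<close> applied to
      \<open>R v\<close>, the same power of \<open>g\<close> yields its preimage.\<close>
    obtain f where f: "(g ^^ i) (R v) = (g' ^^ (f * i)) (R v)"
      using pow[OF g' g pw', of "lvl (R v)"] R_V(1)[OF v] by metis
    let ?u = "(g ^^ (f * i)) (R v)"
    have uV: "?u \<in> ?V" using aut_funpow[OF g R_V(1)[OF v]] by blast
    have "?u \<in> Orb (R v)" by (auto simp: Orb_def)
    hence "R ?u = R v" using Orb_eq[OF R_Orb[OF v] v] R_eq v by blast
    hence "\<phi> ?u = v" using \<phi>[OF uV, of "f * i"] f i by simp
    thus "\<exists>u\<in>?V. v = \<phi> u" by (intro bexI[OF _ uV]) simp
  qed
  hence "aut UNIV \<phi>" using \<phi>_V \<phi>_par by (auto simp: aut_def Bij_def \<phi>_def)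
  hence I: "\<phi> \<in> carrier (Iso (tr UNIV))" "g \<in> carrier (Iso (tr UNIV))" "g' \<in> carrier (Iso (tr UNIV))"
    using aut_Iso g g' by auto
  moreover have "g' \<otimes>\<^bsub>Iso (tr UNIV)\<^esub> \<phi> = \<phi> \<otimes>\<^bsub>Iso (tr UNIV)\<^esub> g"
    using I \<phi>_g by (auto simp: Iso_mult compose_def)
  ultimately show ?thesis
    using group.conj_rel_iff[OF group_Iso_tr group.subgroup_self[OF group_Iso_tr]] by blast
qed

end

section \<open>The lattice tree in integer coordinates\<close>

text \<open>A \<open>p\<close>-adic integer is also given by an arbitrary coherent sequence of integers, whose \<open>n\<close>-th entry matters
  only modulo \<open>p ^ n\<close>; \<open>red\<close> passes to the reduced residues that form the carrier of \<open>Zp\<close>.\<close>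
definition coh :: "nat \<Rightarrow> (nat \<Rightarrow> int) \<Rightarrow> bool" where
  "coh p x \<longleftrightarrow> (\<forall>n. [x (Suc n) = x n] (mod int p ^ n))"

definition red :: "nat \<Rightarrow> (nat \<Rightarrow> int) \<Rightarrow> padic" where
  "red p x = (\<lambda>n. x n mod int p ^ n)"

definition cvec :: "nat \<Rightarrow> int \<times> int \<Rightarrow> vec" where
  "cvec p w = (red p (\<lambda>_. fst w), red p (\<lambda>_. snd w))"

definition Pr :: "nat \<Rightarrow> (int \<times> int) set" where
  "Pr p = {w. \<not> (int p dvd fst w \<and> int p dvd snd w)}"

definition W :: "nat \<Rightarrow> nat \<Rightarrow> int \<times> int \<Rightarrow> vec set set" where
  "W p n w = coset_class p n (cvec p w)"

lemma cohI: "(\<And>n. [x (Suc n) = x n] (mod int p ^ n)) \<Longrightarrow> coh p x" by (simp add: coh_def)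

lemma coh_le:
  assumes "coh p x" "m \<le> n" shows "[x n = x m] (mod int p ^ m)"
  using assms(2)
proof (induction n rule: dec_induct)
  case (step n)
  have "int p ^ m dvd int p ^ n" using step by (simp add: le_imp_power_dvd)
  hence "[x (Suc n) = x n] (mod int p ^ m)" using assms(1) cong_dvd_modulus coh_def by blast
  thus ?case using step cong_trans by blast
qed simp

lemma coh_add: "coh p x \<Longrightarrow> coh p y \<Longrightarrow> coh p (\<lambda>n. x n + y n)" by (simp add: coh_def cong_add)
lemma coh_diff: "coh p x \<Longrightarrow> coh p y \<Longrightarrow> coh p (\<lambda>n. x n - y n)" by (simp add: coh_def cong_diff)
lemma coh_mult: "coh p x \<Longrightarrow> coh p y \<Longrightarrow> coh p (\<lambda>n. x n * y n)" by (simp add: coh_def cong_mult)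
lemma coh_minus: "coh p x \<Longrightarrow> coh p (\<lambda>n. - x n)" by (simp add: coh_def cong_minus_minus_iff)
lemma coh_const: "coh p (\<lambda>n. c)" by (simp add: coh_def)
lemmas coh_intros = coh_add coh_diff coh_mult coh_minus coh_const

locale prime_tree =
  fixes p :: nat
  assumes prime_p: "Factorial_Ring.prime p"
begin

lemma p_gt_1: "int p > 1" using prime_p prime_gt_1_nat by fastforce
lemma p_pos [simp]: "int p > 0" "p > 0" using p_gt_1 by auto
lemma prime_int_p: "Factorial_Ring.prime (int p)" using prime_p by simp
lemma pow_pos [simp]: "int p ^ n > 0" by simp

lemma coprime_pow: "\<not> int p dvd a \<Longrightarrow> coprime a (int p ^ n)"
  using prime_imp_coprime[OF prime_int_p] by (simp add: coprime_commute)

lemma not_dvd_2: "p \<noteq> 2 \<Longrightarrow> \<not> int p dvd 2"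
  using prime_ge_2_nat[OF prime_p] zdvd_imp_le[of "int p" 2] by auto

lemma coprime_4: "p \<noteq> 2 \<Longrightarrow> coprime 4 (int p ^ n)"
  using not_dvd_2 prime_dvd_mult_iff[OF prime_int_p, of 2 2] coprime_pow[of 4 n] by simp

lemma not_dvd_cong:
  assumes "[a = b] (mod int p ^ n)" "n > 0" shows "int p dvd a \<longleftrightarrow> int p dvd b"
proof -
  have "int p dvd int p ^ n" using assms(2) by (simp add: dvd_power)
  thus ?thesis using assms(1) cong_dvd_iff cong_dvd_modulus by blast
qed

lemma Zp_mem: "x \<in> carrier (Zp p) \<longleftrightarrow> coh p x \<and> (\<forall>n. x n mod int p ^ n = x n)"
proof -
  have "x n \<in> {0..<int p ^ n} \<longleftrightarrow> x n mod int p ^ n = x n" for n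
    by (metis atLeastLessThan_iff mod_pos_pos_trivial pos_mod_bound pos_mod_sign pow_pos)
  thus ?thesis by (auto simp: Zp_def coh_def)
qed

lemma red_mem: "coh p x \<Longrightarrow> red p x \<in> carrier (Zp p)"
  unfolding Zp_mem red_def coh_def
  by (metis (no_types, lifting) cong_def cong_mod_pow mod_mod_trivial)

lemma red_id: "x \<in> carrier (Zp p) \<Longrightarrow> red p x = x" by (auto simp: Zp_mem red_def)
lemma red_cong: "[red p x n = x n] (mod int p ^ n)" by (simp add: red_def)
lemma red_eq_iff: "red p x n = red p y n \<longleftrightarrow> [x n = y n] (mod int p ^ n)" by (simp add: red_def cong_def)

lemma Zp_eqI:
  assumes "x \<in> carrier (Zp p)" "y \<in> carrier (Zp p)" "\<And>n. [x n = y n] (mod int p ^ n)"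
  shows "x = y"
  using assms unfolding Zp_mem cong_def by (metis ext)

lemma Zp_ops:
  "x \<oplus>\<^bsub>Zp p\<^esub> y = red p (\<lambda>n. x n + y n)" "x \<otimes>\<^bsub>Zp p\<^esub> y = red p (\<lambda>n. x n * y n)"
  "\<one>\<^bsub>Zp p\<^esub> = red p (\<lambda>_. 1)" "\<zero>\<^bsub>Zp p\<^esub> = (\<lambda>_. 0)"
  by (simp_all add: Zp_def red_def)

sublocale Z: cring "Zp p" by (rule Zp_cring) simp

lemma Zp_add_pow: "y \<in> carrier (Zp p) \<Longrightarrow> add_pow (Zp p) (k :: nat) y = red p (\<lambda>n. int k * y n)"
proof (induction k)
  case 0 thus ?case by (simp add: Zp_ops red_def)
next
  case (Suc k) thus ?case by (simp add: Zp_ops red_def mod_simps algebra_simps)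
qed

lemma Zp_divide:
  assumes x: "x \<in> carrier (Zp p)"
  shows "(\<exists>y\<in>carrier (Zp p). x = add_pow (Zp p) (p ^ n) y) \<longleftrightarrow> x n = 0"
proof
  assume "\<exists>y\<in>carrier (Zp p). x = add_pow (Zp p) (p ^ n) y"
  thus "x n = 0" by (auto simp: Zp_add_pow red_def)
next
  assume 0: "x n = 0"
  have c: "coh p x" using x Zp_mem by blast
  have dvd: "int p ^ n dvd x (n + k)" for k
    using coh_le[OF c, of n "n + k"] 0 by (simp add: cong_0_iff)
  \<comment> \<open>The entry of index \<open>n + k\<close> is known modulo
    \<open>p ^ (n + k)\<close>, so after division by \<open>p ^ n\<close> it is still known modulo
    \<open>p ^ k\<close>.\<close>
  define y where "y = (\<lambda>k. x (n + k) div int p ^ n)"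
  have y: "int p ^ n * y k = x (n + k)" for k using dvd by (simp add: y_def)
  have "coh p y"
  proof (rule cohI)
    fix k
    have "[int p ^ n * y (Suc k) = int p ^ n * y k] (mod int p ^ (n + k))"
      unfolding y using coh_le[OF c, of "n + k" "Suc (n + k)"] by simp
    thus "[y (Suc k) = y k] (mod int p ^ k)"
      using p_pos by (auto simp: cong_iff_dvd_diff power_add right_diff_distrib[symmetric])
  qed
  hence r: "red p y \<in> carrier (Zp p)" by (rule red_mem)
  have "x = add_pow (Zp p) (p ^ n) (red p y)"
  proof (rule Zp_eqI[OF x])
    show "add_pow (Zp p) (p ^ n) (red p y) \<in> carrier (Zp p)" using r by simp
    fix k
    have "[x k = x (n + k)] (mod int p ^ k)" using coh_le[OF c, of k "n + k"] by (simp add: cong_sym)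
    also have "x (n + k) = int p ^ n * y k" by (simp add: y)
    also have "[\<dots> = add_pow (Zp p) (p ^ n) (red p y) k] (mod int p ^ k)"
      unfolding Zp_add_pow[OF r] by (simp add: red_def cong_def mod_simps)
    finally show "[x k = add_pow (Zp p) (p ^ n) (red p y) k] (mod int p ^ k)" .
  qed
  thus "\<exists>y\<in>carrier (Zp p). x = add_pow (Zp p) (p ^ n) y" using r by blast
qed

lemma padic_val_0:
  assumes "x \<in> carrier (Zp p)"
  shows "padic_val p x = 0 \<longleftrightarrow> \<not> int p dvd x 1"
proof -
  have x1: "x 1 mod int p = x 1" using assms Zp_mem[of x] by (metis power_one_right)
  have eq: "padic_val p x = Sup {enat k | k. x k = 0}" using Zp_divide[OF assms] by (simp add: padic_val_def)
  show ?thesis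
  proof
    assume "padic_val p x = 0"
    hence "enat 1 \<le> 0" if "x 1 = 0" unfolding eq using that by (metis (mono_tags, lifting) Sup_upper mem_Collect_eq)
    thus "\<not> int p dvd x 1" using x1 by (auto simp: enat_0_iff zero_enat_def)
  next
    assume a: "\<not> int p dvd x 1"
    have "x k \<noteq> 0" if "k > 0" for k
      using coh_le[of p x 1 k] assms a that by (auto simp: Zp_mem cong_def)
    hence "k = 0" if "x k = 0" for k using that by (cases k) auto
    hence "Sup {enat k | k. x k = 0} \<le> 0" by (intro Sup_least) (auto simp: zero_enat_def)
    thus "padic_val p x = 0" unfolding eq by simp
  qed
qed

text \<open>Inverses are chosen separately modulo each \<open>p ^ n\<close>; their uniqueness there
  makes the choices coherent.\<close>

lemma Units_iff: "x \<in> Units (Zp p) \<longleftrightarrow> x \<in> carrier (Zp p) \<and> \<not> int p dvd x 1"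
proof
  assume "x \<in> Units (Zp p)"
  then obtain y where x: "x \<in> carrier (Zp p)" and "y \<otimes>\<^bsub>Zp p\<^esub> x = \<one>\<^bsub>Zp p\<^esub>" by (auto simp: Units_def)
  hence "red p (\<lambda>n. y n * x n) 1 = red p (\<lambda>_. 1) 1" by (simp add: Zp_ops)
  hence "[y 1 * x 1 = 1] (mod int p)" by (simp add: red_eq_iff)
  thus "x \<in> carrier (Zp p) \<and> \<not> int p dvd x 1" using x p_gt_1
    by (metis cong_dvd_iff dvd_mult prime_int_p not_prime_unit)
next
  assume a: "x \<in> carrier (Zp p) \<and> \<not> int p dvd x 1"
  hence c: "coh p x" by (simp add: Zp_mem)
  have "\<exists>y. [x n * y = 1] (mod int p ^ n)" for n
  proof (cases "n = 0")
    case False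
    hence "\<not> int p dvd x n" using a not_dvd_cong[of "x n" "x 1" 1] coh_le[OF c, of 1 n] by auto
    thus ?thesis using cong_solve_coprime_int coprime_pow by blast
  qed simp
  then obtain y where y: "\<And>n. [x n * y n = 1] (mod int p ^ n)" by metis
  have cy: "coh p y"
  proof (rule cohI)
    fix n
    have "[x n * y (Suc n) = x (Suc n) * y (Suc n)] (mod int p ^ n)"
      using c by (intro cong_mult) (auto simp: coh_def cong_sym)
    also have "[x (Suc n) * y (Suc n) = 1] (mod int p ^ n)"
      by (rule cong_dvd_modulus[OF y]) simp
    also have "[1 = x n * y n] (mod int p ^ n)" using y cong_sym by blast
    finally have "[y n * (x n * y (Suc n)) = y n * (x n * y n)] (mod int p ^ n)" by (rule cong_scalar_left)
    hence "[(x n * y n) * y (Suc n) = (x n * y n) * y n] (mod int p ^ n)" by (simp add: algebra_simps)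
    moreover have "[(x n * y n) * z = 1 * z] (mod int p ^ n)" for z using y by (rule cong_scalar_right)
    ultimately show "[y (Suc n) = y n] (mod int p ^ n)" using cong_trans cong_sym by (metis mult_1)
  qed
  have "red p y \<otimes>\<^bsub>Zp p\<^esub> x = \<one>\<^bsub>Zp p\<^esub>"
    unfolding Zp_ops by (rule ext, unfold red_eq_iff) (use y in \<open>simp add: red_def cong_def mod_simps mult.commute\<close>)
  thus "x \<in> Units (Zp p)" using a red_mem[OF cy] Z.m_comm[of x "red p y"] unfolding Units_def by auto
qed

lemma L0_carrier: "carrier (L0 p) = carrier (Zp p) \<times> carrier (Zp p)"
  by (simp add: L0_def RDirProd_carrier)

sublocale L: ring "L0 p"
  unfolding L0_def by (rule RDirProd_ring) (rule Z.ring_axioms)+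

lemma L0_add: "u \<oplus>\<^bsub>L0 p\<^esub> v = (fst u \<oplus>\<^bsub>Zp p\<^esub> fst v, snd u \<oplus>\<^bsub>Zp p\<^esub> snd v)"
  by (simp add: L0_def RDirProd_def DirProd_def monoid.defs split_beta)

lemma L0_zero: "\<zero>\<^bsub>L0 p\<^esub> = (\<zero>\<^bsub>Zp p\<^esub>, \<zero>\<^bsub>Zp p\<^esub>)"
  by (simp add: L0_def RDirProd_def DirProd_def monoid.defs)

lemma L0_add_pow: "u \<in> carrier (L0 p) \<Longrightarrow>
    add_pow (L0 p) (k :: nat) u = (add_pow (Zp p) k (fst u), add_pow (Zp p) k (snd u))"
proof (induction k)
  case (Suc k)
  thus ?case by (simp add: L0_add)
qed (simp add: L0_zero)

lemma L0_minus:
  assumes "u \<in> carrier (L0 p)" "v \<in> carrier (L0 p)"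
  shows "u \<ominus>\<^bsub>L0 p\<^esub> v = (red p (\<lambda>n. fst u n - fst v n), red p (\<lambda>n. snd u n - snd v n))"
proof -
  let ?w = "(red p (\<lambda>n. - fst v n), red p (\<lambda>n. - snd v n))"
  have w: "?w \<in> carrier (L0 p)"
    using assms by (auto simp: L0_carrier intro!: red_mem coh_minus) (simp_all add: Zp_mem)
  have "?w \<oplus>\<^bsub>L0 p\<^esub> v = \<zero>\<^bsub>L0 p\<^esub>"
    by (simp add: L0_add L0_zero Zp_ops red_def mod_simps)
  hence "\<ominus>\<^bsub>L0 p\<^esub> v = ?w" using w assms(2) by (metis L.minus_equality)
  thus ?thesis by (simp add: L.minus_eq L0_add Zp_ops red_def mod_simps)
qed

lemma primitive_iff: "primitive p u \<longleftrightarrow> u \<in> carrier (L0 p) \<and> \<not> (int p dvd fst u 1 \<and> int p dvd snd u 1)"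
proof (cases "u \<in> carrier (L0 p)")
  case True
  hence "fst u \<in> carrier (Zp p)" "snd u \<in> carrier (Zp p)" by (auto simp: L0_carrier)
  moreover have "nu p u = 0 \<longleftrightarrow> padic_val p (fst u) = 0 \<or> padic_val p (snd u) = 0"
    by (auto simp: nu_def min_def zero_enat_def[symmetric])
  ultimately show ?thesis using True by (auto simp: primitive_def padic_val_0)
qed (simp add: primitive_def)

lemma pL_iff: "u \<in> pL p n \<longleftrightarrow> u \<in> carrier (L0 p) \<and> fst u n = 0 \<and> snd u n = 0"
proof
  assume "u \<in> pL p n"
  then obtain v where "v \<in> carrier (L0 p)" "u = add_pow (L0 p) (p ^ n) v" by (auto simp: pL_def)
  thus "u \<in> carrier (L0 p) \<and> fst u n = 0 \<and> snd u n = 0"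
    using L0_add_pow by (auto simp: L0_carrier Zp_add_pow) (simp_all add: red_def)
next
  assume a: "u \<in> carrier (L0 p) \<and> fst u n = 0 \<and> snd u n = 0"
  then obtain y z where "y \<in> carrier (Zp p)" "z \<in> carrier (Zp p)"
    "fst u = add_pow (Zp p) (p ^ n) y" "snd u = add_pow (Zp p) (p ^ n) z"
    using Zp_divide by (metis L0_carrier mem_Times_iff)
  hence "u = add_pow (L0 p) (p ^ n) (y, z)" "(y, z) \<in> carrier (L0 p)"
    by (simp_all add: L0_add_pow L0_carrier prod_eq_iff)
  thus "u \<in> pL p n" unfolding pL_def by blast
qed

definition eqv :: "nat \<Rightarrow> vec \<Rightarrow> vec \<Rightarrow> bool" where
  "eqv n u v \<longleftrightarrow> fst u n = fst v n \<and> snd u n = snd v n"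

lemma coset_eq:
  assumes u: "u \<in> carrier (L0 p)"
  shows "coset p n u = {v \<in> carrier (L0 p). eqv n v u}"
proof (intro equalityI subsetI)
  fix v assume "v \<in> coset p n u"
  then obtain h where h: "h \<in> pL p n" "v = u \<oplus>\<^bsub>L0 p\<^esub> h"
    by (auto simp: coset_def a_l_coset_def')
  hence "v \<in> carrier (L0 p)" using u pL_iff by simp
  moreover have "eqv n v u" using h u pL_iff[of h n]
    by (auto simp: eqv_def L0_add Zp_ops red_def L0_carrier Zp_mem)
  ultimately show "v \<in> {v \<in> carrier (L0 p). eqv n v u}" by simp
next
  fix v assume "v \<in> {v \<in> carrier (L0 p). eqv n v u}"
  hence v: "v \<in> carrier (L0 p)" "eqv n v u" by auto
  hence "v \<ominus>\<^bsub>L0 p\<^esub> u \<in> pL p n" using u L.minus_closed[OF v(1) u]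
    unfolding pL_iff by (simp add: L0_minus eqv_def) (simp add: red_def)
  moreover have "v = u \<oplus>\<^bsub>L0 p\<^esub> (v \<ominus>\<^bsub>L0 p\<^esub> u)" using u v
    by (metis L.a_assoc L.a_comm L.a_inv_closed L.minus_eq L.r_neg L.r_zero)
  ultimately show "v \<in> coset p n u" unfolding coset_def a_l_coset_def' by blast
qed

lemma coset_eq_iff:
  assumes u: "u \<in> carrier (L0 p)" and v: "v \<in> carrier (L0 p)"
  shows "coset p n u = coset p m v \<longleftrightarrow> n = m \<and> eqv n u v"
proof -
  have False if "n < m" "coset p n u = coset p m v" "u \<in> carrier (L0 p)" "v \<in> carrier (L0 p)" for n m u v
  proof -
    \<comment> \<open>Adding \<open>p ^ n\<close> to the first coordinate stays inside the coset of
      level \<open>n\<close> but leaves every coset of a deeper level \<open>m\<close>, which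
      separates the levels.\<close>
    let ?w = "(red p (\<lambda>k. fst u k + int p ^ n), snd u)"
    have c: "coh p (fst u)" using that(3) Zp_mem by (auto simp: L0_carrier)
    have w: "?w \<in> carrier (L0 p)" using that(3) c by (auto simp: L0_carrier intro!: red_mem coh_intros)
    have "u \<in> coset p n u" using that(3) by (simp add: coset_eq eqv_def)
    moreover have "?w \<in> coset p n u" using w that(3)
      by (simp add: coset_eq eqv_def red_def L0_carrier Zp_mem mem_Times_iff)
    ultimately have "eqv m u v" "eqv m ?w v" using that coset_eq by auto
    hence "fst u m = red p (\<lambda>k. fst u k + int p ^ n) m" by (simp add: eqv_def)
    hence "red p (fst u) m = red p (\<lambda>k. fst u k + int p ^ n) m" using that(3) red_id by (simp add: L0_carrier mem_Times_iff)
    hence "[fst u m + int p ^ n = fst u m + 0] (mod int p ^ m)" by (simp add: red_eq_iff cong_sym)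
    hence "int p ^ m dvd int p ^ n" by (simp only: cong_add_lcancel cong_0_iff)
    from zdvd_imp_le[OF this pow_pos] show False using power_strict_increasing[OF that(1) p_gt_1] by simp
  qed
  hence "n = m" if "coset p n u = coset p m v" using that u v by (metis nat_neq_iff)
  thus ?thesis using u v by (auto simp: coset_eq eqv_def)
qed

text \<open>Proportionality expressed by a vanishing determinant, so that no factor has to be
  named.\<close>

definition par_at :: "nat \<Rightarrow> vec \<Rightarrow> vec \<Rightarrow> bool" where
  "par_at n u v \<longleftrightarrow> [fst u n * snd v n = snd u n * fst v n] (mod int p ^ n)"

definition hom_at :: "nat \<Rightarrow> vec \<Rightarrow> vec \<Rightarrow> bool" where
  "hom_at n u v \<longleftrightarrow> (\<exists>x\<in>Units (Zp p). [x n * fst u n = fst v n] (mod int p ^ n) \<and>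
     [x n * snd u n = snd v n] (mod int p ^ n))"

lemma smult_mem: "x \<in> carrier (Zp p) \<Longrightarrow> u \<in> carrier (L0 p) \<Longrightarrow> smult p x u \<in> carrier (L0 p)"
  by (auto simp: smult_def L0_carrier)

lemma smult_minus_pL:
  assumes "x \<in> carrier (Zp p)" "u \<in> carrier (L0 p)" "v \<in> carrier (L0 p)"
  shows "smult p x u \<ominus>\<^bsub>L0 p\<^esub> v \<in> pL p n \<longleftrightarrow>
    [x n * fst u n = fst v n] (mod int p ^ n) \<and> [x n * snd u n = snd v n] (mod int p ^ n)"
  unfolding pL_iff using L.minus_closed[OF smult_mem[OF assms(1,2)] assms(3)]
  by (simp add: L0_minus[OF smult_mem[OF assms(1,2)] assms(3)])
    (simp add: red_def smult_def Zp_ops cong_iff_dvd_diff mod_eq_0_iff_dvd[symmetric] mod_simps)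

lemma hom_at_sym: assumes "hom_at n u v" shows "hom_at n v u"
proof -
  obtain x where x: "x \<in> Units (Zp p)" "[x n * fst u n = fst v n] (mod int p ^ n)"
    "[x n * snd u n = snd v n] (mod int p ^ n)" using assms by (auto simp: hom_at_def)
  let ?y = "inv\<^bsub>Zp p\<^esub> x"
  have "?y \<otimes>\<^bsub>Zp p\<^esub> x = \<one>\<^bsub>Zp p\<^esub>" using x(1) by simp
  hence "red p (\<lambda>n. ?y n * x n) n = red p (\<lambda>_. 1) n" by (simp add: Zp_ops)
  hence y: "[?y n * x n = 1] (mod int p ^ n)" by (simp add: red_eq_iff)
  have "[?y n * b = a] (mod int p ^ n)" if "[x n * a = b] (mod int p ^ n)" for a b
  proof -
    have "[?y n * b = ?y n * (x n * a)] (mod int p ^ n)" using that by (simp add: cong_scalar_left cong_sym)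
    also have "?y n * (x n * a) = (?y n * x n) * a" by simp
    also have "[\<dots> = 1 * a] (mod int p ^ n)" using y by (rule cong_scalar_right)
    finally show ?thesis by simp
  qed
  thus ?thesis using x Z.Units_inv_Units[OF x(1)] unfolding hom_at_def by blast
qed

lemma hom_at_trans: assumes "hom_at n u v" "hom_at n v w" shows "hom_at n u w"
proof -
  obtain x where x: "x \<in> Units (Zp p)" "[x n * fst u n = fst v n] (mod int p ^ n)"
    "[x n * snd u n = snd v n] (mod int p ^ n)" using assms by (auto simp: hom_at_def)
  obtain y where y: "y \<in> Units (Zp p)" "[y n * fst v n = fst w n] (mod int p ^ n)"
    "[y n * snd v n = snd w n] (mod int p ^ n)" using assms by (auto simp: hom_at_def)
  have "[(y \<otimes>\<^bsub>Zp p\<^esub> x) n * a = c] (mod int p ^ n)"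
    if "[x n * a = b] (mod int p ^ n)" "[y n * b = c] (mod int p ^ n)" for a b c
  proof -
    have "[(y \<otimes>\<^bsub>Zp p\<^esub> x) n * a = (y n * x n) * a] (mod int p ^ n)"
      unfolding Zp_ops by (intro cong_scalar_right red_cong)
    also have "(y n * x n) * a = y n * (x n * a)" by simp
    also have "[\<dots> = y n * b] (mod int p ^ n)" using that(1) by (rule cong_scalar_left)
    also have "[y n * b = c] (mod int p ^ n)" by (rule that(2))
    finally show ?thesis .
  qed
  thus ?thesis using x y Z.Units_m_closed[OF y(1) x(1)] unfolding hom_at_def by blast
qed

lemma hom_at_refl: "hom_at n u u"
proof -
  have "\<one>\<^bsub>Zp p\<^esub> \<in> Units (Zp p)" by simp
  moreover have "[\<one>\<^bsub>Zp p\<^esub> n * a = a] (mod int p ^ n)" for a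
    by (simp add: Zp_ops red_def cong_def mod_simps)
  ultimately show ?thesis unfolding hom_at_def by blast
qed

lemma primitive_at:
  assumes "primitive p u" "n > 0"
  shows "\<not> int p dvd fst u n \<or> \<not> int p dvd snd u n"
proof -
  have c: "coh p (fst u)" "coh p (snd u)" and d: "\<not> (int p dvd fst u 1 \<and> int p dvd snd u 1)"
    using assms(1) unfolding primitive_iff L0_carrier by (auto simp: Zp_mem)
  have "int p dvd x n \<longleftrightarrow> int p dvd x 1" if "coh p x" for x
    using not_dvd_cong[of "x n" "x 1" 1] coh_le[OF that, of 1 n] assms(2) by simp
  thus ?thesis using c d by blast
qed

lemma cong_unit_factor:
  assumes "\<not> int p dvd a" "\<not> (int p dvd a' \<and> int p dvd b')"
    and par: "[a * b' = b * a'] (mod int p ^ n)" and "n > 0"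
  obtains c where "\<not> int p dvd c" "[c * a = a'] (mod int p ^ n)" "[c * b = b'] (mod int p ^ n)"
proof -
  obtain i where i: "[a * i = 1] (mod int p ^ n)"
    using cong_solve_coprime_int coprime_pow[OF assms(1)] by blast
  have 1: "[a' * i * a = a'] (mod int p ^ n)"
    using cong_scalar_left[OF i, of a'] by (simp add: algebra_simps)
  have "[a' * i * b = i * (b * a')] (mod int p ^ n)" by (simp add: algebra_simps)
  also have "[i * (b * a') = i * (a * b')] (mod int p ^ n)"
    using par by (intro cong_scalar_left) (rule cong_sym)
  also have "[i * (a * b') = b'] (mod int p ^ n)"
    using cong_scalar_right[OF i, of b'] by (simp add: algebra_simps)
  finally have 2: "[a' * i * b = b'] (mod int p ^ n)" .
  have "\<not> int p dvd a' * i"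
  proof
    assume "int p dvd a' * i"
    hence "int p dvd a'" "int p dvd b'"
      using not_dvd_cong[OF 1 assms(4)] not_dvd_cong[OF 2 assms(4)] by auto
    thus False using assms(2) by blast
  qed
  thus thesis using that 1 2 by blast
qed

text \<open>Some coordinate of the primitive vector \<open>u\<close> is a unit and determines the
  factor; that factor is a unit since \<open>v\<close> is primitive too. A constant integer sequence
  lifts it to \<open>Zp\<close>.\<close>

lemma hom_at_iff:
  assumes u: "primitive p u" and v: "primitive p v"
  shows "hom_at n u v \<longleftrightarrow> par_at n u v"
proof
  assume "hom_at n u v"
  then obtain x where x: "[x n * fst u n = fst v n] (mod int p ^ n)"
    "[x n * snd u n = snd v n] (mod int p ^ n)" by (auto simp: hom_at_def)
  have "[fst u n * snd v n = fst u n * (x n * snd u n)] (mod int p ^ n)"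
    by (rule cong_scalar_left) (rule cong_sym[OF x(2)])
  also have "fst u n * (x n * snd u n) = snd u n * (x n * fst u n)" by simp
  also have "[\<dots> = snd u n * fst v n] (mod int p ^ n)" by (rule cong_scalar_left) (rule x(1))
  finally show "par_at n u v" by (simp add: par_at_def)
next
  assume par: "par_at n u v"
  show "hom_at n u v"
  proof (cases "n = 0")
    case True
    thus ?thesis using Z.Units_one_closed by (auto simp: hom_at_def)
  next
    case False
    have vn: "\<not> (int p dvd fst v n \<and> int p dvd snd v n)" "\<not> (int p dvd snd v n \<and> int p dvd fst v n)"
      using primitive_at[OF v] False by auto
    have par1: "[fst u n * snd v n = snd u n * fst v n] (mod int p ^ n)"
      and par2: "[snd u n * fst v n = fst u n * snd v n] (mod int p ^ n)"
      using par by (simp_all add: par_at_def cong_sym)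
    have "\<exists>c. \<not> int p dvd c \<and> [c * fst u n = fst v n] (mod int p ^ n) \<and> [c * snd u n = snd v n] (mod int p ^ n)"
    proof (cases "int p dvd fst u n")
      case True
      hence "\<not> int p dvd snd u n" using primitive_at[OF u] False by auto
      from cong_unit_factor[OF this vn(2) par2] False show ?thesis by blast
    next
      case f: False
      from cong_unit_factor[OF f vn(1) par1] False show ?thesis by blast
    qed
    then obtain c where c: "\<not> int p dvd c" "[c * fst u n = fst v n] (mod int p ^ n)"
      "[c * snd u n = snd v n] (mod int p ^ n)" by blast
    let ?x = "red p (\<lambda>_. c)"
    have "?x \<in> Units (Zp p)" using c(1) by (simp add: Units_iff red_mem coh_const) (simp add: red_def dvd_mod_iff)
    moreover have "[?x n * a = c * a] (mod int p ^ n)" for a by (intro cong_scalar_right red_cong)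
    ultimately show ?thesis using c cong_trans unfolding hom_at_def by blast
  qed
qed

lemma primitive_mem: "primitive p u \<Longrightarrow> u \<in> carrier (L0 p)" by (simp add: primitive_def)

lemma coset_class_eq:
  assumes u: "primitive p u"
  shows "coset_class p n u = {coset p n v | v. primitive p v \<and> hom_at n u v}"
proof (intro equalityI subsetI)
  fix Y assume "Y \<in> coset_class p n u"
  then obtain m u' v x where *: "coset p n u = coset p m u'" "Y = coset p m v" "primitive p u'" "primitive p v"
    "x \<in> Units (Zp p)" "smult p x u' \<ominus>\<^bsub>L0 p\<^esub> v \<in> pL p m"
    by (auto simp: coset_class_def homothetic_def)
  have "n = m" "eqv n u u'" using * u by (auto simp: coset_eq_iff primitive_mem)
  moreover have "hom_at m u' v" using * smult_minus_pL[of x u' v m]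
    by (auto simp: hom_at_def Units_def primitive_mem)
  ultimately have "hom_at n u v" by (simp add: hom_at_def eqv_def)
  thus "Y \<in> {coset p n v | v. primitive p v \<and> hom_at n u v}" using * \<open>n = m\<close> by blast
next
  fix Y assume "Y \<in> {coset p n v | v. primitive p v \<and> hom_at n u v}"
  then obtain v where *: "Y = coset p n v" "primitive p v" "hom_at n u v" by blast
  then obtain x where "x \<in> Units (Zp p)" "smult p x u \<ominus>\<^bsub>L0 p\<^esub> v \<in> pL p n"
    using smult_minus_pL[of _ u v n] u by (auto simp: hom_at_def primitive_mem Z.Units_closed)
  thus "Y \<in> coset_class p n u" using * u unfolding coset_class_def homothetic_def by blast
qed

lemma coset_class_eq_iff:
  assumes u: "primitive p u" and v: "primitive p v"
  shows "coset_class p n u = coset_class p m v \<longleftrightarrow> n = m \<and> hom_at n u v"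
proof
  assume eq: "coset_class p n u = coset_class p m v"
  have "coset p m v \<in> coset_class p n u" unfolding eq coset_class_eq[OF v] using v hom_at_refl by blast
  then obtain v' where "coset p m v = coset p n v'" "primitive p v'" "hom_at n u v'"
    unfolding coset_class_eq[OF u] by blast
  moreover from this have "m = n" "eqv m v v'" using v by (auto simp: coset_eq_iff primitive_mem)
  ultimately show "n = m \<and> hom_at n u v" by (simp add: hom_at_def eqv_def)
next
  assume "n = m \<and> hom_at n u v"
  moreover from this have "hom_at n u w \<longleftrightarrow> hom_at n v w" for w
    using hom_at_trans hom_at_sym by blast
  ultimately show "coset_class p n u = coset_class p m v"
    by (auto simp: coset_class_eq[OF u] coset_class_eq[OF v])
qed

lemma line_eq_iff:
  assumes u: "primitive p u" and v: "primitive p v"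
  shows "line p n u = line p n v \<longleftrightarrow> hom_at n u v"
proof
  assume "line p n u = line p n v"
  moreover have "coset p n (smult p \<one>\<^bsub>Zp p\<^esub> v) \<in> line p n v" unfolding line_def by blast
  ultimately have "coset p n (smult p \<one>\<^bsub>Zp p\<^esub> v) \<in> line p n u" by simp
  then obtain x where x: "x \<in> carrier (Zp p)"
    "coset p n (smult p \<one>\<^bsub>Zp p\<^esub> v) = coset p n (smult p x u)" unfolding line_def by blast
  hence eq: "eqv n (smult p \<one>\<^bsub>Zp p\<^esub> v) (smult p x u)"
    using u v by (simp add: coset_eq_iff smult_mem primitive_mem)
  have "smult p \<one>\<^bsub>Zp p\<^esub> v = v" using primitive_mem[OF v] by (auto simp: smult_def L0_carrier)
  hence "[fst v n = x n * fst u n] (mod int p ^ n)" "[snd v n = x n * snd u n] (mod int p ^ n)"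
    using eq by (auto simp: eqv_def smult_def Zp_ops red_def cong_def)
  hence "[fst u n * snd v n = fst u n * (x n * snd u n)] (mod int p ^ n)"
    "[snd u n * fst v n = snd u n * (x n * fst u n)] (mod int p ^ n)"
    by (auto intro: cong_scalar_left)
  hence "[fst u n * snd v n = snd u n * (x n * fst u n)] (mod int p ^ n)"
    "[snd u n * (x n * fst u n) = snd u n * fst v n] (mod int p ^ n)"
    by (simp_all add: cong_sym mult.left_commute mult.commute)
  hence "par_at n u v" unfolding par_at_def by (rule cong_trans)
  thus "hom_at n u v" using hom_at_iff u v by blast
next
  have "line p n v \<subseteq> line p n u" if u: "primitive p u" and v: "primitive p v" and h: "hom_at n u v" for u v
  proof
    fix Y assume "Y \<in> line p n v"
    then obtain y where y: "y \<in> carrier (Zp p)" "Y = coset p n (smult p y v)" by (auto simp: line_def)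
    obtain x where x: "x \<in> Units (Zp p)" "[x n * fst u n = fst v n] (mod int p ^ n)"
      "[x n * snd u n = snd v n] (mod int p ^ n)" using h by (auto simp: hom_at_def)
    define z where "z = y \<otimes>\<^bsub>Zp p\<^esub> x"
    have z: "z \<in> carrier (Zp p)" using x y by (simp add: Z.Units_closed z_def)
    have "[y n * b = z n * a] (mod int p ^ n)" if "[x n * a = b] (mod int p ^ n)" for a b
    proof -
      have "[z n * a = (y n * x n) * a] (mod int p ^ n)"
        unfolding z_def Zp_ops by (intro cong_scalar_right red_cong)
      also have "(y n * x n) * a = y n * (x n * a)" by simp
      also have "[\<dots> = y n * b] (mod int p ^ n)" using that by (rule cong_scalar_left)
      finally show ?thesis by (rule cong_sym)
    qed
    hence "eqv n (smult p y v) (smult p z u)"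
      using x by (simp add: eqv_def smult_def Zp_ops(2) red_eq_iff)
    hence "Y = coset p n (smult p z u)"
      using y z u v by (simp add: coset_eq_iff smult_mem primitive_mem)
    thus "Y \<in> line p n u" using z unfolding line_def by blast
  qed
  thus "hom_at n u v \<Longrightarrow> line p n u = line p n v" using u v hom_at_sym by blast
qed

lemma cvec_primitive: "w \<in> Pr p \<Longrightarrow> primitive p (cvec p w)"
  by (auto simp: primitive_iff L0_carrier cvec_def Pr_def red_mem coh_const) (auto simp: red_def dvd_mod_iff)

text \<open>Level \<open>n\<close> is the projective line over the integers modulo
  \<open>p ^ n\<close>, with integer pairs as homogeneous coordinates.\<close>

lemma W_eq_iff:
  assumes "w \<in> Pr p" "w' \<in> Pr p"
  shows "W p n w = W p m w' \<longleftrightarrow> n = m \<and> int p ^ n dvd vdet w w'"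
proof -
  have "par_at n (cvec p w) (cvec p w') \<longleftrightarrow> [fst w * snd w' = snd w * fst w'] (mod int p ^ n)"
    by (simp add: par_at_def cvec_def red_def cong_def mod_simps)
  thus ?thesis using assms
    by (simp add: W_def coset_class_eq_iff cvec_primitive hom_at_iff vdet_def cong_iff_dvd_diff)
qed

text \<open>The entry of index \<open>n\<close> would fail for \<open>n = 0\<close>, where it is 0
  and not primitive. The entry of index \<open>Suc n\<close> is always primitive and reduces to the
  one of index \<open>n\<close>.\<close>

lemma coset_class_W:
  assumes "primitive p u"
  shows "(fst u (Suc n), snd u (Suc n)) \<in> Pr p" "coset_class p n u = W p n (fst u (Suc n), snd u (Suc n))"
proof -
  show Pr: "(fst u (Suc n), snd u (Suc n)) \<in> Pr p" using primitive_at[OF assms, of "Suc n"] by (simp add: Pr_def)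
  have "x n = red p (\<lambda>_. x (Suc n)) n" if "x \<in> carrier (Zp p)" for x
    using that unfolding Zp_mem coh_def red_def cong_def by metis
  hence "eqv n u (cvec p (fst u (Suc n), snd u (Suc n)))"
    using primitive_mem[OF assms] by (auto simp: eqv_def cvec_def L0_carrier)
  hence "hom_at n u (cvec p (fst u (Suc n), snd u (Suc n)))"
    using hom_at_refl by (simp add: hom_at_def eqv_def)
  thus "coset_class p n u = W p n (fst u (Suc n), snd u (Suc n))"
    using assms cvec_primitive[OF Pr] by (simp add: W_def coset_class_eq_iff)
qed

sublocale layered "W p" "Pr p"
proof
  show "Pr p \<noteq> {}" using p_gt_1 by (auto simp: Pr_def intro!: exI[of _ 1])
  show "W p n w = W p n w'" if "w \<in> Pr p" "w' \<in> Pr p" "W p (Suc n) w = W p (Suc n) w'" for n w w'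
    using that by (auto simp: W_eq_iff intro: dvd_mult_right)
qed (auto simp: W_eq_iff)

lemma verts_eq: "cosets p // homothetic p = {W p n w | n w. w \<in> Pr p}"
proof (intro equalityI subsetI)
  fix X assume "X \<in> cosets p // homothetic p"
  then obtain n u where "primitive p u" "X = coset_class p n u"
    by (auto simp: quotient_def cosets_def coset_class_def)
  thus "X \<in> {W p n w | n w. w \<in> Pr p}" using coset_class_W by blast
next
  fix X assume "X \<in> {W p n w | n w. w \<in> Pr p}"
  then obtain n w where w: "w \<in> Pr p" "X = homothetic p `` {coset p n (cvec p w)}"
    by (auto simp: W_def coset_class_def)
  have "coset p n (cvec p w) \<in> cosets p" using cvec_primitive[OF w(1)] unfolding cosets_def by blast
  thus "X \<in> cosets p // homothetic p" unfolding w(2) by (rule quotientI)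
qed

lemma child_rel_eq: "child_rel p = child UNIV"
proof (intro equalityI subsetI)
  fix e assume "e \<in> child_rel p"
  then obtain n u u' where *: "e = (coset_class p n u, coset_class p (Suc n) u')"
    "primitive p u" "primitive p u'" "line p n u = line p n u'"
    by (auto simp: child_rel_def)
  hence "coset_class p n u = coset_class p n u'" by (simp add: coset_class_eq_iff line_eq_iff)
  \<comment> \<open>\<open>child\<close> demands one integer pair for both ends of the edge. The
    pair that \<open>coset_class_W\<close> assigns to \<open>u'\<close> on level
    \<open>Suc n\<close> also represents its class on level \<open>n\<close>.\<close>
  moreover let ?w = "(fst u' (Suc (Suc n)), snd u' (Suc (Suc n)))"
  have w: "?w \<in> Pr p" "coset_class p (Suc n) u' = W p (Suc n) ?w"
    using coset_class_W[OF *(3), of "Suc n"] by auto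
  moreover have "hom_at n u' (cvec p ?w)"
  proof -
    have "hom_at (Suc n) u' (cvec p ?w)"
      using w(2) *(3) cvec_primitive[OF w(1)] by (simp add: W_def coset_class_eq_iff)
    hence "par_at (Suc n) u' (cvec p ?w)" using hom_at_iff *(3) cvec_primitive[OF w(1)] by blast
    hence "[fst u' (Suc n) * snd (cvec p ?w) (Suc n) = snd u' (Suc n) * fst (cvec p ?w) (Suc n)] (mod int p ^ n)"
      unfolding par_at_def by (rule cong_dvd_modulus) simp
    moreover have "[x (Suc n) = x n] (mod int p ^ n)" if "x \<in> carrier (Zp p)" for x
      using that by (simp add: Zp_mem coh_def)
    moreover have "fst u' \<in> carrier (Zp p)" "snd u' \<in> carrier (Zp p)"
      "fst (cvec p ?w) \<in> carrier (Zp p)" "snd (cvec p ?w) \<in> carrier (Zp p)"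
      using *(3) cvec_primitive[OF w(1)] by (auto simp: primitive_iff L0_carrier mem_Times_iff)
    ultimately have "par_at n u' (cvec p ?w)"
      unfolding par_at_def by (meson cong_mult cong_sym cong_trans)
    thus ?thesis using hom_at_iff *(3) cvec_primitive[OF w(1)] by blast
  qed
  hence "coset_class p n u' = W p n ?w"
    using *(3) cvec_primitive[OF w(1)] by (simp add: W_def coset_class_eq_iff)
  ultimately show "e \<in> child UNIV" using * unfolding child_def by auto
next
  fix e assume "e \<in> child UNIV"
  then obtain n w where "w \<in> Pr p" "e = (W p n w, W p (Suc n) w)" by (auto simp: child_def)
  thus "e \<in> child_rel p" using cvec_primitive unfolding child_rel_def W_def by blast
qed

lemma lattice_tree_eq: "lattice_tree p = tr UNIV"
proof -
  obtain w where w: "w \<in> Pr p" using P_nonempty by blast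
  have "x 0 = 0" if "x \<in> carrier (Zp p)" for x using that Zp_mem by (metis mod_by_1 power_0)
  hence "eqv 0 u v" if "u \<in> carrier (L0 p)" "v \<in> carrier (L0 p)" for u v
    using that unfolding eqv_def L0_carrier mem_Times_iff by metis
  hence "coset p 0 (cvec p w) = carrier (L0 p)"
    unfolding coset_eq[OF primitive_mem[OF cvec_primitive[OF w]]]
    using primitive_mem[OF cvec_primitive[OF w]] by blast
  hence "homothetic p `` {carrier (L0 p)} = root (tr UNIV)"
    using root_tr[OF w, of UNIV] by (simp add: W_def coset_class_def)
  moreover have "cosets p // homothetic p = vts UNIV" using verts_eq by (simp add: vts_def)
  ultimately show ?thesis by (simp add: lattice_tree_def child_rel_eq tr_def)
qed

end

section \<open>The action of the projective linear group\<close>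

context prime_tree
begin

text \<open>The condition on \<open>mdet (A n)\<close> is also imposed for \<open>n = 0\<close>, where coherence says nothing.\<close>
definition GLs :: "(nat \<Rightarrow> imat) set" where
  "GLs = {A. (\<forall>n. mcong (int p ^ n) (A (Suc n)) (A n)) \<and> (\<forall>n. \<not> int p dvd mdet (A n))}"

definition act :: "(nat \<Rightarrow> imat) \<Rightarrow> vec set set \<Rightarrow> vec set set" where
  "act A = (\<lambda>v\<in>vts UNIV. THE x. \<exists>n. \<exists>w\<in>Pr p. v = W p n w \<and> x = W p n (mapp (A n) w))"

text \<open>Equality of the images in the projective linear group over the integers modulo
  \<open>p ^ n\<close>.\<close>

definition proj_eq :: "nat \<Rightarrow> imat \<Rightarrow> imat \<Rightarrow> bool" where
  "proj_eq n A B \<longleftrightarrow> (\<exists>k. \<not> int p dvd k \<and> mcong (int p ^ n) A (of_int k * B))"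

lemma GLsD: "A \<in> GLs \<Longrightarrow> mcong (int p ^ n) (A (Suc n)) (A n)" "A \<in> GLs \<Longrightarrow> \<not> int p dvd mdet (A n)"
  by (simp_all add: GLs_def)

lemma GLs_le:
  assumes "A \<in> GLs" "m \<le> n"
  shows "mcong (int p ^ m) (A n) (A m)"
  using assms(2)
proof (induction n rule: dec_induct)
  case (step n)
  have "mcong (int p ^ m) (A (Suc n)) (A n)"
    using mcong_dvd[OF GLsD(1)[OF assms(1), of n]] step.hyps by (simp add: le_imp_power_dvd)
  thus ?case using step mcong_trans by blast
qed simp

lemma prime_dvd_mult_int: "int p dvd a * b \<longleftrightarrow> int p dvd a \<or> int p dvd b"
  using prime_int_p by (rule prime_dvd_mult_iff)

lemma not_dvd_1 [simp]: "\<not> int p dvd 1" using prime_int_p not_prime_unit by blast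

lemma p_neq_1 [simp]: "p \<noteq> Suc 0" using p_gt_1 by auto

lemma GLs_mult: "A \<in> GLs \<Longrightarrow> B \<in> GLs \<Longrightarrow> (\<lambda>n. A n * B n) \<in> GLs"
  by (simp add: GLs_def mdet_mult prime_dvd_mult_int mcong_mult)

lemma GLs_madj: "A \<in> GLs \<Longrightarrow> (\<lambda>n. madj (A n)) \<in> GLs"
  by (simp add: GLs_def mcong_madj)

lemma mdet_1 [simp]: "mdet 1 = 1" by (simp add: mdet_def)

lemma GLs_one: "(\<lambda>n. 1) \<in> GLs" by (simp add: GLs_def)

lemma GLs_const: "\<not> int p dvd mdet A \<Longrightarrow> (\<lambda>n. A) \<in> GLs" by (simp add: GLs_def)

lemma GLs_power: "A \<in> GLs \<Longrightarrow> (\<lambda>n. A n ^ i) \<in> GLs"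
  by (induction i) (auto simp: GLs_one GLs_mult)

lemma mapp_Pr:
  assumes "w \<in> Pr p" "\<not> int p dvd mdet A" shows "mapp A w \<in> Pr p"
proof (rule ccontr)
  assume "mapp A w \<notin> Pr p"
  hence "int p dvd fst (mapp A w)" "int p dvd snd (mapp A w)" by (simp_all add: Pr_def)
  hence "int p dvd fst (mapp (madj A) (mapp A w))" "int p dvd snd (mapp (madj A) (mapp A w))"
    by (simp_all add: mapp_def[of "madj A"])
  moreover have "mapp (madj A) (mapp A w) = (mdet A * fst w, mdet A * snd w)"
    by (simp add: mapp_mult[symmetric]) (simp add: mapp_def)
  ultimately show False using assms prime_dvd_mult_int by (auto simp: Pr_def)
qed

lemma W_eq_vdet: "w \<in> Pr p \<Longrightarrow> w' \<in> Pr p \<Longrightarrow> int p ^ n dvd vdet w w' \<Longrightarrow> W p n w = W p n w'"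
  by (simp add: W_eq_iff)

lemma act_W:
  assumes A: "A \<in> GLs" and w: "w \<in> Pr p"
  shows "act A (W p n w) = W p n (mapp (A n) w)"
proof -
  have "(THE x. \<exists>m. \<exists>w'\<in>Pr p. W p n w = W p m w' \<and> x = W p m (mapp (A m) w')) = W p n (mapp (A n) w)"
  proof (rule the_equality)
    fix x assume "\<exists>m. \<exists>w'\<in>Pr p. W p n w = W p m w' \<and> x = W p m (mapp (A m) w')"
    then obtain w' where w': "w' \<in> Pr p" "W p n w = W p n w'" "x = W p n (mapp (A n) w')"
      by (metis W_eq_iff w)
    hence "int p ^ n dvd vdet w' w" using w W_eq_iff by metis
    thus "x = W p n (mapp (A n) w)" unfolding w'(3)
      by (intro W_eq_vdet mapp_Pr w w' GLsD[OF A]) (simp add: vdet_mapp)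
  qed (use w in blast)
  thus ?thesis using w by (simp add: act_def)
qed

lemma act_ext: "act A \<in> extensional (vts UNIV)" by (simp add: act_def)

lemma vts_cases: assumes "v \<in> vts I" obtains n w where "n \<in> I" "w \<in> Pr p" "v = W p n w"
  using assms by (auto simp: vts_def)

lemma act_eqI:
  assumes "A \<in> GLs" "B \<in> GLs" "\<And>n w. w \<in> Pr p \<Longrightarrow> W p n (mapp (A n) w) = W p n (mapp (B n) w)"
  shows "act A = act B"
  by (rule extensionalityI[OF act_ext act_ext]) (auto simp: act_W assms elim!: vts_cases)

lemma act_mult: "A \<in> GLs \<Longrightarrow> B \<in> GLs \<Longrightarrow> v \<in> vts UNIV \<Longrightarrow> act (\<lambda>n. A n * B n) v = act A (act B v)"
  by (auto elim!: vts_cases simp: act_W GLs_mult mapp_mult mapp_Pr GLsD)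

lemma mapp_scalar: "mapp (of_int k) w = (k * fst w, k * snd w)" by (simp add: mapp_def)

text \<open>The product of a matrix and its adjugate is the scalar \<open>mdet\<close>, which is
  prime to \<open>p\<close> and moves no vertex.\<close>

lemma act_adj: "A \<in> GLs \<Longrightarrow> v \<in> vts UNIV \<Longrightarrow> act (\<lambda>n. madj (A n)) (act A v) = v"
proof (elim vts_cases)
  fix n w assume A: "A \<in> GLs" and v: "v = W p n w" and w: "w \<in> Pr p"
  have "act (\<lambda>n. madj (A n)) (act A v) = W p n (mapp (of_int (mdet (A n))) w)"
    using A w by (simp add: v act_W GLs_madj mapp_Pr GLsD mapp_mult[symmetric])
  also have "\<dots> = v" unfolding v
  proof (intro W_eq_vdet w)
    show "mapp (of_int (mdet (A n))) w \<in> Pr p" using w GLsD(2)[OF A, of n]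
      by (auto simp: mapp_scalar Pr_def prime_dvd_mult_int)
  qed (simp add: mapp_scalar vdet_def)
  finally show "act (\<lambda>n. madj (A n)) (act A v) = v" .
qed

lemma act_adj': "A \<in> GLs \<Longrightarrow> v \<in> vts UNIV \<Longrightarrow> act A (act (\<lambda>n. madj (A n)) v) = v"
  using act_adj[OF GLs_madj, of A v] by (simp add: madj_def)

lemma act_mem: "A \<in> GLs \<Longrightarrow> v \<in> vts I \<Longrightarrow> act A v \<in> vts I"
  by (auto elim!: vts_cases simp: act_W mapp_Pr GLsD)

lemma aut_act:
  assumes A: "A \<in> GLs" and I: "\<And>n. Suc n \<in> I \<Longrightarrow> n \<in> I"
  shows "aut I (restrict (act A) (vts I))"
proof -
  have sub: "vts I \<subseteq> vts UNIV" by (rule vts_mono) simp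
  have "bij_betw (act A) (vts I) (vts I)"
    by (rule bij_betw_byWitness[where f' = "act (\<lambda>n. madj (A n))"])
      (use sub A GLs_madj act_mem act_adj act_adj' in blast)+
  moreover have "lvl (act A v) = lvl v \<and> act A (par v) = par (act A v)" if "v \<in> vts UNIV" for v
    using that
  proof (cases v rule: vts_cases)
    case (1 n w)
    have "mapp (A n) w \<in> Pr p" using 1 A mapp_Pr GLsD by blast
    moreover have "W p (n - 1) (mapp (A (n - 1)) w) = W p (n - 1) (mapp (A n) w)"
    proof (cases n)
      case (Suc k)
      have "act A (W p k w) = par (act A (W p (Suc k) w))"
      proof -
        have m: "mcong (int p ^ k) (A (Suc k)) (A k)" using GLsD A by blast
        \<comment> \<open>Subtracting \<open>mapp (A k) w\<close> in the second argument does not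
          change \<open>vdet\<close>; what remains is linear in \<open>A (Suc k) - A k\<close>,
          which vanishes modulo \<open>p ^ k\<close>.\<close>
        have "vdet (mapp (A k) w) (mapp (A (Suc k)) w) = vdet (mapp (A k) w) (mapp (A (Suc k) - A k) w)"
          by (simp add: vdet_def mapp_def algebra_simps)
        moreover have "int p ^ k dvd fst (mapp (A (Suc k) - A k) w)" "int p ^ k dvd snd (mapp (A (Suc k) - A k) w)"
          using m by (simp_all add: mapp_def mcong_def)
        ultimately have "int p ^ k dvd vdet (mapp (A k) w) (mapp (A (Suc k)) w)"
          by (simp add: vdet_def)
        thus ?thesis using A 1 mapp_Pr GLsD by (simp add: act_W) (intro W_eq_vdet; blast)
      qed
      thus ?thesis using Suc 1 A mapp_Pr GLsD by (simp add: act_W)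
    qed simp
    ultimately show ?thesis using 1 A by (simp add: act_W par_W)
  qed
  moreover have "par v \<in> vts I" if "v \<in> vts I" for v
    using that
  proof (cases v rule: vts_cases)
    case (1 n w)
    thus ?thesis using I by (cases n) (auto simp: par_W)
  qed
  ultimately show ?thesis using sub act_mem[OF A] by (auto simp: aut_def Bij_def)
qed

lemma act_Iso:
  assumes "A \<in> GLs" "0 \<in> I" "\<And>n. Suc n \<in> I \<Longrightarrow> n \<in> I"
  shows "restrict (act A) (vts I) \<in> carrier (Iso (tr I))"
  using aut_Iso[OF aut_act] assms by blast

lemma restr_act: "restr (tr UNIV) n (act A) = restrict (act A) (vts {..n})"
  by (simp add: restr_def truncate_tr)

lemma proj_eq_refl: "proj_eq n A A"
  unfolding proj_eq_def by (rule exI[of _ 1]) simp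

text \<open>Multiplying \<open>madj B * A = a\<close> by \<open>B\<close> gives
  \<open>mdet B * A = a * B\<close> modulo \<open>p ^ n\<close>. As \<open>mdet B\<close> is a unit,
  only the factor remains to be seen prime to \<open>p\<close>, and this follows from the
  determinant of \<open>A\<close>.\<close>

lemma proj_eq_of_scal:
  assumes A: "\<not> int p dvd mdet A" and B: "\<not> int p dvd mdet B" and Z: "scalar_mod (int p ^ n) (madj B * A)"
  shows "proj_eq n A B"
proof (cases "n = 0")
  case False
  let ?N = "int p ^ n" and ?Z = "madj B * A"
  have "mcong ?N (B * ?Z) (B * of_int (m11 ?Z))" using Z unfolding scalar_mod_iff by (intro mcong_mult mcong_refl)
  moreover have "B * ?Z = of_int (mdet B) * A" by (simp add: mult.assoc[symmetric])
  ultimately have 1: "mcong ?N (of_int (mdet B) * A) (of_int (m11 ?Z) * B)"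
    by (metis of_int_mult_commute_imat)
  obtain i where i: "[mdet B * i = 1] (mod ?N)"
    using cong_solve_coprime_int coprime_pow[OF B] by blast
  have "mcong ?N (of_int (mdet B * i) * A) (of_int 1 * A)" by (intro mcong_mult mcong_of_int i mcong_refl)
  moreover have "mcong ?N (of_int i * (of_int (mdet B) * A)) (of_int i * (of_int (m11 ?Z) * B))"
    by (intro mcong_mult 1 mcong_refl)
  moreover have "of_int i * (of_int (mdet B) * A) = of_int (mdet B * i) * A"
    "of_int i * (of_int (m11 ?Z) * B) = of_int (i * m11 ?Z) * B"
    by (simp_all only: mult.assoc[symmetric] mult.commute of_int_mult[symmetric])
  ultimately have c: "mcong ?N A (of_int (i * m11 ?Z) * B)"
    using mcong_trans mcong_sym by (metis mult_1 of_int_1)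
  hence "[mdet A = mdet (of_int (i * m11 ?Z) * B)] (mod ?N)" by (rule mcong_mdet)
  hence "\<not> int p dvd mdet (of_int (i * m11 ?Z) * B)" using A not_dvd_cong False by blast
  hence "\<not> int p dvd i * m11 ?Z"
    unfolding mdet_of_int_mult by (simp add: prime_dvd_mult_int power2_eq_square)
  thus ?thesis using c unfolding proj_eq_def by blast
qed (auto simp: proj_eq_def intro: exI[of _ 1])

lemma scalar_mod_proj_one:
  assumes "scalar_mod (int p ^ n) A" "\<not> int p dvd mdet A" shows "proj_eq n A 1"
proof (rule proj_eq_of_scal[OF assms(2)])
  show "scalar_mod (int p ^ n) (madj 1 * A)" using assms(1) by (simp add: scalar_mod_def)
qed simp

text \<open>With \<open>Z = madj B * A\<close> the question is when \<open>Z\<close> fixes every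
  point of the projective line. A matrix that fixes the points (1,0), (0,1) and (1,1) is
  scalar.\<close>

lemma W_mapp_iff:
  assumes "\<not> int p dvd mdet A" "\<not> int p dvd mdet B"
  shows "(\<forall>w\<in>Pr p. W p n (mapp A w) = W p n (mapp B w)) \<longleftrightarrow> proj_eq n A B"
proof
  assume a: "\<forall>w\<in>Pr p. W p n (mapp A w) = W p n (mapp B w)"
  let ?N = "int p ^ n"
  define Z where "Z = madj B * A"
  have "?N dvd vdet (mapp Z w) w" if w: "w \<in> Pr p" for w
  proof -
    have "?N dvd vdet (mapp A w) (mapp B w)"
      using a w W_eq_iff[OF mapp_Pr[OF w assms(1)] mapp_Pr[OF w assms(2)], of n n] by blast
    hence "?N dvd mdet (madj B) * vdet (mapp A w) (mapp B w)" by simp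
    hence "?N dvd vdet (mapp (madj B) (mapp A w)) (mapp (madj B) (mapp B w))" by (simp only: vdet_mapp)
    moreover have "vdet (mapp (madj B) (mapp A w)) (mapp (madj B) (mapp B w)) = mdet B * vdet (mapp Z w) w"
      by (simp add: mapp_mult[symmetric] Z_def mapp_scalar) (simp add: vdet_def algebra_simps)
    ultimately show ?thesis using coprime_pow[OF assms(2), of n]
      by (simp add: coprime_commute coprime_dvd_mult_right_iff)
  qed
  from this[of "(1, 0)"] this[of "(0, 1)"] this[of "(1, 1)"]
  have z: "?N dvd m21 Z" "?N dvd m12 Z" "?N dvd m11 Z + m12 Z - (m21 Z + m22 Z)"
    by (auto simp: Pr_def vdet_def mapp_def)
  have "?N dvd (m11 Z + m12 Z - (m21 Z + m22 Z)) - m12 Z + m21 Z"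
    by (rule dvd_add[OF dvd_diff[OF z(3,2)] z(1)])
  hence "scalar_mod ?N Z" using z by (simp add: scalar_mod_def)
  thus "proj_eq n A B" using proj_eq_of_scal assms by (simp add: Z_def)
next
  assume "proj_eq n A B"
  then obtain k where k: "\<not> int p dvd k" "mcong (int p ^ n) A (of_int k * B)" by (auto simp: proj_eq_def)
  show "\<forall>w\<in>Pr p. W p n (mapp A w) = W p n (mapp B w)"
  proof (intro ballI W_eq_vdet mapp_Pr assms)
    fix w assume "w \<in> Pr p"
    obtain K where "A = of_int k * B + of_int (int p ^ n) * K" using k(2) by (auto simp: mcong_iff)
    hence "vdet (mapp A w) (mapp B w) = int p ^ n * vdet (mapp K w) (mapp B w)"
      by (simp add: vdet_def mapp_def algebra_simps del: of_int_power)
    thus "int p ^ n dvd vdet (mapp A w) (mapp B w)" by simp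
  qed
qed

lemma W_mapp_le:
  assumes "A \<in> GLs" "B \<in> GLs" "proj_eq n (A n) (B n)" "m \<le> n"
  shows "proj_eq m (A m) (B m)"
proof -
  obtain k where k: "\<not> int p dvd k" "mcong (int p ^ n) (A n) (of_int k * B n)"
    using assms by (auto simp: proj_eq_def)
  have "mcong (int p ^ m) (A m) (A n)" by (rule mcong_sym[OF GLs_le[OF assms(1,4)]])
  also have "mcong (int p ^ m) (A n) (of_int k * B n)"
    by (rule mcong_dvd[OF k(2)]) (simp add: assms(4) le_imp_power_dvd)
  also have "mcong (int p ^ m) (of_int k * B n) (of_int k * B m)"
    by (intro mcong_mult mcong_refl GLs_le[OF assms(2,4)])
  finally show ?thesis using k(1) by (auto simp: proj_eq_def)
qed

lemma restrict_act_eq_iff: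
  assumes "A \<in> GLs" "B \<in> GLs"
  shows "restrict (act A) (vts {..n}) = restrict (act B) (vts {..n}) \<longleftrightarrow> proj_eq n (A n) (B n)"
proof
  assume eq: "restrict (act A) (vts {..n}) = restrict (act B) (vts {..n})"
  have "W p n (mapp (A n) w) = W p n (mapp (B n) w)" if "w \<in> Pr p" for w
    using fun_cong[OF eq, of "W p n w"] that assms by (simp add: act_W)
  thus "proj_eq n (A n) (B n)" using W_mapp_iff assms GLsD by blast
next
  assume "proj_eq n (A n) (B n)"
  hence "W p m (mapp (A m) w) = W p m (mapp (B m) w)" if "w \<in> Pr p" "m \<le> n" for w m
    using W_mapp_iff assms GLsD that W_mapp_le by blast
  thus "restrict (act A) (vts {..n}) = restrict (act B) (vts {..n})"
    by (intro restrict_ext) (auto elim!: vts_cases simp: act_W assms)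
qed

lemma act_eq_iff:
  assumes "A \<in> GLs" "B \<in> GLs"
  shows "act A = act B \<longleftrightarrow> (\<forall>n. proj_eq n (A n) (B n))"
proof
  assume "act A = act B" thus "\<forall>n. proj_eq n (A n) (B n)" using restrict_act_eq_iff assms by metis
next
  assume "\<forall>n. proj_eq n (A n) (B n)"
  thus "act A = act B" using W_mapp_iff assms GLsD by (intro act_eqI) blast+
qed

subsection \<open>Matrices over the \<open>p\<close>-adic integers as coherent sequences\<close>

definition ofs :: "(nat \<Rightarrow> imat) \<Rightarrow> padic mat2" where
  "ofs A = ((red p (\<lambda>n. m11 (A n)), red p (\<lambda>n. m12 (A n))), (red p (\<lambda>n. m21 (A n)), red p (\<lambda>n. m22 (A n))))"

definition cohM :: "(nat \<Rightarrow> imat) \<Rightarrow> bool" where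
  "cohM A \<longleftrightarrow> (\<forall>n. mcong (int p ^ n) (A (Suc n)) (A n))"

lemma cohM_iff: "cohM A \<longleftrightarrow> coh p (\<lambda>n. m11 (A n)) \<and> coh p (\<lambda>n. m12 (A n)) \<and> coh p (\<lambda>n. m21 (A n)) \<and> coh p (\<lambda>n. m22 (A n))"
  by (auto simp: cohM_def coh_def mcong_def cong_iff_dvd_diff)

lemma GLs_iff: "A \<in> GLs \<longleftrightarrow> cohM A \<and> (\<forall>n. \<not> int p dvd mdet (A n))"
  by (simp add: GLs_def cohM_def)

lemma mod_dot_product: "((a mod m) * (b mod m) + (c mod m) * (d mod m)) mod m = (a * b + c * d) mod (m :: int)"
  unfolding cong_def[symmetric] by (intro cong_add cong_mult) (simp_all add: cong_def)

lemma coh_Suc: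
  assumes "coh p x" shows "coh p (\<lambda>n. x (Suc n))"
proof (rule cohI)
  fix n
  have "[x (Suc (Suc n)) = x (Suc n)] (mod int p ^ Suc n)" using assms unfolding coh_def by blast
  thus "[x (Suc (Suc n)) = x (Suc n)] (mod int p ^ n)" by (rule cong_dvd_modulus) simp
qed

lemma red_Suc:
  assumes "x \<in> carrier (Zp p)" shows "red p (\<lambda>n. x (Suc n)) = x"
proof
  fix n
  have "[x (Suc n) = x n] (mod int p ^ n)" "x n mod int p ^ n = x n"
    using assms unfolding Zp_mem coh_def by blast+
  thus "red p (\<lambda>n. x (Suc n)) n = x n" by (simp add: red_def cong_def)
qed

lemma ofs_mult: "ofs A \<otimes>\<^bsub>M2 (Zp p)\<^esub> ofs B = ofs (\<lambda>n. A n * B n)"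
  by (simp add: ofs_def M2_def Zp_ops red_def mod_simps mod_dot_product)

lemma ofs_one: "\<one>\<^bsub>M2 (Zp p)\<^esub> = ofs (\<lambda>_. 1)"
  by (simp add: ofs_def M2_def Zp_ops red_def)

lemma ofs_eq_iff: "ofs A = ofs B \<longleftrightarrow> (\<forall>n. mcong (int p ^ n) (A n) (B n))"
  unfolding ofs_def prod.inject red_def fun_eq_iff mcong_def cong_iff_dvd_diff[symmetric] cong_def
  by blast

lemma ofs_mem: "cohM A \<Longrightarrow> ofs A \<in> carrier (M2 (Zp p))"
  by (simp add: ofs_def M2_def cohM_iff red_mem)

text \<open>Indices are shifted by one, so that even the entry of index 0 carries the residue modulo
  \<open>p\<close>. Invertibility can then be read off at every index, as \<open>GLs\<close>
  demands.\<close>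

lemma M2_eq_ofs:
  assumes "X \<in> carrier (M2 (Zp p))"
  obtains A where "cohM A" "X = ofs A" "\<And>n. mcong (int p) (A n) (A 0)"
proof -
  obtain a b c d where X: "X = ((a, b), (c, d))" by (metis prod.collapse)
  have Z: "a \<in> carrier (Zp p)" "b \<in> carrier (Zp p)" "c \<in> carrier (Zp p)" "d \<in> carrier (Zp p)"
    using assms by (auto simp: X M2_def)
  define A where "A = (\<lambda>n. Mat (a (Suc n)) (b (Suc n)) (c (Suc n)) (d (Suc n)))"
  have r: "red p (\<lambda>n. x (Suc n)) = x" if "x \<in> carrier (Zp p)" for x
    using that by (rule red_Suc)
  have c: "coh p (\<lambda>n. x (Suc n))" if "x \<in> carrier (Zp p)" for x
    using that coh_Suc by (simp add: Zp_mem)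
  have d: "[x (Suc n) = x (Suc 0)] (mod int p)" if "x \<in> carrier (Zp p)" for x n
    using coh_le[of p x 1 "Suc n"] that by (simp add: Zp_mem)
  show thesis
  proof (rule that)
    show "cohM A" using Z c by (simp add: cohM_iff A_def)
    show "X = ofs A" using Z r by (simp add: X ofs_def A_def)
    show "mcong (int p) (A n) (A 0)" for n
      using Z d by (simp add: A_def mcong_def cong_iff_dvd_diff)
  qed
qed

lemma Units_M2: "Units (M2 (Zp p)) = ofs ` GLs"
proof (intro equalityI subsetI)
  fix X assume X: "X \<in> Units (M2 (Zp p))"
  then obtain Y where Y: "X \<in> carrier (M2 (Zp p))" "Y \<in> carrier (M2 (Zp p))"
    "Y \<otimes>\<^bsub>M2 (Zp p)\<^esub> X = \<one>\<^bsub>M2 (Zp p)\<^esub>" by (auto simp: Units_def)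
  obtain A where A: "cohM A" "X = ofs A" "\<And>n. mcong (int p) (A n) (A 0)" using M2_eq_ofs[OF Y(1)] by metis
  obtain B where B: "Y = ofs B" using M2_eq_ofs[OF Y(2)] by blast
  have "mcong (int p ^ 1) (B 1 * A 1) 1" using Y(3) unfolding A B ofs_mult ofs_one ofs_eq_iff by blast
  from mcong_mdet[OF this] have "[mdet (B 1) * mdet (A 1) = 1] (mod int p)"
    by (simp add: mdet_mult)
  hence "\<not> int p dvd mdet (A 1)" using cong_dvd_iff not_dvd_1 dvd_mult by blast
  moreover have "[mdet (A n) = mdet (A 1)] (mod int p)" for n
    using mcong_mdet[OF A(3)] cong_sym cong_trans by blast
  ultimately have "\<not> int p dvd mdet (A n)" for n using cong_dvd_iff by blast
  thus "X \<in> ofs ` GLs" using A by (auto simp: GLs_iff)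
next
  fix X assume "X \<in> ofs ` GLs"
  then obtain A where A: "A \<in> GLs" "X = ofs A" by blast
  have c: "cohM A" using A by (simp add: GLs_iff)
  have cd: "coh p (\<lambda>n. mdet (A n))" unfolding mdet_def using c by (simp add: cohM_iff coh_intros)
  have "red p (\<lambda>n. mdet (A n)) \<in> Units (Zp p)"
    using GLsD(2)[OF A(1)] by (simp add: Units_iff red_mem cd) (simp add: red_def dvd_mod_iff)
  then obtain e where e: "e \<in> carrier (Zp p)" "e \<otimes>\<^bsub>Zp p\<^esub> red p (\<lambda>n. mdet (A n)) = \<one>\<^bsub>Zp p\<^esub>"
    by (auto simp: Units_def)
  have "[e n * mdet (A n) = 1] (mod int p ^ n)" for n
    using fun_cong[OF e(2), of n] by (simp add: Zp_ops red_def cong_def mod_simps)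
  hence e1: "mcong (int p ^ n) (of_int (e n * mdet (A n))) (of_int 1)" for n by (rule mcong_of_int)
  let ?B = "\<lambda>n. of_int (e n) * madj (A n)"
  have BA: "?B n * A n = of_int (e n * mdet (A n))" "A n * ?B n = of_int (e n * mdet (A n))" for n
    by (intro imat_eqI; simp add: mdet_def algebra_simps)+
  have "cohM ?B" using c e(1) by (simp add: cohM_iff Zp_mem coh_intros)
  hence "ofs ?B \<in> carrier (M2 (Zp p))" by (rule ofs_mem)
  moreover have "ofs ?B \<otimes>\<^bsub>M2 (Zp p)\<^esub> X = \<one>\<^bsub>M2 (Zp p)\<^esub>" "X \<otimes>\<^bsub>M2 (Zp p)\<^esub> ofs ?B = \<one>\<^bsub>M2 (Zp p)\<^esub>"
    using e1 unfolding A(2) ofs_mult ofs_one ofs_eq_iff BA by simp_all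
  moreover have "X \<in> carrier (M2 (Zp p))" using c A(2) ofs_mem by blast
  ultimately show "X \<in> Units (M2 (Zp p))" unfolding Units_def by blast
qed

lemma scalars_eq: "scalars (Zp p) = {ofs (\<lambda>n. of_int (x n)) | x. coh p x \<and> (\<forall>n. \<not> int p dvd x n)}"
proof (intro equalityI subsetI)
  fix X assume "X \<in> scalars (Zp p)"
  then obtain x where x: "x \<in> Units (Zp p)" "X = ((x, \<zero>\<^bsub>Zp p\<^esub>), (\<zero>\<^bsub>Zp p\<^esub>, x))" by (auto simp: scalars_def)
  hence xc: "x \<in> carrier (Zp p)" "\<not> int p dvd x 1" by (simp_all add: Units_iff)
  have c: "coh p x" using xc by (simp add: Zp_mem)
  have "red p (\<lambda>n. x (Suc n)) = x" using xc red_Suc by blast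
  hence "X = ofs (\<lambda>n. of_int (x (Suc n)))" by (simp add: ofs_def x(2) Zp_ops) (simp add: red_def)
  moreover have "coh p (\<lambda>n. x (Suc n))"
    using c by (rule coh_Suc)
  moreover have "\<not> int p dvd x (Suc n)" for n
    using not_dvd_cong[of "x (Suc n)" "x 1" 1] coh_le[OF c, of 1 "Suc n"] xc(2) by simp
  ultimately show "X \<in> {ofs (\<lambda>n. of_int (x n)) | x. coh p x \<and> (\<forall>n. \<not> int p dvd x n)}"
    by (intro CollectI exI[of _ "\<lambda>n. x (Suc n)"]) simp
next
  fix X assume "X \<in> {ofs (\<lambda>n. of_int (x n)) | x. coh p x \<and> (\<forall>n. \<not> int p dvd x n)}"
  then obtain x where x: "X = ofs (\<lambda>n. of_int (x n))" "coh p x" "\<And>n. \<not> int p dvd x n" by blast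
  have "red p x \<in> Units (Zp p)" using x(3)[of 1] x(2) by (simp add: Units_iff red_mem) (simp add: red_def dvd_mod_iff)
  moreover have "X = ((red p x, \<zero>\<^bsub>Zp p\<^esub>), (\<zero>\<^bsub>Zp p\<^esub>, red p x))" by (simp add: x(1) ofs_def Zp_ops) (simp add: red_def)
  ultimately show "X \<in> scalars (Zp p)" unfolding scalars_def by blast
qed

lemma coset_class_mat_app:
  assumes A: "A \<in> GLs" and u: "primitive p u" and w: "w \<in> Pr p" and eq: "coset_class p n u = W p n w"
  shows "coset_class p n (mat_app (Zp p) (ofs A) u) = W p n (mapp (A n) w)"
proof -
  let ?v = "mat_app (Zp p) (ofs A) u"
  have dot: "(a mod m * b + c mod m * d) mod m = (a * b + c * d) mod m" for a b c d m :: int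
    unfolding cong_def[symmetric] by (intro cong_add cong_mult) (simp_all add: cong_def)
  have c: "cohM A" using A by (simp add: GLs_iff)
  have v: "fst ?v n = fst (mapp (A n) (fst u n, snd u n)) mod int p ^ n"
    "snd ?v n = snd (mapp (A n) (fst u n, snd u n)) mod int p ^ n" for n
    by (simp_all add: mat_app_def ofs_def split_beta Zp_ops red_def mapp_def mod_simps dot)
  have "?v \<in> carrier (L0 p)"
    using primitive_mem[OF u] ofs_mem[OF c] by (auto simp: L0_carrier mat_app_def M2_def split_beta)
  moreover have "(fst u 1, snd u 1) \<in> Pr p" using primitive_at[OF u, of 1] by (simp add: Pr_def)
  from mapp_Pr[OF this GLsD(2)[OF A, of 1]]
  have "\<not> (int p dvd fst ?v 1 \<and> int p dvd snd ?v 1)" by (simp add: v Pr_def dvd_mod_iff)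
  ultimately have vp: "primitive p ?v" by (simp add: primitive_iff)
  have mw: "mapp (A n) w \<in> Pr p" using w A mapp_Pr GLsD by blast
  have "par_at n u (cvec p w)"
    using eq u cvec_primitive[OF w] by (simp add: W_def coset_class_eq_iff hom_at_iff)
  hence "[fst u n * snd w = snd u n * fst w] (mod int p ^ n)"
    by (simp add: par_at_def cvec_def red_def cong_def mod_simps)
  hence "int p ^ n dvd mdet (A n) * vdet (fst u n, snd u n) w"
    by (simp add: vdet_def cong_iff_dvd_diff)
  hence "int p ^ n dvd vdet (mapp (A n) (fst u n, snd u n)) (mapp (A n) w)" by (simp add: vdet_mapp)
  hence "par_at n ?v (cvec p (mapp (A n) w))"
    by (simp add: par_at_def cvec_def red_def v vdet_def cong_iff_dvd_diff[symmetric]) (simp add: cong_def mod_simps)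
  thus ?thesis using vp cvec_primitive[OF mw] by (simp add: W_def coset_class_eq_iff hom_at_iff)
qed

text \<open>The members of a coset differ by unit scalars, which fix every vertex, and by
  \<open>coset_class_mat_app\<close> the image does not depend on the vector \<open>u\<close>
  either. So the description under \<open>THE\<close> has one solution.\<close>

lemma PGL2_act_eq:
  assumes A: "A \<in> GLs"
  shows "PGL2_act p (scalars (Zp p) #>\<^bsub>GL2 (Zp p)\<^esub> ofs A) = act A"
proof
  fix v
  let ?X = "scalars (Zp p) #>\<^bsub>GL2 (Zp p)\<^esub> ofs A"
  have X: "?X = {ofs (\<lambda>n. of_int (x n) * A n) | x. coh p x \<and> (\<forall>n. \<not> int p dvd x n)}"
    by (auto simp: r_coset_def GL2_def units_of_mult scalars_eq ofs_mult)
  have V: "verts (lattice_tree p) = vts UNIV" by (simp add: lattice_tree_eq)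
  show "PGL2_act p ?X v = act A v"
  proof (cases "v \<in> vts UNIV")
    case True
    then obtain n w where vw: "v = W p n w" "w \<in> Pr p" by (auto elim: vts_cases)
    have xA: "coset_class p m (mat_app (Zp p) (ofs (\<lambda>n. of_int (x n) * A n)) u) = W p n (mapp (A n) w)"
      if "coh p x" "\<forall>n. \<not> int p dvd x n" "primitive p u" "v = coset_class p m u" for x u m
    proof -
      have "m = n" using that(3,4) cvec_primitive[OF vw(2)] vw(1) by (simp add: W_def coset_class_eq_iff)
      have "cohM (\<lambda>n. of_int (x n) * A n)" using that(1) A by (simp add: GLs_iff cohM_iff coh_intros)
      hence G: "(\<lambda>n. of_int (x n) * A n) \<in> GLs"
        using A that(2) by (simp add: GLs_iff prime_dvd_mult_int power2_eq_square)
      have "coset_class p n (mat_app (Zp p) (ofs (\<lambda>n. of_int (x n) * A n)) u) = W p n (mapp (of_int (x n) * A n) w)"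
        using coset_class_mat_app[OF G that(3) vw(2)] that(4) vw(1) \<open>m = n\<close> by simp
      also have "\<dots> = W p n (mapp (A n) w)"
      proof -
        have "proj_eq n (of_int (x n) * A n) (A n)" unfolding proj_eq_def using that(2) by blast
        thus ?thesis using W_mapp_iff[of "of_int (x n) * A n" "A n" n] GLsD(2)[OF G] GLsD(2)[OF A] vw(2) by blast
      qed
      finally show ?thesis using \<open>m = n\<close> by simp
    qed
    have "(THE y. \<exists>B\<in>?X. \<exists>n u. primitive p u \<and> v = coset_class p n u \<and> y = coset_class p n (mat_app (Zp p) B u))
      = W p n (mapp (A n) w)"
    proof (rule the_equality)
      have "ofs A \<in> ?X" unfolding X using coh_const[of p 1] not_dvd_1 by (force intro!: exI[of _ "\<lambda>_. 1"])
      moreover have "v = coset_class p n (cvec p w)" using vw by (simp add: W_def)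
      moreover from this have "W p n (mapp (A n) w) = coset_class p n (mat_app (Zp p) (ofs A) (cvec p w))"
        using coset_class_mat_app[OF A cvec_primitive[OF vw(2)] vw(2), of n] vw(1) by simp
      ultimately show "\<exists>B\<in>?X. \<exists>m u. primitive p u \<and> v = coset_class p m u \<and>
          W p n (mapp (A n) w) = coset_class p m (mat_app (Zp p) B u)"
        using cvec_primitive[OF vw(2)] by blast
    next
      fix y assume "\<exists>B\<in>?X. \<exists>n u. primitive p u \<and> v = coset_class p n u \<and> y = coset_class p n (mat_app (Zp p) B u)"
      thus "y = W p n (mapp (A n) w)" unfolding X using xA by blast
    qed
    thus ?thesis using True vw act_W[OF A vw(2)] by (simp add: PGL2_act_def V)
  qed (simp add: PGL2_act_def V act_def)
qed

lemma PGL2_Iso_eq: "PGL2_Iso p = act ` GLs"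
proof -
  have "carrier (PGL2 (Zp p)) = (\<lambda>A. scalars (Zp p) #>\<^bsub>GL2 (Zp p)\<^esub> ofs A) ` GLs"
    by (auto simp: PGL2_def FactGroup_def RCOSETS_def GL2_def units_of_carrier Units_M2)
  thus ?thesis using PGL2_act_eq by (simp add: PGL2_Iso_def image_image)
qed

end

section \<open>Counting conjugacy classes\<close>

text \<open>Here \<open>f\<close> and \<open>g\<close> assign classes, and \<open>F\<close> need
  only be surjective up to equivalence. This serves to pass from coherent sequences to single
  integer matrices, and from pairs (trace, determinant) to matrices.\<close>

lemma card_image_transfer:
  assumes F: "\<And>x. x \<in> X \<Longrightarrow> F x \<in> Y" and ex: "\<And>y. y \<in> Y \<Longrightarrow> \<exists>x\<in>X. g (F x) = g y"
    and eq: "\<And>x x'. x \<in> X \<Longrightarrow> x' \<in> X \<Longrightarrow> f x = f x' \<longleftrightarrow> g (F x) = g (F x')"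
  shows "card (g ` Y) = card (f ` X)" "finite (f ` X) \<Longrightarrow> finite (g ` Y)"
proof -
  have gY: "g ` Y = (g \<circ> F) ` X" using F ex by force
  define h where "h = (\<lambda>c. g (F (inv_into X f c)))"
  have h: "h (f x) = g (F x)" if "x \<in> X" for x
    using eq[of "inv_into X f (f x)" x] that by (simp add: h_def inv_into_into f_inv_into_f)
  have im: "h ` f ` X = g ` Y" unfolding gY image_image using h by auto
  have "inj_on h (f ` X)" using h eq by (auto simp: inj_on_def)
  thus "card (g ` Y) = card (f ` X)" using card_image im by metis
  show "finite (f ` X) \<Longrightarrow> finite (g ` Y)" using im by (metis finite_imageI)
qed

text \<open>As \<open>R\<close> is known to be an equivalence relation, \<open>\<Lambda>\<close> needs neither a unit nor inverses.\<close>
lemma burnside: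
  assumes fin: "finite X" "finite \<Lambda>" and equiv: "equiv X R"
    and R: "\<And>x y. x \<in> X \<Longrightarrow> y \<in> X \<Longrightarrow> (x, y) \<in> R \<longleftrightarrow> (\<exists>c\<in>\<Lambda>. \<alpha> c x = y)"
    and \<alpha>: "\<And>c x. c \<in> \<Lambda> \<Longrightarrow> x \<in> X \<Longrightarrow> \<alpha> c x \<in> X"
    and op: "\<And>e c. e \<in> \<Lambda> \<Longrightarrow> c \<in> \<Lambda> \<Longrightarrow> op e c \<in> \<Lambda>"
    and op_\<alpha>: "\<And>e c x. e \<in> \<Lambda> \<Longrightarrow> c \<in> \<Lambda> \<Longrightarrow> x \<in> X \<Longrightarrow> \<alpha> (op e c) x = \<alpha> e (\<alpha> c x)"
    and inj: "\<And>c. c \<in> \<Lambda> \<Longrightarrow> inj_on (\<lambda>e. op e c) \<Lambda>"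
  shows "card (X // R) * card \<Lambda> = card {(c, x) \<in> \<Lambda> \<times> X. \<alpha> c x = x}"
proof -
  define S where "S x y = {c \<in> \<Lambda>. \<alpha> c x = y}" for x y
  have finS: "finite (S x y)" for x y using fin by (simp add: S_def)
  \<comment> \<open>Right multiplication by \<open>c0\<close> injects the transporter from
    \<open>z\<close> to \<open>y\<close> into that from \<open>x\<close> to \<open>y\<close>. Two
    such inequalities take the place of the bijection that inverses would give.\<close>
  have le: "card (S z y) \<le> card (S x y)" if "c0 \<in> \<Lambda>" "\<alpha> c0 x = z" "x \<in> X" for c0 x y z
  proof (rule card_inj_on_le)
    show "inj_on (\<lambda>e. op e c0) (S z y)" using inj[OF that(1)] by (auto simp: S_def inj_on_def)
    show "(\<lambda>e. op e c0) ` S z y \<subseteq> S x y" using op op_\<alpha> that by (auto simp: S_def)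
  qed (rule finS)
  have eq: "card (S x y) = card (S y y)" if "(x, y) \<in> R" for x y
  proof -
    have xy: "x \<in> X" "y \<in> X" "(y, x) \<in> R" using \<open>(x, y) \<in> R\<close> equiv
      by (auto simp: equiv_def refl_on_def dest: symD)
    obtain c c' where "c \<in> \<Lambda>" "\<alpha> c x = y" "c' \<in> \<Lambda>" "\<alpha> c' y = x"
      using R[OF xy(1,2)] R[OF xy(2,1)] xy(3) \<open>(x, y) \<in> R\<close> by blast
    thus ?thesis using le[of c x y y] le[of c' y x y] xy by simp
  qed
  have cls: "(\<Sum>y\<in>C. card (S y y)) = card \<Lambda>" if "C \<in> X // R" for C
  proof -
    obtain x where x: "x \<in> X" "C = R `` {x}" using \<open>C \<in> X // R\<close> by (auto simp: quotient_def)
    have C: "C \<subseteq> X" using that equiv by (meson in_quotient_imp_subset)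
    have "\<Lambda> = (\<Union>y\<in>C. S x y)"
      using R x \<alpha> by (auto simp: S_def)
    hence "card \<Lambda> = (\<Sum>y\<in>C. card (S x y))"
      using card_UN_disjoint[of C "S x"] C fin finS by (auto simp: S_def finite_subset)
    also have "\<dots> = (\<Sum>y\<in>C. card (S y y))" using eq x by (intro sum.cong) auto
    finally show ?thesis by simp
  qed
  have "{(c, x) \<in> \<Lambda> \<times> X. \<alpha> c x = x} = (\<lambda>(x, c). (c, x)) ` (SIGMA x:X. S x x)" by (auto simp: S_def)
  hence "card {(c, x) \<in> \<Lambda> \<times> X. \<alpha> c x = x} = card (SIGMA x:X. S x x)"
    by (simp add: card_image inj_on_def split_beta prod_eq_iff)
  also have "\<dots> = (\<Sum>x\<in>X. card (S x x))" using fin finS by simp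
  also have "\<dots> = (\<Sum>x\<in>\<Union>(X // R). card (S x x))" using Union_quotient[OF equiv] by simp
  also have "\<dots> = (\<Sum>C\<in>X // R. \<Sum>x\<in>C. card (S x x))"
  proof (rule sum.Union_disjoint[unfolded comp_def])
    show "\<forall>A\<in>X // R. finite A" using fin equiv by (meson finite_equiv_class equiv_def)
    show "\<forall>A\<in>X // R. \<forall>B\<in>X // R. A \<noteq> B \<longrightarrow> A \<inter> B = {}" using equiv quotient_disj by blast
  qed
  also have "\<dots> = card (X // R) * card \<Lambda>" using cls by simp
  finally show ?thesis by simp
qed

section \<open>Conjugacy modulo \<open>p ^ n\<close>, normal forms and their orbits\<close>

context prime_tree
begin

lemma inverse_mod: assumes "\<not> int p dvd k" obtains i where "[k * i = 1] (mod int p ^ n)" "\<not> int p dvd i"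
proof -
  obtain i where i: "[k * i = 1] (mod int p ^ Suc n)"
    using cong_solve_coprime_int coprime_pow[OF assms] by blast
  have "\<not> int p dvd k * i" using not_dvd_cong[OF i] not_dvd_1 by blast
  moreover have "[k * i = 1] (mod int p ^ n)" by (rule cong_dvd_modulus[OF i]) simp
  ultimately show thesis using that dvd_mult by blast
qed

lemma proj_eq_sym: assumes "proj_eq n A B" shows "proj_eq n B A"
proof -
  obtain k where k: "\<not> int p dvd k" "mcong (int p ^ n) A (of_int k * B)" using assms by (auto simp: proj_eq_def)
  obtain i where i: "[k * i = 1] (mod int p ^ n)" "\<not> int p dvd i" using inverse_mod[OF k(1)] .
  have "mcong (int p ^ n) (of_int i * A) (of_int i * (of_int k * B))" by (intro mcong_mult mcong_refl k)
  also have "of_int i * (of_int k * B) = of_int (k * i) * B" by (simp add: mult.assoc[symmetric] of_int_mult[symmetric] mult.commute del: of_int_mult)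
  also have "mcong (int p ^ n) (of_int (k * i) * B) (of_int 1 * B)" by (intro mcong_mult mcong_refl mcong_of_int i)
  finally show ?thesis using i(2) mcong_sym by (auto simp: proj_eq_def)
qed

definition sim :: "nat \<Rightarrow> imat \<Rightarrow> imat \<Rightarrow> bool" where
  "sim n A B \<longleftrightarrow> (\<exists>H. \<not> int p dvd mdet H \<and> proj_eq n (H * A) (B * H))"

definition ract :: "nat set \<Rightarrow> (nat \<Rightarrow> imat) \<Rightarrow> vec set set \<Rightarrow> vec set set" where
  "ract I A = restrict (act A) (vts I)"

definition lower :: "nat set \<Rightarrow> bool" where
  "lower I \<longleftrightarrow> 0 \<in> I \<and> (\<forall>n. Suc n \<in> I \<longrightarrow> n \<in> I)"

lemma lower_simps [simp]: "lower UNIV" "lower {..n}" by (auto simp: lower_def)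

lemma ract_Iso: "lower I \<Longrightarrow> A \<in> GLs \<Longrightarrow> ract I A \<in> carrier (Iso (tr I))"
  unfolding ract_def lower_def using act_Iso by blast

lemma ract_UNIV [simp]: "ract UNIV A = act A"
  using act_ext by (simp add: ract_def extensional_restrict)

lemma ract_mult:
  assumes "lower I" "A \<in> GLs" "B \<in> GLs"
  shows "ract I A \<otimes>\<^bsub>Iso (tr I)\<^esub> ract I B = ract I (\<lambda>n. A n * B n)"
proof -
  have "vts I \<subseteq> vts UNIV" by (rule vts_mono) simp
  hence "compose (vts I) (ract I A) (ract I B) v = ract I (\<lambda>n. A n * B n) v" for v
    using assms act_mem[of B v I] by (auto simp: ract_def act_mult compose_def)
  thus ?thesis using assms by (simp add: Iso_mult ract_Iso ext)
qed

lemma ract_one: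
  assumes "lower I" shows "ract I (\<lambda>n. 1) = \<one>\<^bsub>Iso (tr I)\<^esub>"
proof -
  interpret group "Iso (tr I)" using assms by (intro group_Iso_tr) (simp add: lower_def)
  have "ract I (\<lambda>n. 1) \<otimes>\<^bsub>Iso (tr I)\<^esub> ract I (\<lambda>n. 1) = ract I (\<lambda>n. 1)"
    using ract_mult[OF assms GLs_one GLs_one] by simp
  thus ?thesis using ract_Iso[OF assms GLs_one] l_cancel_one by blast
qed

lemma ract_eqI:
  assumes "A \<in> GLs" "B \<in> GLs" "\<And>n. proj_eq n (A n) (B n)"
  shows "ract I A = ract I B"
  using act_eq_iff[OF assms(1,2)] assms(3) by (simp add: ract_def)

lemma subgroup_ract:
  assumes I: "lower I" shows "subgroup (ract I ` GLs) (Iso (tr I))"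
proof -
  interpret group "Iso (tr I)" using assms by (intro group_Iso_tr) (simp add: lower_def)
  show ?thesis
  proof (rule subgroupI)
    show "ract I ` GLs \<subseteq> carrier (Iso (tr I))" using ract_Iso[OF I] by blast
    show "ract I ` GLs \<noteq> {}" using GLs_one by blast
  next
    fix f assume "f \<in> ract I ` GLs"
    then obtain A where A: "A \<in> GLs" "f = ract I A" by blast
    have "ract I (\<lambda>n. madj (A n)) \<otimes>\<^bsub>Iso (tr I)\<^esub> f = ract I (\<lambda>n. of_int (mdet (A n)))"
      unfolding A(2) ract_mult[OF I GLs_madj[OF A(1)] A(1)] by simp
    also have "\<dots> = ract I (\<lambda>n. 1)"
    proof (rule ract_eqI[OF _ GLs_one])
      show "(\<lambda>n. of_int (mdet (A n))) \<in> GLs"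
        using GLs_mult[OF GLs_madj[OF A(1)] A(1)] by simp
      show "proj_eq n (of_int (mdet (A n))) 1" for n
        unfolding proj_eq_def using GLsD(2)[OF A(1)] by (intro exI[of _ "mdet (A n)"]) simp
    qed
    also have "\<dots> = \<one>\<^bsub>Iso (tr I)\<^esub>" by (rule ract_one[OF I])
    finally have "inv\<^bsub>Iso (tr I)\<^esub> f = ract I (\<lambda>n. madj (A n))"
      using inv_equality ract_Iso[OF I] A GLs_madj by blast
    thus "inv\<^bsub>Iso (tr I)\<^esub> f \<in> ract I ` GLs" using GLs_madj A by blast
  next
    fix f g assume "f \<in> ract I ` GLs" "g \<in> ract I ` GLs"
    thus "f \<otimes>\<^bsub>Iso (tr I)\<^esub> g \<in> ract I ` GLs" using ract_mult[OF I] GLs_mult by auto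
  qed
qed

lemma level_equiv_eq:
  "level_equiv (tr UNIV) (act ` GLs) n = {(g, g'). g \<in> carrier (Iso (tr UNIV)) \<and> g' \<in> carrier (Iso (tr UNIV)) \<and>
     (restr (tr UNIV) n g, restr (tr UNIV) n g') \<in> conj_rel (Iso (tr {..n})) (ract {..n} ` GLs)}"
proof -
  have "restr (tr UNIV) n ` act ` GLs = ract {..n} ` GLs"
    by (simp add: image_image restr_act ract_def)
  thus ?thesis by (simp add: level_equiv_def truncate_tr)
qed

lemma group_tr: "lower I \<Longrightarrow> group (Iso (tr I))"
  by (intro group_Iso_tr) (simp add: lower_def)

lemma level_equiv_act_iff:
  assumes A: "A \<in> GLs" and B: "B \<in> GLs"
  shows "(act A, act B) \<in> level_equiv (tr UNIV) (act ` GLs) n \<longleftrightarrow> sim n (A n) (B n)"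
proof -
  interpret G: group "Iso (tr {..n})" by (rule group_tr) simp
  have I: "lower {..n}" by simp
  have "(act A, act B) \<in> level_equiv (tr UNIV) (act ` GLs) n \<longleftrightarrow>
      (ract {..n} A, ract {..n} B) \<in> conj_rel (Iso (tr {..n})) (ract {..n} ` GLs)"
    using ract_Iso[of UNIV] assms by (simp add: level_equiv_eq restr_act ract_def[symmetric])
  also have "\<dots> \<longleftrightarrow> (\<exists>H\<in>GLs. ract {..n} (\<lambda>k. B k * H k) = ract {..n} (\<lambda>k. H k * A k))"
    using ract_Iso[OF I] assms by (auto simp: G.conj_rel_iff[OF subgroup_ract[OF I]] ract_mult[OF I])
  also have "\<dots> \<longleftrightarrow> (\<exists>H\<in>GLs. proj_eq n (B n * H n) (H n * A n))"
    unfolding ract_def using restrict_act_eq_iff GLs_mult assms by (intro bex_cong refl) blast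
  \<comment> \<open>Only the entry \<open>H n\<close> matters on this level, so the conjugating
    sequence may be taken constant.\<close>
  also have "\<dots> \<longleftrightarrow> sim n (A n) (B n)"
    unfolding sim_def using proj_eq_sym GLsD(2) GLs_const by metis
  finally show ?thesis .
qed

lemma level_equiv_sym_trans:
  "sym (level_equiv (tr UNIV) (act ` GLs) n)" "trans (level_equiv (tr UNIV) (act ` GLs) n)"
proof -
  interpret G: group "Iso (tr {..n})" by (rule group_tr) simp
  have S: "subgroup (ract {..n} ` GLs) (Iso (tr {..n}))" by (rule subgroup_ract) simp
  show "sym (level_equiv (tr UNIV) (act ` GLs) n)"
    unfolding level_equiv_eq sym_def using symD[OF G.sym_conj_rel[OF S]] by blast
  show "trans (level_equiv (tr UNIV) (act ` GLs) n)"
    unfolding level_equiv_eq trans_def using transD[OF G.trans_conj_rel[OF S]] by blast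
qed

definition GZ :: "imat set" where "GZ = {A. \<not> int p dvd mdet A}"

definition simrel :: "nat \<Rightarrow> (imat \<times> imat) set" where
  "simrel n = {(A, B). A \<in> GZ \<and> B \<in> GZ \<and> sim n A B}"

lemma simrel_level: "(A, B) \<in> simrel n \<longleftrightarrow> A \<in> GZ \<and> B \<in> GZ \<and>
    (act (\<lambda>_. A), act (\<lambda>_. B)) \<in> level_equiv (tr UNIV) (act ` GLs) n"
  using level_equiv_act_iff[of "\<lambda>_. A" "\<lambda>_. B" n] GLs_const[of A] GLs_const[of B]
  by (auto simp: simrel_def GZ_def)

lemma sim_refl: "sim n A A"
  unfolding sim_def using proj_eq_refl by (intro exI[of _ 1]) simp

text \<open>Symmetry and transitivity are inherited from \<open>level_equiv\<close> through constant
  sequences, instead of composing proportionality factors by hand.\<close>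

lemma equiv_simrel: "equiv GZ (simrel n)"
proof (rule equivI)
  show "refl_on GZ (simrel n)" by (auto simp: refl_on_def simrel_def sim_refl)
  show "sym (simrel n)" using symD[OF level_equiv_sym_trans(1)] by (auto simp: sym_def simrel_level)
  show "trans (simrel n)" using transD[OF level_equiv_sym_trans(2)] unfolding trans_def simrel_level by blast
qed (auto simp: simrel_def)

abbreviation class_number :: "nat \<Rightarrow> nat" where
  "class_number \<equiv> level_count (lattice_tree p) (PGL2_Iso p) (PGL2_Iso p)"

lemma level_count_eq: "class_number n = card ((\<lambda>A. simrel n `` {A}) ` GZ)"
proof -
  let ?r = "level_equiv (tr UNIV) (act ` GLs) n"
  have refl: "(act A, act A) \<in> ?r" if "A \<in> GLs" for A
    using that sim_refl level_equiv_act_iff by blast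
  have "classes_meeting (carrier (Iso (tr UNIV))) ?r (act ` GLs) = (\<lambda>g. ?r `` {g}) ` act ` GLs"
    using ract_Iso[of UNIV] refl by (intro classes_meeting_eq level_equiv_sym_trans) auto
  also have "\<dots> = (\<lambda>A. ?r `` {act A}) ` GLs" by (simp add: image_image)
  finally have "class_number n = card ((\<lambda>A. ?r `` {act A}) ` GLs)"
    by (simp add: level_count_def lattice_tree_eq PGL2_Iso_eq)
  also have "card ((\<lambda>A. simrel n `` {A}) ` GZ) = card ((\<lambda>A. ?r `` {act A}) ` GLs)"
  proof (rule card_image_transfer[where F = "\<lambda>A. A n"])
    show "A n \<in> GZ" if "A \<in> GLs" for A using that by (simp add: GLs_iff GZ_def)
    show "\<exists>x\<in>GLs. simrel n `` {x n} = simrel n `` {A}" if "A \<in> GZ" for A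
      using that GLs_const[of A] by (intro bexI[of _ "\<lambda>_. A"]) (simp_all add: GZ_def)
    fix A B assume AB: "A \<in> GLs" "B \<in> GLs"
    hence "A n \<in> GZ" "B n \<in> GZ" by (simp_all add: GLs_iff GZ_def)
    hence "simrel n `` {A n} = simrel n `` {B n} \<longleftrightarrow> sim n (A n) (B n)"
      using eq_equiv_class_iff[OF equiv_simrel] by (simp add: simrel_def)
    thus "?r `` {act A} = ?r `` {act B} \<longleftrightarrow> simrel n `` {A n} = simrel n `` {B n}"
      using class_eq_iff[OF level_equiv_sym_trans refl[OF AB(1)] refl[OF AB(2)]] level_equiv_act_iff[OF AB] by simp
  qed
  finally show ?thesis by simp
qed

text \<open>A matrix that is scalar modulo \<open>p ^ k\<close> but not modulo \<open>p ^ Suc k\<close> is, projectively and modulo \<open>p ^ n\<close>,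
  conjugate to \<open>1 + p ^ k C\<close> with a companion matrix \<open>C\<close> modulo \<open>p ^ (n - k)\<close>.\<close>
definition nf :: "nat \<Rightarrow> int \<times> int \<Rightarrow> imat" where
  "nf k x = 1 + of_int (int p ^ k) * companion (fst x) (snd x)"

definition nfdet :: "nat \<Rightarrow> int \<times> int \<Rightarrow> int" where
  "nfdet k x = 1 + int p ^ k * fst x + int p ^ (2 * k) * snd x"

text \<open>Trace and determinant of \<open>c + (1 + p ^ k c) C\<close>, where \<open>1 + p ^ k (c + (1 + p ^ k c) C) = (1 + p ^ k c) (1 + p ^ k C)\<close>.\<close>
definition shift :: "nat \<Rightarrow> int \<Rightarrow> int \<times> int \<Rightarrow> int \<times> int" where
  "shift k c x = (2 * c + (1 + int p ^ k * c) * fst x,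
     c^2 + c * (1 + int p ^ k * c) * fst x + (1 + int p ^ k * c)^2 * snd x)"

definition red2 :: "nat \<Rightarrow> int \<times> int \<Rightarrow> int \<times> int" where
  "red2 m x = (fst x mod int p ^ m, snd x mod int p ^ m)"

definition Xs :: "nat \<Rightarrow> nat \<Rightarrow> (int \<times> int) set" where
  "Xs k m = {x \<in> {0..<int p ^ m} \<times> {0..<int p ^ m}. \<not> int p dvd nfdet k x}"

text \<open>A number \<open>c\<close> stands for the unit \<open>1 + p ^ k * c\<close>. For
  \<open>k = 0\<close> these are all units modulo \<open>p ^ m\<close>; for \<open>k > 0\<close> the
  condition excludes no \<open>c\<close>.\<close>

definition Ls :: "nat \<Rightarrow> nat \<Rightarrow> int set" where
  "Ls k m = {c \<in> {0..<int p ^ m}. \<not> int p dvd 1 + int p ^ k * c}"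

text \<open>The matrices that are scalar to the exact order \<open>k\<close>, as far as level
  \<open>n\<close> can tell: for \<open>k = n\<close> nothing finer is visible, so no upper
  condition is imposed.\<close>

definition GZk :: "nat \<Rightarrow> nat \<Rightarrow> imat set" where
  "GZk n k = {A \<in> GZ. scalar_mod (int p ^ k) A \<and> (k < n \<longrightarrow> \<not> scalar_mod (int p ^ Suc k) A)}"

lemma mdet_nf: "mdet (nf k x) = nfdet k x"
  by (simp add: mdet_def nf_def nfdet_def algebra_simps power_mult power2_eq_square)

lemma red2_cong: "[fst (red2 m x) = fst x] (mod int p ^ m)" "[snd (red2 m x) = snd x] (mod int p ^ m)"
  by (simp_all add: red2_def)

lemma red2_eq_iff: "red2 m x = red2 m y \<longleftrightarrow> [fst x = fst y] (mod int p ^ m) \<and> [snd x = snd y] (mod int p ^ m)"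
  by (simp add: red2_def cong_def)

lemma red2_Xs: "x \<in> Xs k m \<Longrightarrow> red2 m x = x"
  by (auto simp: red2_def Xs_def)

lemma mtr_shift_companion: "mtr (of_int c + of_int u * companion t d) = 2 * c + u * t"
  by (simp add: mtr_def)

lemma mdet_shift_companion: "mdet (of_int c + of_int u * companion t d) = c^2 + c * u * t + u^2 * d"
  by (simp add: mdet_def algebra_simps power2_eq_square)

lemma cyclic_conj_ex:
  assumes "\<not> scalar_mod (int p) B" "\<not> scalar_mod (int p) B'"
    and "[mtr B = mtr B'] (mod int p ^ m)" "[mdet B = mdet B'] (mod int p ^ m)"
  obtains H where "\<not> int p dvd mdet H" "mcong (int p ^ m) (H * B) (B' * H)"
proof -
  obtain u u' where u: "\<not> int p dvd mdet (basis_mat u B)" "\<not> int p dvd mdet (basis_mat u' B')"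
    using cyclic_vector[OF assms(1)] cyclic_vector[OF assms(2)] unfolding mdet_basis_mat by metis
  hence nz: "mdet (basis_mat u B) \<noteq> 0" by auto
  note c = cyclic_conj[OF mcong_companion[OF assms(3,4)] nz refl, of u']
  show thesis by (rule that[OF _ c(1)]) (simp add: c(2) prime_dvd_mult_int u)
qed

lemma not_scalar_mod_companion: "\<not> scalar_mod (int p) (companion t d)" by (simp add: scalar_mod_def)

lemma dvd_power_not: "\<not> int p dvd 1 + int p ^ k * c" if "k > 0"
proof
  assume "int p dvd 1 + int p ^ k * c"
  moreover have "int p dvd int p ^ k * c" using that by (simp add: dvd_mult2 dvd_power)
  ultimately have "int p dvd 1 + int p ^ k * c - int p ^ k * c" by (rule dvd_diff)
  thus False by simp
qed

lemma mcong_power_factor: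
  "mcong (int p ^ (k + m)) (of_int (int p ^ k) * A) (of_int (int p ^ k) * B) \<longleftrightarrow> mcong (int p ^ m) A B"
  by (simp add: mcong_def power_add right_diff_distrib[symmetric] less_imp_neq[OF p_pos(2), symmetric])

lemma nf_conj_identity:
  "H * nf k x - of_int (1 + int p ^ k * c) * (nf k y * H) = of_int (int p ^ k) *
    (H * companion (fst x) (snd x) - (of_int c + of_int (1 + int p ^ k * c) * companion (fst y) (snd y)) * H)"
  by (intro imat_eqI) (simp_all add: nf_def algebra_simps)

lemma mcong_diff_0: "mcong N A B \<longleftrightarrow> mcong N (A - B) 0" by (simp add: mcong_def)

text \<open>Both forms are 1 modulo \<open>p ^ k\<close>, which forces the projective factor into
  the shape \<open>1 + p ^ k * c\<close>. Dividing by \<open>p ^ k\<close> leaves a genuine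
  conjugacy modulo \<open>p ^ m\<close> between two matrices that are not scalar modulo
  \<open>p\<close>, and these are classified by trace and determinant.\<close>

lemma sim_nf:
  assumes n: "n = k + m" and mpos: "m > 0" and x: "\<not> int p dvd nfdet k x" and y: "\<not> int p dvd nfdet k y"
  shows "sim n (nf k x) (nf k y) \<longleftrightarrow> (\<exists>c. \<not> int p dvd 1 + int p ^ k * c \<and> red2 m (shift k c y) = red2 m x)"
proof
  assume "sim n (nf k x) (nf k y)"
  then obtain H l where H: "\<not> int p dvd mdet H" "\<not> int p dvd l"
    "mcong (int p ^ n) (H * nf k x) (of_int l * (nf k y * H))" by (auto simp: sim_def proj_eq_def)
  have "mcong (int p ^ k) (nf k z) 1" for z by (simp add: nf_def mcong_def)
  hence "mcong (int p ^ k) (H * nf k x) (H * 1)" "mcong (int p ^ k) (of_int l * (nf k y * H)) (of_int l * (1 * H))"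
    by (intro mcong_mult mcong_refl; simp)+
  moreover have "mcong (int p ^ k) (H * nf k x) (of_int l * (nf k y * H))"
    by (rule mcong_dvd[OF H(3)]) (simp add: n power_add)
  ultimately have "mcong (int p ^ k) H (of_int l * H)" using mcong_trans mcong_sym by (metis mult_1 mult_1_right)
  \<comment> \<open>The adjugate removes \<open>H\<close> from \<open>H = l * H\<close>, leaving
    \<open>mdet H = l * mdet H\<close> modulo \<open>p ^ k\<close>.\<close>
  from mcong_mult[OF this mcong_refl[of _ "madj H"]]
  have "mcong (int p ^ k) (of_int (mdet H)) (of_int (l * mdet H))" by (simp add: mult.assoc)
  hence "int p ^ k dvd (l - 1) * mdet H" by (auto simp: mcong_def algebra_simps dvd_diff_commute)
  hence "int p ^ k dvd l - 1" using coprime_pow[OF H(1), of k] by (simp add: coprime_commute coprime_dvd_mult_left_iff)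
  then obtain c where "l - 1 = int p ^ k * c" by (auto simp: dvd_def)
  hence c: "l = 1 + int p ^ k * c" by simp
  let ?B = "of_int c + of_int (1 + int p ^ k * c) * companion (fst y) (snd y)"
  have "mcong (int p ^ n) (of_int (int p ^ k) * (H * companion (fst x) (snd x) - ?B * H)) (of_int (int p ^ k) * 0)"
    using H(3) unfolding c mcong_diff_0[of _ "H * nf k x"] nf_conj_identity by simp
  hence conj: "mcong (int p ^ m) (H * companion (fst x) (snd x)) (?B * H)"
    unfolding n mcong_power_factor mcong_diff_0[symmetric] .
  have tr: "[mdet H * mtr (companion (fst x) (snd x)) = mdet H * mtr ?B] (mod int p ^ m)"
  proof -
    have "mcong (int p ^ m) (madj H * (H * companion (fst x) (snd x))) (madj H * (?B * H))"
      by (intro mcong_mult mcong_refl conj)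
    from mcong_mtr[OF this] have "[mtr (of_int (mdet H) * companion (fst x) (snd x)) = mtr (madj H * (?B * H))] (mod int p ^ m)"
      by (simp add: mult.assoc[symmetric])
    also have "mtr (madj H * (?B * H)) = mtr (?B * (H * madj H))"
      by (subst mtr_mult_commute) (simp add: mult.assoc)
    finally show ?thesis by (simp del: of_int_add)
  qed
  have dt: "[mdet H * mdet (companion (fst x) (snd x)) = mdet H * mdet ?B] (mod int p ^ m)"
    using mcong_mdet[OF conj] by (simp add: mdet_mult mult.commute)
  have "[mtr (companion (fst x) (snd x)) = mtr ?B] (mod int p ^ m)" "[mdet (companion (fst x) (snd x)) = mdet ?B] (mod int p ^ m)"
    using tr dt coprime_pow[OF H(1), of m] by (simp_all only: cong_mult_lcancel)
  hence "red2 m (shift k c y) = red2 m x"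
    unfolding mtr_shift_companion mdet_shift_companion
    by (simp add: red2_eq_iff shift_def cong_sym mtr_def) (simp add: mdet_def cong_sym)
  thus "\<exists>c. \<not> int p dvd 1 + int p ^ k * c \<and> red2 m (shift k c y) = red2 m x" using H(2) c by blast
next
  assume "\<exists>c. \<not> int p dvd 1 + int p ^ k * c \<and> red2 m (shift k c y) = red2 m x"
  then obtain c where c: "\<not> int p dvd 1 + int p ^ k * c" "red2 m (shift k c y) = red2 m x" by blast
  let ?B = "of_int c + of_int (1 + int p ^ k * c) * companion (fst y) (snd y)"
  have "\<not> scalar_mod (int p) ?B" using c(1) by (simp add: scalar_mod_def)
  moreover have "[mtr (companion (fst x) (snd x)) = mtr ?B] (mod int p ^ m)" "[mdet (companion (fst x) (snd x)) = mdet ?B] (mod int p ^ m)"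
    using c(2) unfolding mtr_shift_companion mdet_shift_companion
    by (simp_all add: red2_eq_iff shift_def cong_sym mtr_def mdet_def)
  ultimately obtain H where H: "\<not> int p dvd mdet H" "mcong (int p ^ m) (H * companion (fst x) (snd x)) (?B * H)"
    using cyclic_conj_ex[OF not_scalar_mod_companion] by blast
  have "mcong (int p ^ n) (of_int (int p ^ k) * (H * companion (fst x) (snd x) - ?B * H)) (of_int (int p ^ k) * 0)"
    using H(2) unfolding n mcong_power_factor mcong_diff_0[symmetric] .
  hence "mcong (int p ^ n) (H * nf k x) (of_int (1 + int p ^ k * c) * (nf k y * H))"
    unfolding mcong_diff_0[of _ "H * nf k x"] nf_conj_identity by simp
  thus "sim n (nf k x) (nf k y)" unfolding sim_def proj_eq_def using H(1) c(1) by blast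
qed

lemma sim_nf_ex:
  assumes A: "A \<in> GZk n k" and n: "n = k + m" and m: "m > 0"
  shows "\<exists>x\<in>Xs k m. sim n A (nf k x)"
proof -
  have det: "\<not> int p dvd mdet A" and sc: "scalar_mod (int p ^ k) A" "\<not> scalar_mod (int p ^ Suc k) A"
    using A n m by (auto simp: GZk_def GZ_def)
  \<comment> \<open>For \<open>k = 0\<close> the congruence is void and \<open>m11 A\<close> could
    be divisible by \<open>p\<close>; hence the choice \<open>a = 1\<close> there.\<close>
  obtain a where a: "\<not> int p dvd a" "mcong (int p ^ k) A (of_int a)"
  proof (cases "k = 0")
    case True
    thus thesis using that[of 1] by simp
  next
    case False
    have 1: "mcong (int p ^ k) A (of_int (m11 A))" using sc(1) scalar_mod_iff by blast
    have "mdet (of_int (m11 A)) = (m11 A)^2" by (simp add: mdet_def power2_eq_square)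
    hence "[mdet A = (m11 A)^2] (mod int p ^ k)" using mcong_mdet[OF 1] by simp
    hence "\<not> int p dvd (m11 A)^2" using not_dvd_cong det False by blast
    thus thesis using that[OF _ 1] by (simp add: power2_eq_square prime_dvd_mult_int)
  qed
  obtain B0 where B0: "A = of_int a + of_int (int p ^ k) * B0" using a(2) by (auto simp: mcong_iff)
  obtain i where i: "[a * i = 1] (mod int p ^ n)" "\<not> int p dvd i" using inverse_mod[OF a(1)] .
  define B where "B = of_int i * B0"
  have iA: "of_int i * A = of_int (a * i) + of_int (int p ^ k) * B"
    by (intro imat_eqI) (simp_all add: B0 B_def algebra_simps)
  have "\<not> scalar_mod (int p) B0"
  proof
    assume "scalar_mod (int p) B0"
    hence "scalar_mod (int p ^ Suc k) A" by (simp add: scalar_mod_def B0 right_diff_distrib[symmetric] mult.commute[of "int p"])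
    thus False using sc by blast
  qed
  hence B: "\<not> scalar_mod (int p) B"
    using i(2) by (auto simp: scalar_mod_def B_def right_diff_distrib[symmetric] prime_dvd_mult_int)
  define x where "x = red2 m (mtr B, mdet B)"
  have "[mtr B = mtr (companion (fst x) (snd x))] (mod int p ^ m)" "[mdet B = mdet (companion (fst x) (snd x))] (mod int p ^ m)"
    using red2_cong[of m "(mtr B, mdet B)"] by (simp_all add: x_def[symmetric] cong_sym mtr_def[of "companion _ _"] mdet_def[of "companion _ _"])
  then obtain H where H: "\<not> int p dvd mdet H" "mcong (int p ^ m) (H * B) (companion (fst x) (snd x) * H)"
    using cyclic_conj_ex[OF B not_scalar_mod_companion] by blast
  have "mcong (int p ^ n) (of_int (a * i) * H) (of_int 1 * H)" by (intro mcong_mult mcong_refl mcong_of_int i)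
  moreover have "mcong (int p ^ n) (of_int (int p ^ k) * (H * B)) (of_int (int p ^ k) * (companion (fst x) (snd x) * H))"
    using H(2) unfolding n mcong_power_factor .
  ultimately have "mcong (int p ^ n) (of_int (a * i) * H + of_int (int p ^ k) * (H * B))
      (of_int 1 * H + of_int (int p ^ k) * (companion (fst x) (snd x) * H))" by (rule mcong_add)
  moreover have "of_int 1 * H + of_int (int p ^ k) * (companion (fst x) (snd x) * H) = nf k x * H"
    by (intro imat_eqI) (simp_all add: nf_def algebra_simps)
  moreover have "of_int (a * i) * H + of_int (int p ^ k) * (H * B) = of_int i * (H * A)"
    by (intro imat_eqI) (simp_all add: B0 B_def algebra_simps)
  ultimately have c: "mcong (int p ^ n) (nf k x * H) (of_int i * (H * A))" using mcong_sym by simp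
  hence "proj_eq n (nf k x * H) (H * A)" using i(2) by (auto simp: proj_eq_def)
  hence s: "sim n A (nf k x)" using H(1) proj_eq_sym by (auto simp: sim_def)
  have "\<not> int p dvd mdet (of_int i * (H * A))"
    using i(2) H(1) det by (simp add: mdet_mult prime_dvd_mult_int power2_eq_square)
  moreover have "n > 0" using n m by simp
  ultimately have "\<not> int p dvd mdet (nf k x * H)" using not_dvd_cong[OF mcong_mdet[OF c]] by blast
  hence "\<not> int p dvd nfdet k x" by (simp add: mdet_mult mdet_nf prime_dvd_mult_int)
  hence "x \<in> Xs k m" by (simp add: Xs_def) (simp add: x_def red2_def)
  thus ?thesis using s by blast
qed

lemma scalar_mod_of_int_mult: "coprime k N \<Longrightarrow> scalar_mod N (of_int k * A) \<longleftrightarrow> scalar_mod N A"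
  by (simp add: scalar_mod_def right_diff_distrib[symmetric] coprime_commute coprime_dvd_mult_right_iff)

lemma sim_scal:
  assumes "sim n A B" "scalar_mod (int p ^ j) A" "j \<le> n"
  shows "scalar_mod (int p ^ j) B"
proof -
  obtain H l where H: "\<not> int p dvd mdet H" "\<not> int p dvd l"
    "mcong (int p ^ n) (H * A) (of_int l * (B * H))" using assms(1) by (auto simp: sim_def proj_eq_def)
  obtain a where a: "mcong (int p ^ j) A (of_int a)" using assms(2) scalar_mod_iff_ex by blast
  have "mcong (int p ^ j) (of_int l * (B * H)) (H * A)"
    by (rule mcong_sym[OF mcong_dvd[OF H(3)]]) (simp add: assms(3) le_imp_power_dvd)
  also have "mcong (int p ^ j) (H * A) (H * of_int a)" by (intro mcong_mult mcong_refl a)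
  finally have "mcong (int p ^ j) (of_int l * (B * H)) (H * of_int a)" .
  hence "mcong (int p ^ j) (of_int l * (B * H) * madj H) (H * of_int a * madj H)"
    by (rule mcong_mult[OF _ mcong_refl])
  moreover have "of_int l * (B * H) * madj H = of_int (l * mdet H) * B"
    "H * of_int a * madj H = of_int (a * mdet H)"
    by (intro imat_eqI; simp add: mdet_def algebra_simps)+
  ultimately have "scalar_mod (int p ^ j) (of_int (l * mdet H) * B)" using scalar_mod_iff_ex by metis
  thus ?thesis using scalar_mod_of_int_mult coprime_pow H prime_dvd_mult_int by blast
qed

abbreviation cl :: "nat \<Rightarrow> imat \<Rightarrow> imat set" where "cl n A \<equiv> simrel n `` {A}"

lemma cl_eq_iff: "A \<in> GZ \<Longrightarrow> B \<in> GZ \<Longrightarrow> cl n A = cl n B \<longleftrightarrow> sim n A B"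
  using eq_equiv_class_iff[OF equiv_simrel] by (simp add: simrel_def)

definition Rk :: "nat \<Rightarrow> nat \<Rightarrow> ((int \<times> int) \<times> (int \<times> int)) set" where
  "Rk k m = {(x, y) \<in> Xs k m \<times> Xs k m. (nf k x, nf k y) \<in> simrel (k + m)}"

lemma nf_GZ: "x \<in> Xs k m \<Longrightarrow> nf k x \<in> GZ" by (simp add: GZ_def mdet_nf Xs_def)

lemma equiv_Rk: "equiv (Xs k m) (Rk k m)"
proof (rule equivI)
  show "Rk k m \<subseteq> Xs k m \<times> Xs k m" by (auto simp: Rk_def)
  show "refl_on (Xs k m) (Rk k m)"
    using nf_GZ by (auto simp: refl_on_def Rk_def simrel_def sim_refl)
  have e: "sym (simrel (k + m))" "trans (simrel (k + m))" using equiv_simrel by (auto simp: equiv_def)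
  show "sym (Rk k m)" using symD[OF e(1)] by (auto simp: sym_def Rk_def)
  show "trans (Rk k m)" using transD[OF e(2)] unfolding trans_def Rk_def by blast
qed

lemma finite_Xs: "finite (Xs k m)" by (simp add: Xs_def)

lemma GZk_classes:
  assumes n: "n = k + m" and m: "m > 0"
  shows "card (cl n ` GZk n k) = card (Xs k m // Rk k m)" "finite (cl n ` GZk n k)"
proof -
  have q: "Xs k m // Rk k m = (\<lambda>x. Rk k m `` {x}) ` Xs k m" by (auto simp: quotient_def)
  have F: "nf k x \<in> GZk n k" if "x \<in> Xs k m" for x
  proof -
    have "\<not> int p * int p ^ k dvd int p ^ k" using p_pos by simp
    moreover have "nf k x \<in> GZ" using that nf_GZ by blast
    ultimately show ?thesis by (simp add: GZk_def) (simp add: nf_def scalar_mod_def)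
  qed
  have ex: "\<exists>x\<in>Xs k m. cl n (nf k x) = cl n A" if A: "A \<in> GZk n k" for A
  proof -
    obtain x where "x \<in> Xs k m" "sim n A (nf k x)" using sim_nf_ex[OF A n m] by blast
    thus ?thesis using cl_eq_iff[of A "nf k x" n] nf_GZ A by (auto simp: GZk_def)
  qed
  have eq: "Rk k m `` {x} = Rk k m `` {y} \<longleftrightarrow> cl n (nf k x) = cl n (nf k y)"
    if "x \<in> Xs k m" "y \<in> Xs k m" for x y
    using eq_equiv_class_iff[OF equiv_Rk that] cl_eq_iff nf_GZ that
    by (auto simp: Rk_def simrel_def n)
  show "card (cl n ` GZk n k) = card (Xs k m // Rk k m)" "finite (cl n ` GZk n k)"
    using card_image_transfer[of "Xs k m" "nf k" "GZk n k" "cl n" "\<lambda>x. Rk k m `` {x}"] F ex eq finite_Xs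
    unfolding q by blast+
qed

lemma GZk_top: "cl n ` GZk n n = {cl n 1}"
proof -
  have one: "1 \<in> GZk n n" by (simp add: GZk_def GZ_def scalar_mod_def)
  have "cl n A = cl n 1" if A: "A \<in> GZk n n" for A
  proof -
    have "proj_eq n A 1" using A scalar_mod_proj_one by (simp add: GZk_def GZ_def)
    hence "sim n A 1" unfolding sim_def by (intro exI[of _ 1]) simp
    thus ?thesis using cl_eq_iff A one by (auto simp: GZk_def)
  qed
  hence "cl n ` GZk n n \<subseteq> {cl n 1}" by blast
  moreover have "cl n 1 \<in> cl n ` GZk n n" using one by (rule imageI)
  ultimately show ?thesis by blast
qed

lemma scalar_mod_le: "scalar_mod (int p ^ k) A \<Longrightarrow> j \<le> k \<Longrightarrow> scalar_mod (int p ^ j) A"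
  unfolding scalar_mod_def using le_imp_power_dvd dvd_trans by blast

lemma GZ_Union: "GZ = (\<Union>k\<le>n. GZk n k)"
proof (intro equalityI subsetI)
  fix A assume A: "A \<in> GZ"
  let ?P = "\<lambda>k. k \<le> n \<and> scalar_mod (int p ^ k) A"
  have P0: "?P 0" by (simp add: scalar_mod_def)
  define k where "k = (GREATEST k. ?P k)"
  have k: "?P k" unfolding k_def by (rule GreatestI_nat[of ?P 0 n]) (use P0 in auto)
  have "\<not> ?P (Suc k)"
    using Greatest_le_nat[of ?P "Suc k" n] unfolding k_def[symmetric] by auto
  hence "A \<in> GZk n k" using A k by (auto simp: GZk_def)
  thus "A \<in> (\<Union>k\<le>n. GZk n k)" using k by blast
qed (auto simp: GZk_def)

lemma GZk_disjoint:
  assumes "j < k" "k \<le> n" shows "cl n ` GZk n j \<inter> cl n ` GZk n k = {}"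
proof (rule ccontr)
  assume "cl n ` GZk n j \<inter> cl n ` GZk n k \<noteq> {}"
  then obtain A B where AB: "A \<in> GZk n j" "B \<in> GZk n k" "cl n A = cl n B" by blast
  hence "A \<in> GZ" "B \<in> GZ" "cl n B = cl n A" by (simp_all add: GZk_def)
  hence "sim n B A" using cl_eq_iff by blast
  moreover have "scalar_mod (int p ^ Suc j) B" using AB(2) assms(1) scalar_mod_le[of k B "Suc j"] by (auto simp: GZk_def)
  ultimately have "scalar_mod (int p ^ Suc j) A" using sim_scal assms by (meson Suc_leI le_trans)
  thus False using AB(1) assms by (auto simp: GZk_def)
qed

text \<open>The order of scalarity is a conjugacy invariant, so the layers contribute separately;
  the summand 1 is the layer \<open>k = n\<close>, which is the class of the identity.\<close>

lemma level_count_sum: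
  "class_number n = 1 + (\<Sum>k<n. card (Xs k (n - k) // Rk k (n - k)))"
proof -
  have fin: "finite (cl n ` GZk n k)" if "k < n" for k
    using GZk_classes(2)[of n k "n - k"] that by simp
  have "class_number n = card (\<Union>k\<le>n. cl n ` GZk n k)"
    unfolding level_count_eq by (subst GZ_Union[of n]) (simp add: image_UN)
  also have "\<dots> = (\<Sum>k\<le>n. card (cl n ` GZk n k))"
  proof (rule card_UN_disjoint)
    show "\<forall>k\<in>{..n}. finite (cl n ` GZk n k)" using fin GZk_top[of n] by (auto simp: le_less)
    show "\<forall>i\<in>{..n}. \<forall>j\<in>{..n}. i \<noteq> j \<longrightarrow> cl n ` GZk n i \<inter> cl n ` GZk n j = {}"
      using GZk_disjoint by (metis Int_commute atMost_iff linorder_neqE_nat)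
  qed simp
  also have "\<dots> = (\<Sum>k<n. card (cl n ` GZk n k)) + 1"
    using GZk_top[of n] by (simp add: lessThan_Suc_atMost[symmetric])
  also have "(\<Sum>k<n. card (cl n ` GZk n k)) = (\<Sum>k<n. card (Xs k (n - k) // Rk k (n - k)))"
    by (intro sum.cong refl GZk_classes) auto
  finally show ?thesis by simp
qed

lemma nfdet_shift: "nfdet k (shift k c x) = (1 + int p ^ k * c)^2 * nfdet k x"
  by (simp add: nfdet_def shift_def algebra_simps power2_eq_square power_mult)

lemma shift_comp: "shift k (e + c + int p ^ k * e * c) x = shift k e (shift k c x)"
  by (simp add: shift_def algebra_simps power2_eq_square)

lemma cong_nfdet:
  assumes "[fst x = fst y] (mod N)" "[snd x = snd y] (mod N)" shows "[nfdet k x = nfdet k y] (mod N)"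
  unfolding nfdet_def using assms by (intro cong_add cong_mult cong_refl)

lemma cong_shift:
  assumes "[c = c'] (mod N)" "[fst x = fst y] (mod N)" "[snd x = snd y] (mod N)"
  shows "[fst (shift k c x) = fst (shift k c' y)] (mod N)" "[snd (shift k c x) = snd (shift k c' y)] (mod N)"
  by (simp_all add: shift_def assms cong_add cong_mult cong_pow)

lemma red2_shift_cong: "[c = c'] (mod int p ^ m) \<Longrightarrow> red2 m (shift k c (red2 m x)) = red2 m (shift k c' x)"
  unfolding red2_eq_iff using cong_shift red2_cong by blast

lemma cong_p: "[a = b] (mod int p ^ m) \<Longrightarrow> m > 0 \<Longrightarrow> int p dvd 1 + int p ^ k * a \<longleftrightarrow> int p dvd 1 + int p ^ k * b"
  by (intro not_dvd_cong[of _ _ m] cong_add cong_mult cong_refl)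

text \<open>The operation \<open>e + c + p ^ k * e * c\<close> is the multiplication of the units
  \<open>1 + p ^ k * e\<close> and \<open>1 + p ^ k * c\<close> in their coordinates. Cancelling a
  unit makes the translations injective.\<close>

lemma orbit_count:
  assumes m: "m > 0"
  shows "card (Xs k m // Rk k m) * card (Ls k m) =
    card {(c, x) \<in> Ls k m \<times> Xs k m. red2 m (shift k c x) = x}"
proof (rule burnside[where op = "\<lambda>e c. (e + c + int p ^ k * e * c) mod int p ^ m"])
  let ?N = "int p ^ m"
  show "finite (Xs k m)" "finite (Ls k m)" by (simp_all add: finite_Xs) (auto simp: Ls_def intro: finite_subset[of _ "{0..<?N}"])
  show "equiv (Xs k m) (Rk k m)" by (rule equiv_Rk)
  fix x y assume xy: "x \<in> Xs k m" "y \<in> Xs k m"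
  have "(x, y) \<in> Rk k m \<longleftrightarrow> (y, x) \<in> Rk k m" using equiv_Rk by (meson equiv_def symD)
  also have "\<dots> \<longleftrightarrow> (\<exists>c. \<not> int p dvd 1 + int p ^ k * c \<and> red2 m (shift k c x) = y)"
    using xy nf_GZ sim_nf[OF refl m, of k y x] by (simp add: Rk_def simrel_def red2_Xs) (auto simp: Xs_def)
  also have "\<dots> \<longleftrightarrow> (\<exists>c\<in>Ls k m. red2 m (shift k c x) = y)"
  proof
    assume "\<exists>c. \<not> int p dvd 1 + int p ^ k * c \<and> red2 m (shift k c x) = y"
    then obtain c where c: "\<not> int p dvd 1 + int p ^ k * c" "red2 m (shift k c x) = y" by blast
    have cc: "[c mod ?N = c] (mod ?N)" by simp
    have "c mod ?N \<in> Ls k m" using c(1) cong_p[OF cc m] by (simp add: Ls_def)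
    moreover have "red2 m (shift k (c mod ?N) x) = y"
      using red2_shift_cong[OF cc, of k x] c(2) red2_Xs[OF xy(1)] by simp
    ultimately show "\<exists>c\<in>Ls k m. red2 m (shift k c x) = y" by blast
  qed (auto simp: Ls_def)
  finally show "(x, y) \<in> Rk k m \<longleftrightarrow> (\<exists>c\<in>Ls k m. red2 m (shift k c x) = y)" .
next
  let ?N = "int p ^ m"
  fix c x assume c: "c \<in> Ls k m" and x: "x \<in> Xs k m"
  have "\<not> int p dvd nfdet k (shift k c x)"
    using c x by (simp add: nfdet_shift power2_eq_square prime_dvd_mult_int Ls_def Xs_def)
  hence "\<not> int p dvd nfdet k (red2 m (shift k c x))"
    using not_dvd_cong[OF cong_nfdet[OF red2_cong] m] by blast
  thus "red2 m (shift k c x) \<in> Xs k m" by (simp add: Xs_def) (simp add: red2_def)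
  fix e assume e: "e \<in> Ls k m"
  show "red2 m (shift k ((e + c + int p ^ k * e * c) mod ?N) x) = red2 m (shift k e (red2 m (shift k c x)))"
    using red2_shift_cong[of "(e + c + int p ^ k * e * c) mod ?N" "e + c + int p ^ k * e * c" m k x]
      red2_shift_cong[of e e m k "shift k c x"] red2_Xs[OF x] by (simp add: shift_comp)
next
  let ?N = "int p ^ m"
  fix e c assume ec: "e \<in> Ls k m" "c \<in> Ls k m"
  have "1 + int p ^ k * (e + c + int p ^ k * e * c) = (1 + int p ^ k * e) * (1 + int p ^ k * c)"
    by (simp add: algebra_simps)
  hence "\<not> int p dvd 1 + int p ^ k * (e + c + int p ^ k * e * c)"
    using ec by (simp add: prime_dvd_mult_int Ls_def)
  thus "(e + c + int p ^ k * e * c) mod ?N \<in> Ls k m"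
    using cong_p[of "(e + c + int p ^ k * e * c) mod ?N" "e + c + int p ^ k * e * c" m k] m
    by (simp add: Ls_def)
next
  let ?N = "int p ^ m"
  fix c assume c: "c \<in> Ls k m"
  show "inj_on (\<lambda>e. (e + c + int p ^ k * e * c) mod ?N) (Ls k m)"
  proof (rule inj_onI)
    fix a b assume ab: "a \<in> Ls k m" "b \<in> Ls k m"
      "(a + c + int p ^ k * a * c) mod ?N = (b + c + int p ^ k * b * c) mod ?N"
    hence "?N dvd (a + c + int p ^ k * a * c) - (b + c + int p ^ k * b * c)" by (simp only: mod_eq_dvd_iff)
    also have "(a + c + int p ^ k * a * c) - (b + c + int p ^ k * b * c) = (1 + int p ^ k * c) * (a - b)"
      by (simp add: algebra_simps)
    finally have "?N dvd a - b"
      using c coprime_pow[of "1 + int p ^ k * c" m] by (simp add: Ls_def coprime_commute coprime_dvd_mult_right_iff)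
    hence "a mod ?N = b mod ?N" by (simp add: mod_eq_dvd_iff)
    thus "a = b" using ab by (simp add: Ls_def)
  qed
qed

end

section \<open>Fixed points of the substitutions, for odd \<open>p\<close> and for
  \<open>p = 2\<close>\<close>

lemma half_dvd_iff:
  fixes h c :: int
  assumes "0 \<le> c" "c < 2 * h" "0 < h"
  shows "h dvd c \<longleftrightarrow> c = 0 \<or> c = h" "h dvd c + 1 \<longleftrightarrow> c = h - 1 \<or> c = 2 * h - 1"
    "1 < h \<Longrightarrow> h dvd c + 2 \<longleftrightarrow> c = h - 2 \<or> c = 2 * h - 2"
proof -
  have small: "h dvd x \<longleftrightarrow> x = 0 \<or> x = h \<or> x = 2 * h" if "0 \<le> x" "x < 3 * h" for x
  proof
    assume "h dvd x"
    then obtain q where q: "x = h * q" by blast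
    hence "0 \<le> q" "q < 3" using that assms(3) by (auto simp: zero_le_mult_iff mult.commute)
    hence "q = 0 \<or> q = 1 \<or> q = 2" by auto
    thus "x = 0 \<or> x = h \<or> x = 2 * h" using q by auto
  qed auto
  show "h dvd c \<longleftrightarrow> c = 0 \<or> c = h" using small[of c] assms by auto
  show "h dvd c + 1 \<longleftrightarrow> c = h - 1 \<or> c = 2 * h - 1" using small[of "c + 1"] assms by auto
  show "1 < h \<Longrightarrow> h dvd c + 2 \<longleftrightarrow> c = h - 2 \<or> c = 2 * h - 2" using small[of "c + 2"] assms by auto
qed

lemma dvd_double_iff: "x = 2 * y \<Longrightarrow> 2 * h dvd x \<longleftrightarrow> h dvd (y :: int)"
  by simp

lemma card_parity: "card {t \<in> {0..<2 * h}. even t = b} = nat h" if "0 \<le> h" for h :: int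
proof -
  have "{t \<in> {0..<2 * h}. even t = b} = (\<lambda>x. 2 * x + (if b then 0 else 1)) ` {0..<h}"
  proof (intro equalityI subsetI)
    fix t assume "t \<in> {t \<in> {0..<2 * h}. even t = b}"
    thus "t \<in> (\<lambda>x. 2 * x + (if b then 0 else 1)) ` {0..<h}"
      by (intro image_eqI[of _ _ "t div 2"]) auto
  qed (auto split: if_splits)
  moreover have "inj_on (\<lambda>x. 2 * x + (if b then 0 else 1)) {0..<h}" by (simp add: inj_on_def)
  ultimately show ?thesis using card_image by fastforce
qed

lemma finite_parity: "finite {t \<in> {0..<h}. even t = b}" for h :: int
  by (rule finite_subset[of _ "{0..<h}"]) auto

context prime_tree
begin

lemma p_neq_0 [simp]: "p \<noteq> 0" using p_pos by simp

definition Nc :: "nat \<Rightarrow> nat \<Rightarrow> nat" where "Nc k m = card (Xs k m // Rk k m)"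

text \<open>The factor \<open>c\<close> splits off from the change of the trace and from that of the
  determinant. The cofactor \<open>2 + p ^ k * t\<close> of the first decides which nonzero
  \<open>c\<close> can fix a pair.\<close>

lemma fixed_iff:
  assumes "x \<in> Xs k m"
  shows "red2 m (shift k c x) = x \<longleftrightarrow> int p ^ m dvd c * (2 + int p ^ k * fst x) \<and>
    int p ^ m dvd c * (c + (1 + int p ^ k * c) * fst x + (2 * int p ^ k + int p ^ (2 * k) * c) * snd x)"
proof -
  have "red2 m (shift k c x) = x \<longleftrightarrow> red2 m (shift k c x) = red2 m x" using red2_Xs[OF assms] by simp
  also have "\<dots> \<longleftrightarrow> int p ^ m dvd fst (shift k c x) - fst x \<and> int p ^ m dvd snd (shift k c x) - snd x"
    by (simp add: red2_eq_iff cong_iff_dvd_diff)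
  also have "fst (shift k c x) - fst x = c * (2 + int p ^ k * fst x)"
    by (simp add: shift_def algebra_simps)
  also have "snd (shift k c x) - snd x =
      c * (c + (1 + int p ^ k * c) * fst x + (2 * int p ^ k + int p ^ (2 * k) * c) * snd x)"
    by (simp add: shift_def algebra_simps power2_eq_square power_mult)
  finally show ?thesis .
qed

lemma Ls_pos: "k > 0 \<Longrightarrow> Ls k m = {0..<int p ^ m}"
  using dvd_power_not by (auto simp: Ls_def)

lemma Xs_pos: "k > 0 \<Longrightarrow> Xs k m = {0..<int p ^ m} \<times> {0..<int p ^ m}"
proof -
  assume k: "k > 0"
  have "nfdet k x = 1 + int p ^ k * (fst x + int p ^ k * snd x)" for x
    by (simp add: nfdet_def algebra_simps power_mult power2_eq_square)
  hence "\<not> int p dvd nfdet k x" for x using dvd_power_not[OF k] by simp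
  thus ?thesis by (auto simp: Xs_def)
qed

lemma Nc_eq:
  assumes "m > 0" "k > 0"
    and "{(c, x) \<in> Ls k m \<times> Xs k m. red2 m (shift k c x) = x} = S" "card S = M * p ^ m"
  shows "Nc k m = M"
proof -
  have "card (Ls k m) = p ^ m" using assms(2) by (simp add: Ls_pos nat_power_eq)
  hence "Nc k m * p ^ m = M * p ^ m"
    using orbit_count[OF assms(1), of k] assms(3,4) by (simp add: Nc_def)
  thus ?thesis by simp
qed

lemma mem_fixed: "k > 0 \<Longrightarrow> (c, t, d) \<in> {(c, x) \<in> Ls k m \<times> Xs k m. red2 m (shift k c x) = x} \<longleftrightarrow>
    c \<in> {0..<int p ^ m} \<and> t \<in> {0..<int p ^ m} \<and> d \<in> {0..<int p ^ m} \<and>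
    int p ^ m dvd c * (2 + int p ^ k * t) \<and>
    int p ^ m dvd c * (c + (1 + int p ^ k * c) * t + (2 * int p ^ k + int p ^ (2 * k) * c) * d)"
  using fixed_iff[of "(t, d)" k m c] by (auto simp: Ls_pos Xs_pos)

text \<open>For odd \<open>p\<close> the cofactor \<open>2 + p ^ k * t\<close> is a unit, so only
  \<open>c = 0\<close> has fixed points: the operation is free on \<open>p ^ (2 * m)\<close>
  pairs.\<close>

lemma Nc_odd_pos:
  assumes "p \<noteq> 2" "k > 0" "m > 0"
  shows "Nc k m = p ^ m"
proof (rule Nc_eq[OF assms(3,2)])
  have "\<not> int p dvd 2 + int p ^ k * t" for t
  proof
    assume "int p dvd 2 + int p ^ k * t"
    moreover have "int p dvd int p ^ k * t" using assms(2) by (simp add: dvd_mult2 dvd_power)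
    ultimately have "int p dvd 2" by (simp add: dvd_add_left_iff)
    thus False using not_dvd_2[OF assms(1)] by blast
  qed
  hence "int p ^ m dvd c * (2 + int p ^ k * t) \<longleftrightarrow> int p ^ m dvd c" for c t
    using coprime_pow[of "2 + int p ^ k * t" m] by (simp add: coprime_commute coprime_dvd_mult_left_iff)
  moreover have "int p ^ m dvd c \<longleftrightarrow> c = 0" if "c \<in> {0..<int p ^ m}" for c
    using that zdvd_imp_le[of "int p ^ m" c] by fastforce
  ultimately show "{(c, x) \<in> Ls k m \<times> Xs k m. red2 m (shift k c x) = x} =
      {0 :: int} \<times> ({0..<int p ^ m} \<times> {0..<int p ^ m})"
    using mem_fixed[OF assms(2)] by (intro Set.set_eqI) (clarsimp, auto)
  show "card ({0 :: int} \<times> ({0..<int p ^ m} \<times> {0..<int p ^ m})) = p ^ m * p ^ m"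
    by (simp add: card_cartesian_product nat_power_eq)
qed

lemma two_part:
  assumes "p = 2" "m > 0"
  obtains h :: int where "int p ^ m = 2 * h" "h = 2 ^ (m - 1)" "0 < h" "nat h = 2 ^ (m - 1)" "p ^ m = 2 * nat h"
proof (rule that[of "2 ^ (m - 1)"])
  show "int p ^ m = 2 * 2 ^ (m - 1)" using assms by (cases m) auto
  show "p ^ m = 2 * nat (2 ^ (m - 1))" using assms by (cases m) (auto simp: nat_power_eq)
qed (simp_all add: nat_power_eq)

lemma odd_dvd_iff: "odd u \<Longrightarrow> (2 :: int) ^ j dvd u * x \<longleftrightarrow> 2 ^ j dvd x"
  by (simp add: coprime_dvd_mult_right_iff)

lemma odd_dvd_iff': "odd u \<Longrightarrow> (2 :: int) ^ j dvd x * u \<longleftrightarrow> 2 ^ j dvd x"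
  by (simp add: coprime_dvd_mult_left_iff)

text \<open>With \<open>h\<close> half the modulus, the cofactor is twice the odd number
  \<open>1 + 2 ^ (k - 1) * t\<close>. So \<open>c\<close> is 0 or \<open>h\<close>, and
  \<open>h\<close> fixes exactly the pairs whose \<open>t\<close> has the parity of
  \<open>h\<close>.\<close>

lemma Nc_two_ge2:
  assumes p2: "p = 2" and k: "k \<ge> 2" and m: "m > 0"
  shows "Nc k m = 2 ^ m + 2 ^ (m - 1)"
proof -
  obtain h where h: "int p ^ m = 2 * h" "h = 2 ^ (m - 1)" "0 < h" "nat h = 2 ^ (m - 1)" "p ^ m = 2 * nat h"
    using two_part[OF p2 m] by metis
  let ?I = "{0..<2 * h}"
  let ?S = "{0 :: int} \<times> (?I \<times> ?I) \<union> {h} \<times> ({t \<in> ?I. even t = even h} \<times> ?I)"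
  obtain j where j: "k = Suc (Suc j)" using k by (metis add_2_eq_Suc le_Suc_ex)
  have E1: "2 * h dvd c * (2 + int p ^ k * t) \<longleftrightarrow> h dvd c" for c t
  proof -
    have "2 * h dvd c * (2 + int p ^ k * t) \<longleftrightarrow> h dvd c * (1 + 2 * 2 ^ j * t)"
      by (rule dvd_double_iff) (simp add: p2 j algebra_simps)
    also have "\<dots> \<longleftrightarrow> h dvd c" unfolding h(2) by (rule odd_dvd_iff') simp
    finally show ?thesis .
  qed
  have E2: "2 * h dvd h * (h + (1 + int p ^ k * h) * t + (2 * int p ^ k + int p ^ (2 * k) * h) * d) \<longleftrightarrow>
      even t = even h" for t d
    using h(3) by (auto simp: p2 j mult.commute[of 2 h])
  have "Nc k m = 2 * nat h + nat h"
  proof (rule Nc_eq[OF m])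
    show "{(c, x) \<in> Ls k m \<times> Xs k m. red2 m (shift k c x) = x} = ?S"
    proof (intro Set.set_eqI)
      fix z :: "int \<times> int \<times> int" obtain c t d where z: "z = (c, t, d)" by (metis prod.collapse)
      show "z \<in> {(c, x) \<in> Ls k m \<times> Xs k m. red2 m (shift k c x) = x} \<longleftrightarrow> z \<in> ?S"
        unfolding z mem_fixed[OF less_le_trans[OF pos2 k]] h(1) E1
        using half_dvd_iff(1)[of c h] h(3) E2 by (cases "c = h") auto
    qed
    have "card ?S = card ({0 :: int} \<times> (?I \<times> ?I)) + card ({h} \<times> ({t \<in> ?I. even t = even h} \<times> ?I))"
      using h(3) by (intro card_Un_disjoint finite_cartesian_product finite_parity) auto
    also have "\<dots> = (2 * nat h) * (2 * nat h) + nat h * (2 * nat h)"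
      using card_parity[of h "even h"] h(3) by (simp add: card_cartesian_product nat_mult_distrib)
    finally show "card ?S = (2 * nat h + nat h) * p ^ m" unfolding h(5) by (simp add: algebra_simps)
  qed (use k in simp)
  thus ?thesis unfolding h(4) using m by (cases m) auto
qed

text \<open>Now \<open>1 + t\<close> may be even and odd \<open>c\<close> appear. The solutions
  \<open>2 * h - 1\<close> and \<open>h - 1\<close> stand for the units -1 and
  \<open>-1 + 2 ^ m\<close>; each fixes a single value of \<open>t\<close> and leaves
  \<open>d\<close> free, which accounts for the additional 2.\<close>

lemma Nc_two_1:
  assumes p2: "p = 2" and m: "m \<ge> 2"
  shows "Nc 1 m = 2 ^ m + 2 ^ (m - 1) + 2"
proof -
  have m0: "m > 0" using m by simp
  obtain h where h: "int p ^ m = 2 * h" "h = 2 ^ (m - 1)" "0 < h" "nat h = 2 ^ (m - 1)" "p ^ m = 2 * nat h"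
    using two_part[OF p2 m0] by metis
  have heven: "even h" using h(2) m by simp
  have N: "2 * h = 2 ^ m" using h(1) p2 by simp
  let ?I = "{0..<2 * h}"
  let ?S = "{0 :: int} \<times> (?I \<times> ?I) \<union> {h} \<times> ({t \<in> ?I. even t = True} \<times> ?I) \<union>
    ({2 * h - 1} \<times> ({2 * h - 1} \<times> ?I) \<union> {h - 1} \<times> ({h - 1} \<times> ?I))"
  let ?E1 = "\<lambda>c t :: int. 2 * h dvd c * (2 + 2 * t)"
  let ?E2 = "\<lambda>c t d :: int. 2 * h dvd c * (c + (1 + 2 * c) * t + (4 + 4 * c) * d)"
  have E1: "?E1 c t \<longleftrightarrow> h dvd c * (1 + t)" for c t
    by (rule dvd_double_iff) (simp add: algebra_simps)
  have iff: "?E1 c t \<and> ?E2 c t d \<longleftrightarrow> c = 0 \<or> c = h \<and> even t \<or> c = 2 * h - 1 \<and> t = 2 * h - 1 \<or> c = h - 1 \<and> t = h - 1"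
    if c: "0 \<le> c" "c < 2 * h" and t: "0 \<le> t" "t < 2 * h" for c t d
  proof (cases "even c")
    case ce: True
    show ?thesis
    proof (cases "even t")
      case te: True
      have "h dvd c * (1 + t) \<longleftrightarrow> h dvd c" unfolding h(2) by (rule odd_dvd_iff') (use te in simp)
      moreover have "?E2 h t d" using te heven by (simp add: mult.commute[of 2 h])
      ultimately show ?thesis unfolding E1 using half_dvd_iff(1)[OF c h(3)] te ce heven by auto
    next
      case te: False
      have "?E2 c t d \<longleftrightarrow> 2 * h dvd c" unfolding N by (rule odd_dvd_iff') (use te ce in simp)
      also have "\<dots> \<longleftrightarrow> c = 0" using c zdvd_imp_le[of "2 * h" c] by fastforce
      finally show ?thesis using te ce heven h(3) by auto
    qed
  next
    case co: False
    have 1: "?E1 c t \<longleftrightarrow> t = h - 1 \<or> t = 2 * h - 1"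
      unfolding E1 using odd_dvd_iff[OF co, of "m - 1" "1 + t"] half_dvd_iff(2)[OF t h(3)]
      by (simp add: h(2) add.commute)
    have 2: "?E2 c t d \<longleftrightarrow> 2 * h dvd c + (1 + 2 * c) * t + (4 + 4 * c) * d"
      unfolding N by (rule odd_dvd_iff[OF co])
    have 3: "?E2 c (2 * h - 1) d \<longleftrightarrow> c = 2 * h - 1" if "t = 2 * h - 1"
    proof -
      have "c + (1 + 2 * c) * (2 * h - 1) + (4 + 4 * c) * d = (4 * d - 1) * (c + 1) + 2 * h * (1 + 2 * c)"
        by (simp add: algebra_simps)
      hence "?E2 c (2 * h - 1) d \<longleftrightarrow> 2 * h dvd (4 * d - 1) * (c + 1)"
        using 2 that dvd_add_times_triv_right_iff by (metis dvd_add_left_iff dvd_triv_left)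
      also have "\<dots> \<longleftrightarrow> 2 * h dvd c + 1" unfolding N by (rule odd_dvd_iff) simp
      also have "\<dots> \<longleftrightarrow> c = 2 * h - 1" using c zdvd_imp_le[of "2 * h" "c + 1"] by fastforce
      finally show ?thesis .
    qed
    have 4: "?E2 c (h - 1) d \<longleftrightarrow> c = h - 1" if "t = h - 1"
    proof -
      have e: "c + (1 + 2 * c) * (h - 1) + (4 + 4 * c) * d = (4 * d - 1) * (c + 1) + h + 2 * h * c"
        by (simp add: algebra_simps)
      hence "?E2 c (h - 1) d \<longleftrightarrow> 2 * h dvd (4 * d - 1) * (c + 1) + h"
        using 2 that by (metis dvd_add_left_iff dvd_triv_left)
      also have "\<dots> \<longleftrightarrow> c = h - 1"
      proof
        assume a: "2 * h dvd (4 * d - 1) * (c + 1) + h"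
        hence "h dvd (4 * d - 1) * (c + 1) + h" by (rule dvd_mult_right)
        hence "h dvd (4 * d - 1) * (c + 1)" by simp
        hence "h dvd c + 1" unfolding h(2) by (subst (asm) odd_dvd_iff) simp_all
        hence "c = h - 1 \<or> c = 2 * h - 1" using half_dvd_iff(2)[OF c h(3)] by blast
        moreover have "c \<noteq> 2 * h - 1"
        proof
          assume "c = 2 * h - 1"
          hence "2 * h dvd 2 * h * (4 * d - 1) + h" using a by (simp add: algebra_simps)
          hence "2 * h dvd h" by (simp add: dvd_add_right_iff)
          thus False using h(3) zdvd_imp_le[of "2 * h" h] by simp
        qed
        ultimately show "c = h - 1" by blast
      next
        assume "c = h - 1"
        hence "(4 * d - 1) * (c + 1) + h = 2 * h * (2 * d)" by (simp add: algebra_simps)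
        thus "2 * h dvd (4 * d - 1) * (c + 1) + h" by simp
      qed
      finally show ?thesis .
    qed
    have "c \<noteq> 0" "c \<noteq> h" using co heven by auto
    thus ?thesis using 1 3 4 h(3) by (cases "t = 2 * h - 1"; cases "t = h - 1") auto
  qed
  have "Nc 1 m = 2 * nat h + nat h + 2"
  proof (rule Nc_eq[OF m0])
    show "{(c, x) \<in> Ls 1 m \<times> Xs 1 m. red2 m (shift 1 c x) = x} = ?S"
    proof (intro Set.set_eqI)
      fix z :: "int \<times> int \<times> int" obtain c t d where z: "z = (c, t, d)" by (metis prod.collapse)
      have "z \<in> {(c, x) \<in> Ls 1 m \<times> Xs 1 m. red2 m (shift 1 c x) = x} \<longleftrightarrow>
          c \<in> ?I \<and> t \<in> ?I \<and> d \<in> ?I \<and> ?E1 c t \<and> ?E2 c t d"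
        unfolding z mem_fixed[OF zero_less_one] h(1) by (simp add: p2)
      also have "\<dots> \<longleftrightarrow> z \<in> ?S" using iff[of c t d] h(3) by (auto simp: z)
      finally show "z \<in> {(c, x) \<in> Ls 1 m \<times> Xs 1 m. red2 m (shift 1 c x) = x} \<longleftrightarrow> z \<in> ?S" .
    qed
    have h1: "h > 1" using heven h(3) by (cases "h = 1") auto
    have "card ?S = (card ({0 :: int} \<times> (?I \<times> ?I)) + card ({h} \<times> ({t \<in> ?I. even t = True} \<times> ?I))) +
        (card ({2 * h - 1} \<times> ({2 * h - 1} \<times> ?I)) + card ({h - 1} \<times> ({h - 1} \<times> ?I)))"
    proof -
      have fin: "finite ({0 :: int} \<times> (?I \<times> ?I))" "finite ({h} \<times> ({t \<in> ?I. even t = True} \<times> ?I))"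
        "finite ({2 * h - 1} \<times> ({2 * h - 1} \<times> ?I))" "finite ({h - 1} \<times> ({h - 1} \<times> ?I))"
        by (intro finite_cartesian_product finite_parity finite.intros finite_atLeastLessThan_int)+
      have "({0 :: int} \<times> (?I \<times> ?I)) \<inter> ({h} \<times> ({t \<in> ?I. even t = True} \<times> ?I)) = {}"
        "({2 * h - 1} \<times> ({2 * h - 1} \<times> ?I)) \<inter> ({h - 1} \<times> ({h - 1} \<times> ?I)) = {}"
        "({0 :: int} \<times> (?I \<times> ?I) \<union> {h} \<times> ({t \<in> ?I. even t = True} \<times> ?I)) \<inter>
          ({2 * h - 1} \<times> ({2 * h - 1} \<times> ?I) \<union> {h - 1} \<times> ({h - 1} \<times> ?I)) = {}"
        using h1 heven by auto
      thus ?thesis using fin by (simp only: card_Un_disjoint finite_Un simp_thms)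
    qed
    also have "\<dots> = (2 * nat h) * (2 * nat h) + nat h * (2 * nat h) + (2 * nat h + 2 * nat h)"
      using card_parity[of h True] h(3) by (simp add: card_cartesian_product nat_mult_distrib)
    finally show "card ?S = (2 * nat h + nat h + 2) * p ^ m" unfolding h(5) by (simp add: algebra_simps)
  qed simp
  thus ?thesis unfolding h(4) using m0 by (cases m) auto
qed

text \<open>For \<open>k = 0\<close> the operation is that of the units \<open>1 + c\<close> on pairs of trace \<open>2 + t\<close> and determinant
  \<open>1 + t + d\<close>; a fixed pair is independent of the determinant.\<close>
lemma Nc_0:
  assumes m: "m > 0"
  shows "Nc 0 m = card {(c, t) \<in> {0..<int p ^ m} \<times> {0..<int p ^ m}.
    int p ^ m dvd c * (c + 2) \<and> int p ^ m dvd c * (t + 2)}" (is "_ = card ?P")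
proof -
  let ?N = "int p ^ m" and ?I = "{0..<int p ^ m}"
  let ?D = "\<lambda>t. {d \<in> ?I. \<not> int p dvd 1 + t + d}"
  have L: "Ls 0 m = ?D 0" by (auto simp: Ls_def)
  \<comment> \<open>Translation by \<open>t\<close> maps the admissible \<open>d\<close> onto
    \<open>Ls 0 m\<close>, so their number is that of the units and cancels against the order of the
    operating group.\<close>
  have D: "card (?D t) = card (Ls 0 m)" for t
  proof (rule bij_betw_same_card[OF bij_betw_byWitness[where f = "\<lambda>d. (d + t) mod ?N" and f' = "\<lambda>d. (d - t) mod ?N"]])
    have c: "[1 + (d + t) mod ?N = 1 + t + d] (mod ?N)" "[1 + t + (d - t) mod ?N = 1 + d] (mod ?N)" for d
    proof -
      have "[1 + (d + t) mod ?N = 1 + (d + t)] (mod ?N)" "[1 + t + (d - t) mod ?N = 1 + t + (d - t)] (mod ?N)"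
        by (intro cong_add cong_refl; simp)+
      thus "[1 + (d + t) mod ?N = 1 + t + d] (mod ?N)" "[1 + t + (d - t) mod ?N = 1 + d] (mod ?N)"
        by (simp_all add: algebra_simps)
    qed
    have "(d + t) mod ?N \<in> Ls 0 m" if "d \<in> ?D t" for d
      using that not_dvd_cong[OF c(1)[of d] m] by (simp add: Ls_def)
    thus "(\<lambda>d. (d + t) mod ?N) ` ?D t \<subseteq> Ls 0 m" by blast
    have "(d - t) mod ?N \<in> ?D t" if "d \<in> Ls 0 m" for d
      using that not_dvd_cong[OF c(2)[of d] m] by (simp add: Ls_def)
    thus "(\<lambda>d. (d - t) mod ?N) ` Ls 0 m \<subseteq> ?D t" by blast
    have w: "((d + t) mod ?N - t) mod ?N = d" "((d - t) mod ?N + t) mod ?N = d" if "d \<in> ?I" for d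
      using that by (simp_all add: mod_diff_left_eq mod_add_left_eq)
    show "\<forall>d\<in>?D t. ((d + t) mod ?N - t) mod ?N = d" "\<forall>d\<in>Ls 0 m. ((d - t) mod ?N + t) mod ?N = d"
      unfolding L using w by blast+
  qed
  have ne: "card (Ls 0 m) > 0"
  proof -
    have "0 \<in> Ls 0 m" by (simp add: Ls_def)
    moreover have "finite (Ls 0 m)" unfolding L by (rule finite_subset[of _ ?I]) auto
    ultimately show ?thesis using card_gt_0_iff by blast
  qed
  have mem: "(c, t, d) \<in> {(c, x) \<in> Ls 0 m \<times> Xs 0 m. red2 m (shift 0 c x) = x} \<longleftrightarrow> (c, t) \<in> ?P \<and> d \<in> ?D t" for c t d
  proof -
    have "?N dvd c * (c + (1 + c) * t + (2 + c) * d) \<longleftrightarrow> ?N dvd c * (c + 2)"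
      if "?N dvd c * (t + 2)" "\<not> int p dvd 1 + t + d"
    proof -
      \<comment> \<open>Modulo the trace condition, the determinant condition becomes
        \<open>(1 + c) ^ 2 - 1\<close> times the determinant \<open>1 + t + d\<close>, and the
        latter is a unit.\<close>
      have "c * (c + (1 + c) * t + (2 + c) * d) = (c * (c + 2)) * (1 + t + d) - c * (t + 2)"
        by (simp add: algebra_simps)
      hence "?N dvd c * (c + (1 + c) * t + (2 + c) * d) \<longleftrightarrow> ?N dvd (c * (c + 2)) * (1 + t + d)"
        using that(1) by (simp only: dvd_diff_left_iff)
      thus ?thesis using coprime_pow[OF that(2), of m] by (simp add: coprime_commute coprime_dvd_mult_left_iff)
    qed
    moreover have "\<not> int p dvd 1 + c" if "?N dvd c * (c + 2)"
    proof
      assume "int p dvd 1 + c"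
      hence "int p dvd (1 + c) * (1 + c)" by simp
      moreover have "int p dvd c * (c + 2)" using that m by (meson dvd_power dvd_trans)
      ultimately have "int p dvd (1 + c) * (1 + c) - c * (c + 2)" by (rule dvd_diff)
      also have "(1 + c) * (1 + c) - c * (c + 2) = 1" by (simp add: algebra_simps)
      finally show False by simp
    qed
    ultimately show ?thesis
      using fixed_iff[of "(t, d)" 0 m c] by (auto simp: Ls_def Xs_def nfdet_def add.commute[of 2 t])
  qed
  have "card {(c, x) \<in> Ls 0 m \<times> Xs 0 m. red2 m (shift 0 c x) = x} = card (SIGMA z:?P. ?D (snd z))"
  proof (rule bij_betw_same_card[OF bij_betw_byWitness[where f = "\<lambda>(c, t, d). ((c, t), d)" and f' = "\<lambda>((c, t), d). (c, t, d)"]])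
    show "(\<lambda>(c, t, d). ((c, t), d)) ` {(c, x) \<in> Ls 0 m \<times> Xs 0 m. red2 m (shift 0 c x) = x} \<subseteq> (SIGMA z:?P. ?D (snd z))"
      using mem by fastforce
    show "(\<lambda>((c, t), d). (c, t, d)) ` (SIGMA z:?P. ?D (snd z)) \<subseteq> {(c, x) \<in> Ls 0 m \<times> Xs 0 m. red2 m (shift 0 c x) = x}"
      using mem by fastforce
  qed auto
  also have "\<dots> = (\<Sum>z\<in>?P. card (?D (snd z)))"
  proof (intro card_SigmaI ballI)
    show "finite ?P" by (rule finite_subset[of _ "?I \<times> ?I"]) auto
    show "finite (?D (snd z))" for z by (rule finite_subset[of _ ?I]) auto
  qed
  also have "\<dots> = card ?P * card (Ls 0 m)" using D by simp
  finally have "Nc 0 m * card (Ls 0 m) = card ?P * card (Ls 0 m)"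
    using orbit_count[OF m, of 0] by (simp add: Nc_def)
  thus ?thesis using ne by simp
qed

text \<open>Modulo an odd prime power the only units with square 1 are 1 and -1, that is,
  \<open>c = 0\<close> and \<open>c = -2\<close>. The first fixes all \<open>t\<close>, the second
  only \<open>t = -2\<close>, which is trace 0.\<close>

lemma Nc_odd_0:
  assumes "p \<noteq> 2" "m > 0"
  shows "Nc 0 m = p ^ m + 1"
proof -
  let ?N = "int p ^ m" and ?I = "{0..<int p ^ m}"
  have p3: "p > 2" using assms(1) prime_ge_2_nat[OF prime_p] by simp
  have "int p ^ 1 \<le> int p ^ m" using assms(2) p_gt_1 by (intro power_increasing) auto
  hence "int p \<le> ?N" by (simp only: power_one_right)
  moreover have "2 < int p" using p3 by simp
  ultimately have N3: "?N > 2" by (rule less_le_trans[rotated])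
  have n2: "\<not> int p dvd 2" by (rule not_dvd_2[OF assms(1)])
  have lt: "?N dvd c \<longleftrightarrow> c = 0" "?N dvd c + 2 \<longleftrightarrow> c = ?N - 2" if "c \<in> ?I" for c
  proof -
    show "?N dvd c \<longleftrightarrow> c = 0" using that zdvd_imp_le[of ?N c] by fastforce
    have "c + 2 = ?N" if "?N dvd c + 2"
    proof -
      have "?N dvd c + 2 - ?N" using that by simp
      thus ?thesis using zdvd_imp_le[of ?N "c + 2 - ?N"] zdvd_imp_le[of ?N "?N - (c + 2)"] \<open>c \<in> ?I\<close> N3 that
        by (smt (verit) atLeastLessThan_iff zdvd_imp_le)
    qed
    thus "?N dvd c + 2 \<longleftrightarrow> c = ?N - 2" by auto
  qed
  have cc: "?N dvd c * (c + 2) \<longleftrightarrow> ?N dvd c \<or> ?N dvd c + 2" for c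
  proof
    assume a: "?N dvd c * (c + 2)"
    show "?N dvd c \<or> ?N dvd c + 2"
    proof (cases "int p dvd c")
      case True
      hence "\<not> int p dvd c + 2" using n2 by (simp add: dvd_add_right_iff)
      thus ?thesis using a coprime_pow[of "c + 2" m] by (simp add: coprime_commute coprime_dvd_mult_left_iff)
    next
      case False
      thus ?thesis using a coprime_pow[of c m] by (simp add: coprime_commute coprime_dvd_mult_right_iff)
    qed
  qed auto
  have tt: "?N dvd (?N - 2) * (t + 2) \<longleftrightarrow> ?N dvd t + 2" for t
  proof -
    have "\<not> int p dvd ?N - 2" using n2 assms(2) by (simp add: dvd_diff_right_iff dvd_power)
    thus ?thesis using coprime_pow[of "?N - 2" m] by (simp add: coprime_commute coprime_dvd_mult_right_iff)
  qed
  have "{(c, t) \<in> ?I \<times> ?I. ?N dvd c * (c + 2) \<and> ?N dvd c * (t + 2)} = {0 :: int} \<times> ?I \<union> {(?N - 2, ?N - 2)}"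
    (is "?L = ?R")
  proof (intro Set.set_eqI)
    fix z :: "int \<times> int" obtain c t where z: "z = (c, t)" by (metis prod.collapse)
    show "z \<in> ?L \<longleftrightarrow> z \<in> ?R" 
    proof (cases "c \<in> ?I \<and> t \<in> ?I")
      case True
      have "z \<in> ?L \<longleftrightarrow> (c = 0 \<or> c = ?N - 2) \<and> ?N dvd c * (t + 2)"
        unfolding z using True cc[of c] lt[of c] by auto
      also have "\<dots> \<longleftrightarrow> c = 0 \<or> c = ?N - 2 \<and> t = ?N - 2"
        using True tt[of t] lt(2)[of t] by auto
      also have "\<dots> \<longleftrightarrow> z \<in> ?R" unfolding z using True by auto
      finally show ?thesis .
    next
      case False
      thus ?thesis unfolding z using N3 by auto
    qed
  qed
  moreover have "card ?R = p ^ m + 1" using N3 by (subst card_Un_disjoint) (auto simp: card_cartesian_product nat_power_eq)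
  ultimately show ?thesis using Nc_0[OF assms(2)] by simp
qed

text \<open>Modulo \<open>2 ^ m\<close> with \<open>m \<ge> 3\<close> there are four square roots of
  1, giving \<open>c = 0\<close>, \<open>h\<close>, \<open>h - 2\<close> and
  \<open>2 * h - 2\<close>. The root for \<open>h\<close> fixes the even \<open>t\<close>; each of
  the last two fixes the two \<open>t\<close> congruent to -2 modulo \<open>h\<close>, hence the
  4.\<close>

lemma Nc_two_0:
  assumes p2: "p = 2" and m: "m \<ge> 3"
  shows "Nc 0 m = 2 ^ m + 2 ^ (m - 1) + 4"
proof -
  have m0: "m > 0" using m by simp
  obtain h where h: "int p ^ m = 2 * h" "h = 2 ^ (m - 1)" "0 < h" "nat h = 2 ^ (m - 1)" "p ^ m = 2 * nat h"
    using two_part[OF p2 m0] by metis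
  obtain j where j: "m = Suc (Suc (Suc j))" using m by (metis Suc_le_D numeral_3_eq_3 Suc_le_mono)
  have h4: "h = 4 * 2 ^ j" "h \<ge> 4" using h(2) by (simp_all add: j)
  let ?I = "{0..<2 * h}"
  let ?A = "{h - 2, 2 * h - 2}"
  have cc: "2 * h dvd c * (c + 2) \<longleftrightarrow> h dvd c \<or> h dvd c + 2" for c
  proof (cases "even c")
    case True
    then obtain e where e: "c = 2 * e" by blast
    have "2 * h dvd c * (c + 2) \<longleftrightarrow> 2 * 2 ^ j dvd e * (e + 1)"
    proof -
      have "c * (c + 2) = 4 * (e * (e + 1))" "2 * h = 4 * (2 * 2 ^ j)" by (simp_all add: e h4(1) algebra_simps)
      thus ?thesis by (simp only: dvd_mult_cancel_left) simp
    qed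
    also have "\<dots> \<longleftrightarrow> 2 * 2 ^ j dvd e \<or> 2 * 2 ^ j dvd e + 1"
    proof (cases "even e")
      case True
      thus ?thesis using odd_dvd_iff'[of "e + 1" "Suc j" e] by (auto dest: dvd_mult_left)
    next
      case False
      thus ?thesis using odd_dvd_iff[of e "Suc j" "e + 1"] by (auto dest: dvd_mult_left)
    qed
    also have "\<dots> \<longleftrightarrow> h dvd c \<or> h dvd c + 2"
    proof -
      have "h = 2 * (2 * 2 ^ j)" "c + 2 = 2 * (e + 1)" by (simp_all add: h4(1) e)
      thus ?thesis unfolding e by (simp only: dvd_mult_cancel_left) simp
    qed
    finally show ?thesis .
  next
    case False
    hence "\<not> even (c * (c + 2))" by simp
    hence "\<not> 2 * h dvd c * (c + 2)" using dvd_mult_left by blast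
    moreover have "\<not> h dvd c" "\<not> h dvd c + 2" using False h4(1)
      by (metis dvd_trans dvd_triv_left even_add even_mult_iff even_numeral)+
    ultimately show ?thesis by blast
  qed
  have t1: "2 * h dvd h * (t + 2) \<longleftrightarrow> even t" for t using h(3) by (simp add: mult.commute[of 2 h])
  have t2: "2 * h dvd (2 * h - 2) * (t + 2) \<longleftrightarrow> h dvd t + 2" for t
  proof -
    have "2 * h dvd (2 * h - 2) * (t + 2) \<longleftrightarrow> h dvd (h - 1) * (t + 2)"
      by (rule dvd_double_iff) (simp add: algebra_simps)
    also have "\<dots> \<longleftrightarrow> h dvd t + 2" unfolding h(2) by (rule odd_dvd_iff) (simp add: j)
    finally show ?thesis .
  qed
  have t3: "2 * h dvd (h - 2) * (t + 2) \<longleftrightarrow> h dvd t + 2" for t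
  proof -
    have "2 * h dvd (h - 2) * (t + 2) \<longleftrightarrow> h dvd (2 * 2 ^ j - 1) * (t + 2)"
      by (rule dvd_double_iff) (simp add: h4(1) algebra_simps)
    also have "\<dots> \<longleftrightarrow> h dvd t + 2" unfolding h(2) by (rule odd_dvd_iff) simp
    finally show ?thesis .
  qed
  have "{(c, t) \<in> ?I \<times> ?I. 2 * h dvd c * (c + 2) \<and> 2 * h dvd c * (t + 2)} =
      {0 :: int} \<times> ?I \<union> {h} \<times> {t \<in> ?I. even t = True} \<union> ?A \<times> ?A" (is "?L = ?R")
  proof (intro Set.set_eqI)
    fix z :: "int \<times> int" obtain c t where z: "z = (c, t)" by (metis prod.collapse)
    have H: "h dvd c \<longleftrightarrow> c = 0 \<or> c = h" "h dvd c + 2 \<longleftrightarrow> c = h - 2 \<or> c = 2 * h - 2" if "c \<in> ?I" for c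
      using half_dvd_iff(1,3)[of c h] that h4(2) by auto
    show "z \<in> ?L \<longleftrightarrow> z \<in> ?R"
    proof (cases "c \<in> ?I \<and> t \<in> ?I")
      case True
      have "z \<in> ?L \<longleftrightarrow> (c = 0 \<or> c = h \<or> c = h - 2 \<or> c = 2 * h - 2) \<and> 2 * h dvd c * (t + 2)"
        unfolding z using True cc[of c] H[of c] by auto
      also have "\<dots> \<longleftrightarrow> c = 0 \<or> c = h \<and> even t \<or> (c = h - 2 \<or> c = 2 * h - 2) \<and> h dvd t + 2"
        using t1[of t] t2[of t] t3[of t] by auto
      also have "\<dots> \<longleftrightarrow> z \<in> ?R" unfolding z using True H(2)[of t] by auto
      finally show ?thesis .
    next
      case False
      thus ?thesis unfolding z using h4(2) by auto
    qed
  qed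
  moreover have "card ?R = card ({0 :: int} \<times> ?I) + card ({h} \<times> {t \<in> ?I. even t = True}) + card (?A \<times> ?A)"
  proof -
    have fin: "finite ({0 :: int} \<times> ?I)" "finite ({h} \<times> {t \<in> ?I. even t = True})" "finite (?A \<times> ?A)"
      by (intro finite_cartesian_product finite_parity finite.intros finite_atLeastLessThan_int)+
    have "({0 :: int} \<times> ?I) \<inter> ({h} \<times> {t \<in> ?I. even t = True}) = {}"
      "({0 :: int} \<times> ?I \<union> {h} \<times> {t \<in> ?I. even t = True}) \<inter> (?A \<times> ?A) = {}"
      using h4(2) by auto
    thus ?thesis using fin by (simp only: card_Un_disjoint finite_Un simp_thms)
  qed
  moreover have "\<dots> = 2 * nat h + nat h + 4"
    using card_parity[of h True] h4(2) by (simp add: card_cartesian_product nat_mult_distrib)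
  ultimately have "Nc 0 m = 2 * nat h + nat h + 4" using Nc_0[OF m0] unfolding h(1) by simp
  thus ?thesis unfolding h(4) using m0 by (cases m) auto
qed

text \<open>Indexing by \<open>m = n - k\<close> makes the summands with \<open>k \<ge> 2\<close>
  independent of \<open>n\<close>; \<open>k = 0\<close> and \<open>k = 1\<close> are split off
  because 2 behaves differently there. The constant is \<open>p\<close> for odd \<open>p\<close> and
  3 for \<open>p = 2\<close>. From \<open>n = 3\<close> on, the values for \<open>m = n\<close> and
  \<open>m = n - 1\<close> are both available.\<close>

lemma level_count_step:
  "\<exists>\<kappa>. \<forall>n\<ge>3. class_number (Suc n) =
     class_number n + \<kappa> * p ^ n"
proof -
  have lc: "class_number n =
      1 + Nc 0 n + Nc 1 (n - 1) + (\<Sum>m=1..<n - 1. Nc (n - m) m)" if "n \<ge> 3" for n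
  proof -
    have j': "n = Suc (Suc (n - 2))" using that by simp
    then obtain j where j: "n = Suc (Suc j)" by blast
    have "(\<Sum>k<n. Nc k (n - k)) = Nc 0 n + (Nc 1 (n - 1) + (\<Sum>k<j. Nc (Suc (Suc k)) (n - Suc (Suc k))))"
      by (simp add: j sum.lessThan_Suc_shift del: sum.lessThan_Suc)
    also have "(\<Sum>k<j. Nc (Suc (Suc k)) (n - Suc (Suc k))) = (\<Sum>m=1..<n - 1. Nc (n - m) m)"
      by (rule sum.reindex_bij_witness[of _ "\<lambda>m. n - m - 2" "\<lambda>k. n - Suc (Suc k)"]) (auto simp: j)
    finally show ?thesis by (simp add: level_count_sum Nc_def)
  qed
  show ?thesis
  proof (cases "p = 2")
    case True
    have "class_number n =
        1 + (2 ^ n + 2 ^ (n - 1) + 4) + (2 ^ (n - 1) + 2 ^ (n - 1 - 1) + 2) + (\<Sum>m=1..<n - 1. 2 ^ m + 2 ^ (m - 1))"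
      if "n \<ge> 3" for n
    proof -
      have "(\<Sum>m=1..<n - 1. Nc (n - m) m) = (\<Sum>m=1..<n - 1. 2 ^ m + 2 ^ (m - 1))"
        by (intro sum.cong refl Nc_two_ge2[OF True]) auto
      thus ?thesis using lc[OF that] Nc_two_0[OF True that] Nc_two_1[OF True, of "n - 1"] that by simp
    qed
    note f = this
    have "class_number (Suc n) =
      class_number n + 3 * p ^ n" if "n \<ge> 3" for n
    proof -
      have "n = Suc (Suc (Suc (n - 3)))" using that by simp
      then obtain j where j: "n = Suc (Suc (Suc j))" by blast
      show ?thesis using f[of n] f[of "Suc n"] by (simp add: j True)
    qed
    thus ?thesis by blast
  next
    case False
    have f: "class_number n =
        1 + (p ^ n + 1) + p ^ (n - 1) + (\<Sum>m=1..<n - 1. p ^ m)" if "n \<ge> 3" for n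
    proof -
      have "(\<Sum>m=1..<n - 1. Nc (n - m) m) = (\<Sum>m=1..<n - 1. p ^ m)"
        by (intro sum.cong refl Nc_odd_pos[OF False]) auto
      thus ?thesis using lc[OF that] Nc_odd_0[OF False, of n] Nc_odd_pos[OF False, of 1 "n - 1"] that by simp
    qed
    have "class_number (Suc n) =
      class_number n + p * p ^ n" if "n \<ge> 3" for n
    proof -
      have "n = Suc (Suc (Suc (n - 3)))" using that by simp
      then obtain j where j: "n = Suc (Suc (Suc j))" by blast
      show ?thesis using f[of n] f[of "Suc n"] by (simp add: j)
    qed
    thus ?thesis by blast
  qed
qed

lemma Q_rational_zeta: "Q_rational (zeta_series (lattice_tree p) (PGL2_Iso p) (PGL2_Iso p))"
proof -
  define c where "c n = (of_nat (class_number n) :: rat)" for n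
  obtain \<kappa> where \<kappa>: "\<And>n. n \<ge> 3 \<Longrightarrow> c (Suc n) = c n + of_nat \<kappa> * of_nat p ^ n"
  proof -
    obtain \<kappa> where "\<forall>n\<ge>3. class_number (Suc n) =
        class_number n + \<kappa> * p ^ n"
      using level_count_step by blast
    thus thesis using that[of \<kappa>] by (simp add: c_def)
  qed
  let ?f = "Abs_fps c"
  \<comment> \<open>This is \<open>(1 - t) * (1 - p * t)\<close>, which annihilates constants and
    multiples of \<open>p ^ n\<close>. The recurrence starts at index 3 and the degree is 2, so the
    coefficients of the product vanish from 5 on.\<close>
  let ?Q = "[:1, - (1 + of_nat p), of_nat p:] :: rat poly"
  have z: "fps_nth (?f * fps_of_poly ?Q) n = 0" if "n \<ge> 5" for n
  proof -
    have "n = Suc (Suc (n - 2))" "n - 2 \<ge> 3" using that by simp_all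
    then obtain j where j: "n = Suc (Suc j)" "j \<ge> 3" by blast
    have "?f * fps_of_poly ?Q = ?f - fps_const (1 + of_nat p) * (?f * fps_X) + fps_const (of_nat p) * (?f * fps_X ^ 2)"
      by (simp add: fps_of_poly_pCons algebra_simps power2_eq_square flip: fps_const_add fps_const_sub fps_const_neg)
    hence "fps_nth (?f * fps_of_poly ?Q) n = c (Suc (Suc j)) - (1 + of_nat p) * c (Suc j) + of_nat p * c j"
      by (simp add: j fps_X_power_mult_right_nth)
    also have "\<dots> = 0" using \<kappa>[of j] \<kappa>[of "Suc j"] j(2) by (simp add: algebra_simps)
    finally show ?thesis .
  qed
  let ?P = "Poly (map (fps_nth (?f * fps_of_poly ?Q)) [0..<5])"
  have "?f * fps_of_poly ?Q = fps_of_poly ?P"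
  proof (rule fps_ext)
    fix n show "fps_nth (?f * fps_of_poly ?Q) n = fps_nth (fps_of_poly ?P) n"
      using z[of n] by (cases "n < 5") (auto simp: nth_default_def)
  qed
  moreover have "?Q \<noteq> 0" by simp
  ultimately show ?thesis unfolding Q_rational_def zeta_series_def c_def[symmetric] by blast
qed

end

section \<open>Powers in the torus of a companion matrix\<close>

text \<open>Membership of \<open>P\<close> in the ring generated by the companion matrix; the coordinates are \<open>m11\<close> and \<open>m21\<close>.\<close>
definition tor :: "int \<Rightarrow> int \<Rightarrow> imat \<Rightarrow> bool" where
  "tor \<tau> \<delta> P \<longleftrightarrow> m12 P = - \<delta> * m21 P \<and> m22 P = m11 P + \<tau> * m21 P"

lemma tor_closed: "tor \<tau> \<delta> P \<Longrightarrow> tor \<tau> \<delta> Q \<Longrightarrow> tor \<tau> \<delta> (P * Q)" "tor \<tau> \<delta> 1" "tor \<tau> \<delta> P \<Longrightarrow> tor \<tau> \<delta> (madj P)"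
  by (auto simp: tor_def algebra_simps)

lemma tor_power: "tor \<tau> \<delta> P \<Longrightarrow> tor \<tau> \<delta> (P ^ l)"
  by (induction l) (auto simp: tor_closed)

lemma tor_commute: "tor \<tau> \<delta> P \<Longrightarrow> tor \<tau> \<delta> Q \<Longrightarrow> P * Q = Q * P"
  by (intro imat_eqI) (simp_all add: tor_def algebra_simps)

lemma tor_power_mult: "tor \<tau> \<delta> P \<Longrightarrow> tor \<tau> \<delta> Q \<Longrightarrow> (P * Q) ^ l = P ^ l * Q ^ l"
proof (induction l)
  case (Suc l)
  have "P * Q * (P ^ l * Q ^ l) = P * (Q * P ^ l) * Q ^ l" by (simp add: mult.assoc)
  also have "Q * P ^ l = P ^ l * Q" using Suc.prems tor_power tor_commute by blast
  finally show ?case using Suc by (simp add: mult.assoc)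
qed simp

lemma tor_scal: "tor \<tau> \<delta> P \<Longrightarrow> scalar_mod N P \<longleftrightarrow> N dvd m21 P"
  by (auto simp: tor_def scalar_mod_def)

lemma madj_power: "madj (P ^ l) = madj P ^ l"
proof (induction l)
  case 0 show ?case by (intro imat_eqI) simp_all
next
  case (Suc l)
  have "madj (P * P ^ l) = madj (P ^ l) * madj P" by (intro imat_eqI) (simp_all add: algebra_simps)
  thus ?case using Suc by (simp add: power_commutes)
qed

text \<open>The binomial expansion of \<open>(x + y C) ^ l\<close> up to first order in
  \<open>y\<close>. For \<open>l = 0\<close> the truncated exponent \<open>l - 1\<close> is harmless
  since its coefficient is 0.\<close>

lemma tor_power_expand:
  assumes "tor \<tau> \<delta> P"
  shows "\<exists>K L. m21 (P ^ l) = int l * m11 P ^ (l - 1) * m21 P + (m21 P)^2 * K \<and> m11 (P ^ l) = m11 P ^ l + m21 P * L"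
proof (induction l)
  case 0
  show ?case by (intro exI[of _ 0]) simp
next
  case (Suc l)
  let ?x = "m11 P" and ?y = "m21 P"
  obtain K L where IH: "m21 (P ^ l) = int l * ?x ^ (l - 1) * ?y + ?y^2 * K" "m11 (P ^ l) = ?x ^ l + ?y * L"
    using Suc by blast
  have x: "int l * ?x ^ (l - 1) * ?x = int l * ?x ^ l" by (cases l) auto
  have "m21 (P ^ Suc l) = ?y * m11 (P ^ l) + (?x + \<tau> * ?y) * m21 (P ^ l)"
    using assms by (simp add: tor_def)
  also have "\<dots> = (int l * ?x ^ (l - 1) * ?x) * ?y + ?x ^ l * ?y + ?y^2 * (L + ?x * K + \<tau> * (int l * ?x ^ (l - 1) + ?y * K))"
    unfolding IH by (simp add: algebra_simps power2_eq_square)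
  also have "\<dots> = int (Suc l) * ?x ^ (Suc l - 1) * ?y + ?y^2 * (L + ?x * K + \<tau> * (int l * ?x ^ (l - 1) + ?y * K))"
    unfolding x by (simp add: algebra_simps)
  finally have 1: "m21 (P ^ Suc l) = \<dots>" .
  have "m11 (P ^ Suc l) = ?x ^ Suc l + ?y * (?x * L - \<delta> * m21 (P ^ l))"
    using assms by (simp add: tor_def IH(2) algebra_simps)
  thus ?case using 1 by blast
qed

text \<open>The \<open>C\<close>-coordinate of \<open>madj P * Q\<close>, which vanishes when \<open>P\<close> and \<open>Q\<close> are proportional.\<close>
definition cross :: "imat \<Rightarrow> imat \<Rightarrow> int" where "cross P Q = m11 P * m21 Q - m11 Q * m21 P"

lemma cross_eq: "tor \<tau> \<delta> P \<Longrightarrow> tor \<tau> \<delta> Q \<Longrightarrow> m21 (madj P * Q) = cross P Q"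
  by (simp add: tor_def cross_def algebra_simps)

context prime_tree
begin

definition has_val :: "nat \<Rightarrow> int \<Rightarrow> bool" where
  "has_val j y \<longleftrightarrow> int p ^ j dvd y \<and> \<not> int p ^ Suc j dvd y"

lemma has_val_cong: "has_val j x \<Longrightarrow> [x = y] (mod int p ^ n) \<Longrightarrow> j < n \<Longrightarrow> has_val j y"
proof -
  assume a: "has_val j x" "[x = y] (mod int p ^ n)" "j < n"
  have "[x = y] (mod int p ^ j)" "[x = y] (mod int p ^ Suc j)"
    using a(3) cong_dvd_modulus[OF a(2)] by (simp_all only: le_imp_power_dvd Suc_leI less_imp_le)
  thus "has_val j y" using a(1) cong_dvd_iff unfolding has_val_def by blast
qed

lemma has_val_add: "has_val j x \<Longrightarrow> int p ^ Suc j dvd y \<Longrightarrow> has_val j (x + y)"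
proof -
  assume a: "has_val j x" "int p ^ Suc j dvd y"
  have "int p ^ j dvd y" using a(2) by (rule dvd_trans[rotated]) simp
  thus "has_val j (x + y)" using a unfolding has_val_def by (simp add: dvd_add_left_iff del: power_Suc)
qed

lemma has_val_mult_unit: "\<not> int p dvd u \<Longrightarrow> has_val j (u * x) \<longleftrightarrow> has_val j x"
  using coprime_pow[of u j] coprime_pow[of u "Suc j"] unfolding has_val_def
  by (metis coprime_commute coprime_dvd_mult_right_iff)

lemma has_val_mult_p: "has_val j x \<Longrightarrow> has_val (Suc j) (int p * x)"
  by (simp add: has_val_def)

lemma has_val_exists:
  assumes "\<not> int p ^ n dvd x" obtains j where "has_val j x" "j < n"
proof -
  define k where "k = (LEAST k. \<not> int p ^ k dvd x)"
  have k: "\<not> int p ^ k dvd x" unfolding k_def using assms by (rule LeastI)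
  have le: "k \<le> n" unfolding k_def using assms by (rule Least_le)
  have "k \<noteq> 0" using k by (intro notI) simp
  then obtain j where j: "k = Suc j" by (cases k) auto
  have "int p ^ j dvd x" using not_less_Least[of j "\<lambda>k. \<not> int p ^ k dvd x"] j by (simp add: k_def[symmetric])
  thus thesis using that[of j] k j le by (simp add: has_val_def)
qed

lemma tor_unit:
  assumes "tor \<tau> \<delta> P" "\<not> int p dvd mdet P" "int p dvd m21 P" shows "\<not> int p dvd m11 P"
proof
  assume "int p dvd m11 P"
  hence "int p dvd m11 P * m22 P - m12 P * m21 P" using assms(3) by simp
  thus False using assms(2) by (simp add: mdet_def)
qed

lemma unit_power: "\<not> int p dvd x \<Longrightarrow> \<not> int p dvd x ^ l"
  using prime_int_p prime_dvd_power by blast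

lemma has_val_power_unit:
  assumes P: "tor \<tau> \<delta> P" and y: "has_val j (m21 P)" "j \<ge> 1" and x: "\<not> int p dvd m11 P" and l: "\<not> int p dvd int l"
  shows "has_val j (m21 (P ^ l))"
proof -
  obtain K where K: "m21 (P ^ l) = int l * m11 P ^ (l - 1) * m21 P + (m21 P)^2 * K"
    using tor_power_expand[OF P, of l] by blast
  have "int p ^ (j + j) dvd m21 P ^ 2" using y by (simp add: has_val_def power_add power2_eq_square mult_dvd_mono)
  moreover have "int p ^ Suc j dvd int p ^ (j + j)" using y(2) by (intro le_imp_power_dvd) simp
  ultimately have "int p ^ Suc j dvd (m21 P)^2 * K" using dvd_mult2 dvd_trans by blast
  moreover have "\<not> int p dvd int l * m11 P ^ (l - 1)" using l unit_power[OF x] by (simp add: prime_dvd_mult_int)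
  ultimately show ?thesis unfolding K using has_val_add has_val_mult_unit y(1) by blast
qed

text \<open>The linear term has valuation \<open>j + 1\<close> and the remainder at least
  \<open>2 * j\<close>. For \<open>j = 1\<close> the two could have the same valuation, hence
  \<open>j \<ge> 2\<close>.\<close>

lemma has_val_power_p:
  assumes P: "tor \<tau> \<delta> P" and y: "has_val j (m21 P)" "j \<ge> 2" and x: "\<not> int p dvd m11 P"
  shows "has_val (Suc j) (m21 (P ^ p))"
proof -
  obtain K where K: "m21 (P ^ p) = int p * m11 P ^ (p - 1) * m21 P + (m21 P)^2 * K"
    using tor_power_expand[OF P, of p] by blast
  have 1: "int p ^ (j + j) dvd m21 P ^ 2" using y by (simp add: has_val_def power_add power2_eq_square mult_dvd_mono)
  have "int p ^ Suc (Suc j) dvd int p ^ (j + j)" using y(2) by (intro le_imp_power_dvd) simp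
  hence "int p ^ Suc (Suc j) dvd (m21 P)^2 * K" using 1 dvd_mult2 dvd_trans by blast
  moreover have "has_val (Suc j) (int p * (m11 P ^ (p - 1) * m21 P))"
    using has_val_mult_p has_val_mult_unit unit_power[OF x] y(1) by blast
  ultimately show ?thesis unfolding K using has_val_add by (simp only: mult.assoc)
qed

lemma has_val_power_pp:
  assumes P: "tor \<tau> \<delta> P" and y: "has_val j (m21 P)" "j \<ge> 2" and x: "\<not> int p dvd m11 P"
  shows "has_val (j + i) (m21 (P ^ (p ^ i))) \<and> \<not> int p dvd m11 (P ^ (p ^ i))"
proof (induction i)
  case (Suc i)
  let ?Q = "P ^ (p ^ i)"
  have Q: "tor \<tau> \<delta> ?Q" using P tor_power by blast
  have "P ^ (p ^ Suc i) = ?Q ^ p" by (simp add: power_mult[symmetric] mult.commute)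
  moreover have "has_val (Suc (j + i)) (m21 (?Q ^ p))" using has_val_power_p[OF Q] Suc y(2) by simp
  moreover have "\<not> int p dvd m11 (?Q ^ p)"
  proof -
    obtain L where L: "m11 (?Q ^ p) = m11 ?Q ^ p + m21 ?Q * L" using tor_power_expand[OF Q, of p] by blast
    have "int p ^ 1 dvd int p ^ (j + i)" using y(2) by (intro le_imp_power_dvd) simp
    hence "int p dvd m21 ?Q * L" using Suc by (auto simp: has_val_def intro: dvd_mult2 dvd_trans)
    moreover have "\<not> int p dvd m11 ?Q ^ p" using Suc unit_power by blast
    ultimately show ?thesis unfolding L by (simp add: dvd_add_left_iff)
  qed
  ultimately show ?case by simp
qed (use y x in simp)

lemma has_val_power:
  assumes P: "tor \<tau> \<delta> P" and y: "has_val j (m21 P)" "j \<ge> 2" and x: "\<not> int p dvd m11 P" and m: "m > 0"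
  shows "has_val (j + multiplicity p m) (m21 (P ^ m))"
proof -
  obtain l where l: "m = p ^ multiplicity p m * l" "\<not> p dvd l"
    using multiplicity_decompose'[of m p] m prime_p not_prime_unit by blast
  let ?i = "multiplicity p m"
  let ?Q = "P ^ (p ^ ?i)"
  have "tor \<tau> \<delta> ?Q" "has_val (j + ?i) (m21 ?Q)" "\<not> int p dvd m11 ?Q"
    using has_val_power_pp[OF P y x] tor_power[OF P] by blast+
  hence "has_val (j + ?i) (m21 (?Q ^ l))" using has_val_power_unit[of \<tau> \<delta> ?Q] y(2) l(2) by simp
  moreover have "?Q ^ l = P ^ m" using l(1) by (simp add: power_mult[symmetric])
  ultimately show ?thesis by simp
qed

lemma proj_eq_of_cr:
  assumes "tor \<tau> \<delta> P" "tor \<tau> \<delta> Q" "\<not> int p dvd mdet P" "\<not> int p dvd mdet Q" "int p ^ n dvd cross P Q"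
  shows "proj_eq n Q P"
proof (rule proj_eq_of_scal[OF assms(4,3)])
  have "tor \<tau> \<delta> (madj P * Q)" using assms tor_closed by blast
  thus "scalar_mod (int p ^ n) (madj P * Q)" using tor_scal cross_eq assms by simp
qed

text \<open>Multiplication by a power of \<open>(P ^ m) ^ (p ^ (n - j))\<close> corrects the \<open>n\<close>-th \<open>p\<close>-adic digit of the defect
  \<open>cross (P ^ i) Q\<close> without changing the lower ones.\<close>
lemma powers_exhaust:
  assumes P: "tor \<tau> \<delta> P" "\<not> int p dvd mdet P" and Q: "tor \<tau> \<delta> Q" "\<not> int p dvd mdet Q"
    and j: "has_val j (m21 (P ^ m))" "j \<ge> 2" and start: "int p ^ j dvd cross P Q" and "j \<le> n"
  shows "\<exists>i. int p ^ n dvd cross (P ^ i) Q"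
  using \<open>j \<le> n\<close>
proof (induction n rule: dec_induct)
  case base
  show ?case using start by (intro exI[of _ 1]) simp
next
  case (step n)
  obtain i e where e: "cross (P ^ i) Q = int p ^ n * e" using step.IH by (auto simp: dvd_def)
  let ?R = "P ^ i"
  have R: "tor \<tau> \<delta> ?R" using P tor_power by blast
  have detR: "\<not> int p dvd mdet ?R" using P(2) unit_power by (simp add: mdet_power)
  have n1: "n \<ge> 2" using step.hyps j(2) by simp
  define \<kappa> where "\<kappa> = m11 (madj ?R * Q)"
  have pcr: "int p dvd cross ?R Q"
    unfolding e using n1 by (intro dvd_mult2 dvd_power) simp
  have "\<not> int p dvd \<kappa>" unfolding \<kappa>_def
  proof (rule tor_unit)
    show "tor \<tau> \<delta> (madj ?R * Q)" using R Q tor_closed by blast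
    show "\<not> int p dvd mdet (madj ?R * Q)" using detR Q(2) by (simp add: mdet_mult prime_dvd_mult_int)
    show "int p dvd m21 (madj ?R * Q)" using pcr cross_eq[OF R Q(1)] by simp
  qed
  \<comment> \<open>A power of \<open>P\<close> whose C-coordinate has exact valuation
    \<open>n\<close>: starting from valuation \<open>j\<close>, each p-th power adds one.\<close>
  define G where "G = (P ^ m) ^ (p ^ (n - j))"
  have Pm: "tor \<tau> \<delta> (P ^ m)" using P tor_power by blast
  have G: "tor \<tau> \<delta> G" unfolding G_def using Pm tor_power by blast
  have "int p ^ 1 dvd int p ^ j" using j(2) by (intro le_imp_power_dvd) simp
  hence "\<not> int p dvd m11 (P ^ m)"
    using tor_unit[OF Pm] P(2) unit_power j(1) by (auto simp: mdet_power has_val_def dest: dvd_trans)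
  hence Gv: "has_val n (m21 G)" "\<not> int p dvd m11 G"
    using has_val_power_pp[OF Pm j, of "n - j"] step.hyps by (simp_all add: G_def)
  then obtain y where y: "m21 G = int p ^ n * y" by (auto simp: has_val_def)
  have py: "\<not> int p dvd y" using Gv(1) by (simp add: has_val_def y)
  let ?x = "m11 G"
  obtain v where v: "[y * \<kappa> * v = 1] (mod int p ^ 1)"
    using inverse_mod[of "y * \<kappa>" 1] py \<open>\<not> int p dvd \<kappa>\<close> by (auto simp: prime_dvd_mult_int)
  \<comment> \<open>To first order the new defect is
    \<open>p ^ n * x ^ (l - 1) * (x * e - l * y * \<kappa>)\<close>. The exponent solves
    \<open>l * y * \<kappa> = x * e\<close> modulo \<open>p\<close>; the summand \<open>p\<close>
    only keeps it positive.\<close>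
  define l where "l = nat ((v * ?x * e) mod int p) + p"
  have l: "[int l = v * ?x * e] (mod int p)" "l > 0" using p_pos by (simp_all add: l_def cong_def)
  obtain K L where KL: "m21 (G ^ l) = int l * ?x ^ (l - 1) * m21 G + (m21 G)^2 * K" "m11 (G ^ l) = ?x ^ l + m21 G * L"
    using tor_power_expand[OF G, of l] by blast
  have xl: "?x ^ l = ?x ^ (l - 1) * ?x" using l(2) by (cases l) auto
  have "cross (?R * G ^ l) Q = m11 (G ^ l) * cross ?R Q - m21 (G ^ l) * \<kappa>"
  proof -
    have "tor \<tau> \<delta> (G ^ l)" using G tor_power by blast
    thus ?thesis using R Q(1) by (simp add: cross_def \<kappa>_def tor_def algebra_simps)
  qed
  also have "\<dots> = int p ^ n * (?x ^ (l - 1) * (?x * e - int l * (y * \<kappa>))) + (int p ^ n * int p ^ n) * (y * L * e - y^2 * K * \<kappa>)"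
    unfolding KL e y xl by (simp add: algebra_simps power2_eq_square)
  finally have cross: "cross (?R * G ^ l) Q = \<dots>" .
  have "[?x * e - int l * (y * \<kappa>) = ?x * e - v * ?x * e * (y * \<kappa>)] (mod int p)"
    by (intro cong_diff cong_mult cong_refl l)
  also have "?x * e - v * ?x * e * (y * \<kappa>) = ?x * e * 1 - ?x * e * (y * \<kappa> * v)" by (simp add: algebra_simps)
  also have "[\<dots> = ?x * e * 1 - ?x * e * 1] (mod int p)" using v by (intro cong_diff cong_mult cong_refl) simp
  finally have "int p dvd ?x * e - int l * (y * \<kappa>)" by (simp add: cong_0_iff)
  hence "int p ^ n * int p dvd int p ^ n * (?x ^ (l - 1) * (?x * e - int l * (y * \<kappa>)))"
    by (intro mult_dvd_mono dvd_mult dvd_refl)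
  moreover have "int p ^ n * int p dvd (int p ^ n * int p ^ n) * (y * L * e - y^2 * K * \<kappa>)"
    using n1 by (intro dvd_mult2 mult_dvd_mono dvd_refl dvd_power) simp
  ultimately have "int p ^ Suc n dvd cross (?R * G ^ l) Q" unfolding cross by (simp add: mult.commute[of "int p"])
  moreover have "?R * G ^ l = P ^ (i + m * p ^ (n - j) * l)" by (simp add: G_def power_add power_mult)
  ultimately show ?case by metis
qed

section \<open>From equal generated groups to conjugate isometries\<close>

lemma pow_period:
  assumes "\<not> int p dvd mdet A" obtains e where "e > 0" "mcong (int p ^ n) (A ^ e) 1"
proof -
  let ?N = "int p ^ n"
  let ?f = "\<lambda>i. (m11 (A ^ i) mod ?N, m12 (A ^ i) mod ?N, m21 (A ^ i) mod ?N, m22 (A ^ i) mod ?N)"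
  have "range ?f \<subseteq> {0..<?N} \<times> {0..<?N} \<times> {0..<?N} \<times> {0..<?N}" by auto
  hence "finite (range ?f)" by (rule finite_subset) auto
  hence "\<not> inj ?f" using finite_imageD infinite_UNIV_nat by blast
  then obtain i k where ik: "?f i = ?f k" "i < k" unfolding inj_on_def by (metis linorder_neqE_nat)
  have "mcong ?N (A ^ k) (A ^ i)" using ik(1) by (simp add: mcong_def mod_eq_dvd_iff[symmetric])
  hence "mcong ?N (madj (A ^ i) * A ^ k) (madj (A ^ i) * A ^ i)" by (intro mcong_mult mcong_refl)
  moreover have "madj (A ^ i) * A ^ k = of_int (mdet (A ^ i)) * A ^ (k - i)"
  proof -
    have "A ^ k = A ^ i * A ^ (k - i)" using ik(2) by (simp flip: power_add)
    thus ?thesis by (simp add: mult.assoc[symmetric])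
  qed
  ultimately have "mcong ?N (of_int (mdet (A ^ i)) * A ^ (k - i)) (of_int (mdet (A ^ i)) * 1)" by simp
  hence "mcong ?N (A ^ (k - i)) 1"
    by (rule mcong_cancel) (use assms unit_power coprime_pow in \<open>simp add: mdet_power\<close>)
  thus thesis using that[of "k - i"] ik(2) by simp
qed

lemma act_power:
  assumes A: "A \<in> GLs" and v: "v \<in> vts UNIV"
  shows "(act A ^^ e) v = act (\<lambda>n. A n ^ e) v"
proof (induction e)
  case 0
  show ?case using v by (auto elim!: vts_cases simp: act_W GLs_one mapp_def)
next
  case (Suc e)
  thus ?case using act_mult[OF A GLs_power[OF A] v] by simp
qed

lemma act_level_eq:
  assumes "A \<in> GLs" "B \<in> GLs" "proj_eq n (A n) (B n)" "v \<in> vts {n}"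
  shows "act A v = act B v"
proof -
  obtain w where w: "w \<in> Pr p" "v = W p n w" using assms(4) by (auto elim: vts_cases)
  have "\<forall>w\<in>Pr p. W p n (mapp (A n) w) = W p n (mapp (B n) w)"
    using W_mapp_iff[OF GLsD(2)[OF assms(1)] GLsD(2)[OF assms(2)]] assms(3) by blast
  thus ?thesis using w by (simp add: act_W[OF assms(1) w(1)] act_W[OF assms(2) w(1)])
qed

lemma vts_sub_UNIV: "v \<in> vts I \<Longrightarrow> v \<in> vts UNIV" using vts_mono[of I UNIV] by blast

text \<open>The exponents may vary with the level: on each level either isometry is a power of the
  other, so the orbits agree and \<open>conj_of_same_orbits\<close> applies.\<close>

lemma iso_conj_of_powers:
  assumes A: "A \<in> GLs" and B: "B \<in> GLs"
    and AB: "\<And>n. \<exists>e. proj_eq n (B n) (A n ^ e)" and BA: "\<And>n. \<exists>e. proj_eq n (A n) (B n ^ e)"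
  shows "(act A, act B) \<in> conj_rel (Iso (tr UNIV)) (carrier (Iso (tr UNIV)))"
proof (rule conj_of_same_orbits)
  have aut: "aut UNIV (act A)" if "A \<in> GLs" for A using aut_act[OF that, of UNIV] ract_UNIV[of A] by (simp add: ract_def)
  show "aut UNIV (act A)" "aut UNIV (act B)" using aut A B by blast+
  have pw: "\<exists>e. \<forall>v\<in>vts {n}. act B v = (act A ^^ e) v"
    if A: "A \<in> GLs" and B: "B \<in> GLs" and "\<exists>e. proj_eq n (B n) (A n ^ e)" for A B n
  proof -
    obtain e where "proj_eq n (B n) (A n ^ e)" using \<open>\<exists>e. proj_eq n (B n) (A n ^ e)\<close> by blast
    hence "act B v = act (\<lambda>n. A n ^ e) v" if "v \<in> vts {n}" for v
      using act_level_eq[OF B GLs_power[OF A, of e] _ that] by simp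
    thus ?thesis using act_power[OF A vts_sub_UNIV] by metis
  qed
  show "\<exists>e. \<forall>v\<in>vts {n}. act B v = (act A ^^ e) v" for n using pw[OF A B AB] .
  show "\<exists>e. \<forall>v\<in>vts {n}. act A v = (act B ^^ e) v" for n using pw[OF B A BA] .
  show "\<exists>e>0. \<forall>v\<in>vts {n}. (act A ^^ e) v = v" for n
  proof -
    obtain e where e: "e > 0" "mcong (int p ^ n) (A n ^ e) 1" using pow_period[OF GLsD(2)[OF A]] .
    have "proj_eq n (A n ^ e) 1" unfolding proj_eq_def using e(2) by (intro exI[of _ 1]) simp
    hence "act (\<lambda>n. A n ^ e) v = act (\<lambda>n. 1) v" if "v \<in> vts {n}" for v
      using act_level_eq[OF GLs_power[OF A, of e] GLs_one _ that] by simp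
    moreover have "act (\<lambda>n. 1) v = v" if "v \<in> vts {n}" for v
      using act_power[OF A vts_sub_UNIV[OF that], of 0] by simp
    ultimately show ?thesis using act_power[OF A vts_sub_UNIV] e(1) by metis
  qed
qed

definition torus :: "int \<Rightarrow> int \<Rightarrow> (nat \<Rightarrow> imat) set" where
  "torus \<tau> \<delta> = {A \<in> GLs. \<forall>n. tor \<tau> \<delta> (A n)}"

lemma mcong_m21: "mcong N A B \<Longrightarrow> [m21 A = m21 B] (mod N)"
  by (simp add: mcong_def cong_iff_dvd_diff)

lemma cross_self: "mcong N P Q \<Longrightarrow> N dvd cross P Q"
proof -
  assume "mcong N P Q"
  moreover have "cross P Q = m21 P * (m11 P - m11 Q) - m11 P * (m21 P - m21 Q)" by (simp add: cross_def algebra_simps)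
  ultimately show ?thesis by (simp add: mcong_def)
qed

text \<open>The residues modulo \<open>p ^ Suc j\<close> fix the valuation \<open>j\<close> of the
  m-th power on all deeper levels, and the congruence of \<open>A\<close> and \<open>B\<close>
  supplies the starting point for \<open>powers_exhaust\<close>. Shallower levels follow by
  reduction.\<close>

lemma torus_powers:
  assumes A: "A \<in> torus \<tau> \<delta>" and B: "B \<in> torus \<tau> \<delta>" and j: "has_val j (m21 (A (Suc j) ^ m))" "j \<ge> 2"
    and AB: "mcong (int p ^ Suc j) (A (Suc j)) (B (Suc j))"
  shows "\<exists>e. proj_eq n (B n) (A n ^ e)"
proof -
  have G: "A \<in> GLs" "B \<in> GLs" and t: "tor \<tau> \<delta> (A n)" "tor \<tau> \<delta> (B n)" for n using A B by (auto simp: torus_def)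
  have main: "\<exists>e. proj_eq n (B n) (A n ^ e)" if n: "n \<ge> Suc j" for n
  proof -
    have Aj: "mcong (int p ^ Suc j) (A n) (A (Suc j))" "mcong (int p ^ Suc j) (B n) (B (Suc j))"
      using GLs_le G n by blast+
    have "has_val j (m21 (A n ^ m))"
      by (rule has_val_cong[OF j(1) cong_sym[OF mcong_m21[OF mcong_power[OF Aj(1)]]]]) simp
    moreover have "mcong (int p ^ Suc j) (A n) (B n)" using Aj AB mcong_trans mcong_sym by blast
    hence "int p ^ j dvd cross (A n) (B n)" using cross_self by (meson dvd_trans le_imp_power_dvd lessI less_imp_le)
    ultimately obtain i where "int p ^ n dvd cross (A n ^ i) (B n)"
      using powers_exhaust[OF t(1) GLsD(2)[OF G(1)] t(2) GLsD(2)[OF G(2)] _ j(2)] n by (meson Suc_leD)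
    hence "proj_eq n (B n) (A n ^ i)"
      by (intro proj_eq_of_cr[OF tor_power[OF t(1)] t(2)])
        (use GLsD(2) G unit_power in \<open>auto simp: mdet_power\<close>)
    thus ?thesis by blast
  qed
  show ?thesis
  proof (cases "n \<ge> Suc j")
    case False
    obtain e where "proj_eq (Suc j) (B (Suc j)) (A (Suc j) ^ e)" using main by blast
    thus ?thesis using W_mapp_le[OF G(2) GLs_power[OF G(1), of e], of "Suc j" n] False by auto
  qed (rule main)
qed

lemma torus_conj:
  assumes A: "A \<in> torus \<tau> \<delta>" and B: "B \<in> torus \<tau> \<delta>" and j: "has_val j (m21 (A (Suc j) ^ m))" "j \<ge> 2"
    and AB: "mcong (int p ^ Suc j) (A (Suc j)) (B (Suc j))"
  shows "(act A, act B) \<in> conj_rel (Iso (tr UNIV)) (carrier (Iso (tr UNIV)))"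
proof (rule iso_conj_of_powers)
  show "A \<in> GLs" "B \<in> GLs" using A B by (auto simp: torus_def)
  show "\<exists>e. proj_eq n (B n) (A n ^ e)" for n by (rule torus_powers[OF A B j AB])
  have "has_val j (m21 (B (Suc j) ^ m))" by (rule has_val_cong[OF j(1) mcong_m21[OF mcong_power[OF AB]]]) simp
  thus "\<exists>e. proj_eq n (A n) (B n ^ e)" for n by (rule torus_powers[OF B A _ j(2) mcong_sym[OF AB]])
qed

text \<open>The quotient \<open>h = madj A * B\<close> has a scalar m-th power and is scalar modulo
  \<open>p ^ 2\<close>. Were it not scalar, its C-coordinate would have some valuation
  \<open>j \<ge> 2\<close>, and that of \<open>h ^ m\<close> the finite valuation
  \<open>j + multiplicity p m\<close>.\<close>

lemma torus_torsion_eq: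
  assumes A: "A \<in> torus \<tau> \<delta>" and B: "B \<in> torus \<tau> \<delta>" and m: "m > 0"
    and Am: "\<And>n. int p ^ n dvd m21 (A n ^ m)" and Bm: "\<And>n. int p ^ n dvd m21 (B n ^ m)"
    and AB: "mcong (int p ^ 2) (A 2) (B 2)"
  shows "act A = act B"
proof -
  have G: "A \<in> GLs" "B \<in> GLs" and t: "tor \<tau> \<delta> (A n)" "tor \<tau> \<delta> (B n)" for n using A B by (auto simp: torus_def)
  define h where "h = (\<lambda>n. madj (A n) * B n)"
  have hG: "h \<in> GLs" unfolding h_def using GLs_mult GLs_madj G by blast
  have ht: "tor \<tau> \<delta> (h n)" for n unfolding h_def using t tor_closed by blast
  have h2: "int p ^ 2 dvd m21 (h 2)" unfolding h_def using cross_self[OF AB] cross_eq[OF t] by simp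
  have hc: "[m21 (h n) = m21 (h k)] (mod int p ^ k)" if "k \<le> n" for n k
    using mcong_m21[OF GLs_le[OF hG that]] .
  have "int p ^ N dvd m21 (h N)" for N
  proof (rule ccontr)
    assume N: "\<not> int p ^ N dvd m21 (h N)"
    then obtain j where j: "has_val j (m21 (h N))" "j < N" using has_val_exists by blast
    have "N > 2"
    proof (rule ccontr)
      assume "\<not> N > 2"
      hence "[m21 (h 2) = m21 (h N)] (mod int p ^ N)" "int p ^ N dvd int p ^ 2" using hc by (auto intro: le_imp_power_dvd)
      thus False using h2 N cong_dvd_iff dvd_trans by blast
    qed
    hence "int p ^ 2 dvd m21 (h N)" using hc[of 2 N] h2 cong_dvd_iff by (metis less_imp_le)
    hence j2: "j \<ge> 2" using j(1) by (metis has_val_def dvd_trans le_imp_power_dvd not_less_eq_eq)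
    define e where "e = j + multiplicity p m"
    \<comment> \<open>Deep enough to keep the valuation \<open>j\<close> found at \<open>N\<close>
      and to see the valuation \<open>e\<close> of the m-th power.\<close>
    define n where "n = N + Suc e"
    have jn: "has_val j (m21 (h n))" by (rule has_val_cong[OF j(1) cong_sym[OF hc] j(2)]) (simp add: n_def)
    have "int p dvd m21 (h n)"
    proof -
      have "int p ^ 1 dvd int p ^ j" using j2 by (intro le_imp_power_dvd) simp
      thus ?thesis using jn by (auto simp: has_val_def dest: dvd_trans)
    qed
    hence "\<not> int p dvd m11 (h n)" using tor_unit[OF ht GLsD(2)[OF hG]] by blast
    hence "has_val e (m21 (h n ^ m))" unfolding e_def using has_val_power[OF ht jn j2 _ m] by blast
    moreover have "int p ^ n dvd m21 (h n ^ m)"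
    proof -
      have "h n ^ m = madj (A n ^ m) * B n ^ m"
        unfolding h_def madj_power by (rule tor_power_mult[OF tor_closed(3)[OF t(1)] t(2)])
      hence "m21 (h n ^ m) = cross (A n ^ m) (B n ^ m)" using cross_eq[OF tor_power[OF t(1)] tor_power[OF t(2)]] by simp
      thus ?thesis using Am Bm by (simp add: cross_def)
    qed
    moreover have "int p ^ Suc e dvd int p ^ n" by (intro le_imp_power_dvd) (simp add: n_def)
    ultimately show False unfolding has_val_def using dvd_trans by blast
  qed
  hence "proj_eq n (B n) (A n)" for n
    using proj_eq_of_cr[OF t GLsD(2)[OF G(1)] GLsD(2)[OF G(2)]] cross_eq[OF t] by (simp add: h_def)
  thus ?thesis using act_eq_iff[OF G] proj_eq_sym by blast
qed

section \<open>Countably many isometry types\<close>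

text \<open>The map \<open>w \<mapsto> p z - w^2\<close> is a contraction of the \<open>p\<close>-adic integers divisible by \<open>p\<close>.\<close>
lemma hensel:
  assumes z: "coh p z"
  obtains w where "coh p w" "\<And>n. int p dvd w n" "\<And>n. [w n ^ 2 + w n = int p * z n] (mod int p ^ n)"
proof -
  \<comment> \<open>The k-th iterate of the contraction from 0, computed with the entry
    \<open>z n\<close>. Each iteration settles one more digit, so the diagonal \<open>V n n\<close>
    is correct modulo \<open>p ^ n\<close>.\<close>
  define V where "V n = rec_nat 0 (\<lambda>_ v. int p * z n - v^2)" for n
  have V0: "V n 0 = 0" and VS: "V n (Suc k) = int p * z n - (V n k)^2" for n k by (simp_all add: V_def)
  have dv: "int p dvd V n k" for n k
    by (induction k) (auto simp: V0 VS power2_eq_square)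
  have step: "int p ^ Suc k dvd V n (Suc k) - V n k" for n k
  proof (induction k)
    case (Suc k)
    have "V n (Suc (Suc k)) - V n (Suc k) = - ((V n (Suc k) - V n k) * (V n (Suc k) + V n k))"
      unfolding VS[of n "Suc k"] by (subst (2) VS) (simp add: algebra_simps power2_eq_square)
    moreover have "int p ^ Suc k * int p dvd (V n (Suc k) - V n k) * (V n (Suc k) + V n k)"
      using Suc dv by (intro mult_dvd_mono dvd_add)
    ultimately show ?case by (simp add: mult.commute)
  qed (simp add: V0 VS)
  have zc: "[V (Suc n) k = V n k] (mod int p ^ n)" for n k
  proof (induction k)
    case (Suc k)
    have "[z (Suc n) = z n] (mod int p ^ n)" using z by (simp add: coh_def)
    thus ?case unfolding VS using Suc by (intro cong_diff cong_mult cong_pow cong_refl)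
  qed (simp add: V0)
  show thesis
  proof (rule that[of "\<lambda>n. V n n"])
    show "coh p (\<lambda>n. V n n)"
    proof (rule cohI)
      fix n
      have "int p ^ n dvd V (Suc n) (Suc n) - V (Suc n) n" by (rule dvd_trans[OF _ step]) simp
      hence "[V (Suc n) (Suc n) = V (Suc n) n] (mod int p ^ n)" by (simp add: cong_iff_dvd_diff)
      thus "[V (Suc n) (Suc n) = V n n] (mod int p ^ n)" using zc cong_trans by blast
    qed
    show "[V n n ^ 2 + V n n = int p * z n] (mod int p ^ n)" for n
    proof -
      have "int p ^ n dvd V n (Suc n) - V n n" by (rule dvd_trans[OF _ step]) simp
      hence "int p ^ n dvd - (V n (Suc n) - V n n)" by (simp only: dvd_minus_iff)
      thus ?thesis by (simp add: VS cong_iff_dvd_diff algebra_simps)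
    qed
  qed (rule dv)
qed

text \<open>Division by \<open>p ^ a\<close> loses \<open>a\<close> digits, which are regained by
  reading the dividend at index \<open>n + a\<close>; the cofactor \<open>K'\<close> is inverted
  modulo each \<open>p ^ n\<close>.\<close>

lemma padic_divide:
  assumes x: "coh p x" and K: "K = int p ^ a * K'" "\<not> int p dvd K'" and dvd: "\<And>n. n \<ge> a \<Longrightarrow> int p ^ a dvd x n"
  obtains y where "coh p y" "\<And>n. [K * y n = x n] (mod int p ^ n)"
proof -
  have "\<exists>i. [K' * i = 1] (mod int p ^ n)" for n using inverse_mod[OF K(2)] by metis
  then obtain i where i: "\<And>n. [K' * i n = 1] (mod int p ^ n)" by metis
  define q where "q n = x (n + a) div int p ^ a" for n
  have q: "x (n + a) = int p ^ a * q n" for n using dvd[of "n + a"] by (simp add: q_def)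
  have qc: "[q (Suc n) = q n] (mod int p ^ n)" for n
  proof -
    have "[x (Suc (n + a)) = x (n + a)] (mod int p ^ (n + a))" using x unfolding coh_def by blast
    hence "int p ^ n * int p ^ a dvd x (Suc n + a) - x (n + a)"
      by (simp only: cong_iff_dvd_diff power_add add_Suc)
    hence "int p ^ a * int p ^ n dvd int p ^ a * (q (Suc n) - q n)"
      unfolding q by (simp only: right_diff_distrib mult.commute[of "int p ^ n"])
    thus ?thesis by (simp add: cong_iff_dvd_diff)
  qed
  define y where "y n = q n * i n" for n
  have Ky: "[K' * y n = q n] (mod int p ^ n)" for n
    using cong_scalar_left[OF i[of n], of "q n"] by (simp add: y_def algebra_simps)
  show thesis
  proof (rule that[of y])
    show "coh p y"
    proof (rule cohI)
      fix n
      have "[K' * y (Suc n) = q (Suc n)] (mod int p ^ n)" by (rule cong_dvd_modulus[OF Ky]) simp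
      also have "[q (Suc n) = q n] (mod int p ^ n)" by (rule qc)
      also have "[q n = K' * y n] (mod int p ^ n)" by (rule cong_sym[OF Ky])
      finally have "[K' * y (Suc n) = K' * y n] (mod int p ^ n)" .
      thus "[y (Suc n) = y n] (mod int p ^ n)" using coprime_pow[OF K(2), of n] by (simp add: cong_mult_lcancel)
    qed
    fix n
    have "[int p ^ a * (K' * y n) = int p ^ a * q n] (mod int p ^ n)" by (intro cong_scalar_left Ky)
    also have "int p ^ a * q n = x (n + a)" by (simp add: q)
    also have "[x (n + a) = x n] (mod int p ^ n)" by (rule coh_le[OF x]) simp
    finally show "[K * y n = x n] (mod int p ^ n)" by (simp add: K(1) mult.assoc)
  qed
qed

lemma padic_divide_large:
  assumes x: "coh p x" and K: "\<not> int p ^ M dvd K" and dvd: "\<And>n. n \<ge> M \<Longrightarrow> int p ^ M dvd x n"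
  obtains y where "coh p y" "\<And>n. [K * y n = x n] (mod int p ^ n)"
proof -
  obtain a where a: "has_val a K" "a < M" using has_val_exists[OF K] by blast
  then obtain K' where K': "K = int p ^ a * K'" by (auto simp: has_val_def)
  have "\<not> int p dvd K'" using a(1) by (simp add: has_val_def K')
  moreover have "int p ^ a dvd x n" if "n \<ge> a" for n
  proof -
    have "int p ^ a dvd x (max n M)"
      using dvd[of "max n M"] a(2) by (meson dvd_trans le_imp_power_dvd less_imp_le max.cobounded2)
    moreover have "[x (max n M) = x n] (mod int p ^ a)"
      using coh_le[OF x, of n "max n M"] that by (meson cong_dvd_modulus le_imp_power_dvd max.cobounded1)
    ultimately show ?thesis using cong_dvd_iff by blast
  qed
  ultimately show thesis using padic_divide[OF x K'] that by blast
qed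

text \<open>For \<open>p = 2\<close> cancelling 4 costs two digits; coherence supplies them from the
  entry of index \<open>n + 2\<close>.\<close>

lemma four_dvd:
  assumes x: "coh p x" and dvd: "\<And>n. int p ^ n dvd 4 * x n" shows "int p ^ n dvd x n"
proof -
  have "int p ^ n dvd x (n + 2)"
  proof (cases "p = 2")
    case True
    have "(4 :: int) * 2 ^ n dvd 4 * x (n + 2)" using dvd[of "n + 2"] by (simp add: True)
    thus ?thesis by (simp add: True)
  next
    case False
    have "int p ^ (n + 2) dvd x (n + 2)"
      using dvd[of "n + 2"] coprime_4[OF False] by (metis coprime_commute coprime_dvd_mult_right_iff)
    thus ?thesis by (rule dvd_trans[rotated]) (simp add: le_imp_power_dvd)
  qed
  moreover have "[x (n + 2) = x n] (mod int p ^ n)" by (rule coh_le[OF x]) simp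
  ultimately show ?thesis using cong_dvd_iff by blast
qed

text \<open>The substitution \<open>X \<mapsto> c + s X\<close> reaches a polynomial with integer coefficients: if the discriminant \<open>D\<close> is
  nonzero, an integral approximation has a discriminant \<open>D0\<close> with \<open>D = D0 (1 + 4 p z)\<close>, and
  \<open>1 + 4 p z\<close> is the square of \<open>1 + 2 w\<close> when \<open>w^2 + w = p z\<close>.\<close>
lemma quadratic_normal_form:
  assumes t: "coh p t" and d: "coh p d"
  obtains \<tau> \<delta> c s where "coh p c" "coh p s" "\<And>n. \<not> int p dvd s n"
    "\<And>n. [2 * c n + s n * \<tau> = t n] (mod int p ^ n)"
    "\<And>n. [c n ^ 2 + c n * s n * \<tau> + s n ^ 2 * \<delta> = d n] (mod int p ^ n)"
proof -
  define D where "D n = t n ^ 2 - 4 * d n" for n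
  have Dc: "coh p D" unfolding D_def power2_eq_square by (intro coh_intros t d)
  \<comment> \<open>The determinant comes for free: four times it is the square of the trace minus
    the discriminant, and \<open>four_dvd\<close> cancels the 4.\<close>
  have det: "[c n ^ 2 + c n * s n * \<tau> + s n ^ 2 * \<delta> = d n] (mod int p ^ n)"
    if c: "coh p c" and s: "coh p s" and tr: "\<And>n. [2 * c n + s n * \<tau> = t n] (mod int p ^ n)"
      and disc: "\<And>n. [s n ^ 2 * (\<tau>^2 - 4 * \<delta>) = D n] (mod int p ^ n)" for c s \<tau> \<delta> n
  proof -
    let ?x = "\<lambda>n. c n ^ 2 + c n * s n * \<tau> + s n ^ 2 * \<delta> - d n"
    have "coh p ?x" unfolding power2_eq_square by (intro coh_intros c s d)
    moreover have "int p ^ n dvd 4 * ?x n" for n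
    proof -
      have "[(2 * c n + s n * \<tau>)^2 - s n ^ 2 * (\<tau>^2 - 4 * \<delta>) = t n ^ 2 - D n] (mod int p ^ n)"
        by (intro cong_diff cong_pow tr disc)
      moreover have "(2 * c n + s n * \<tau>)^2 - s n ^ 2 * (\<tau>^2 - 4 * \<delta>) - (t n ^ 2 - D n) = 4 * ?x n"
        by (simp add: D_def algebra_simps power2_eq_square)
      ultimately show ?thesis by (simp only: cong_iff_dvd_diff)
    qed
    ultimately have "int p ^ n dvd ?x n" by (rule four_dvd)
    thus ?thesis by (simp add: cong_iff_dvd_diff)
  qed
  show thesis
  proof (cases "\<forall>n. int p ^ n dvd D n")
    case True
    \<comment> \<open>Zero discriminant means a double root, half the trace. For
      \<open>p = 2\<close> halving is possible because \<open>t ^ 2 = 4 * d\<close>. The companion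
      matrix is then the nilpotent one with trace and determinant 0.\<close>
    obtain e where e: "coh p e" "\<And>n. [2 * e n = t n] (mod int p ^ n)"
    proof (cases "p = 2")
      case p2: True
      have "int p ^ 1 dvd t n" if "n \<ge> 1" for n
      proof -
        have "int p ^ 1 dvd D n" using True that by (meson dvd_trans le_imp_power_dvd)
        thus ?thesis by (simp add: p2 D_def)
      qed
      moreover have "2 = int p ^ 1 * 1" by (simp add: p2)
      ultimately show thesis using padic_divide[OF t _ not_dvd_1] that by blast
    next
      case False
      have "\<not> int p dvd 2" using False by (rule not_dvd_2)
      moreover have "2 = int p ^ 0 * 2" "\<And>n. int p ^ 0 dvd t n" by simp_all
      ultimately show thesis using padic_divide[OF t] that by blast
    qed
    show thesis
    proof (rule that[OF e(1) coh_const, of 1 0 0])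
      show "[2 * e n + 1 * 0 = t n] (mod int p ^ n)" for n using e(2) by simp
      show "[e n ^ 2 + e n * 1 * 0 + 1 ^ 2 * 0 = d n] (mod int p ^ n)" for n
        by (rule det[OF e(1) coh_const]) (use e(2) True in \<open>simp_all add: cong_0_iff cong_sym_eq[of 0]\<close>)
    qed simp
  next
    case False
    then obtain v where v: "\<not> int p ^ v dvd D v" by blast
    \<comment> \<open>The slack 3 exceeds or equals the valuation of \<open>4 * p\<close> for every
      prime, so \<open>4 * p * D0\<close> still divides any difference that vanishes modulo
      \<open>p ^ M\<close>.\<close>
    define M where "M = v + 3"
    define \<tau> \<delta> D0 where "\<tau> = t M" and "\<delta> = d M" and "D0 = D M"
    have D0: "D0 = \<tau>^2 - 4 * \<delta>" by (simp add: D0_def D_def \<tau>_def \<delta>_def)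
    have "[D M = D v] (mod int p ^ v)" by (rule coh_le[OF Dc]) (simp add: M_def)
    hence vD0: "\<not> int p ^ v dvd D0" using v cong_dvd_iff unfolding D0_def by blast
    have "\<not> int p ^ M dvd 4 * int p * D0"
    proof
      assume "int p ^ M dvd 4 * int p * D0"
      hence "int p * int p ^ (v + 2) dvd int p * (4 * D0)" by (simp add: M_def power_add ac_simps power3_eq_cube power2_eq_square)
      hence a: "int p ^ (v + 2) dvd 4 * D0" by simp
      show False
      proof (cases "p = 2")
        case True
        hence "(4 :: int) * 2 ^ v dvd 4 * D0" using a by simp
        thus False using vD0 True by simp
      next
        case False
        have "int p ^ (v + 2) dvd D0"
          using a coprime_4[OF False] by (metis coprime_commute coprime_dvd_mult_right_iff)
        hence "int p ^ v dvd D0" by (rule dvd_trans[rotated]) (simp add: le_imp_power_dvd)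
        thus False using vD0 by blast
      qed
    qed
    moreover have "coh p (\<lambda>n. D n - D0)" by (intro coh_intros Dc)
    moreover have "int p ^ M dvd D n - D0" if "n \<ge> M" for n
      using coh_le[OF Dc that] by (simp add: D0_def cong_iff_dvd_diff)
    ultimately obtain z where z: "coh p z" "\<And>n. [4 * int p * D0 * z n = D n - D0] (mod int p ^ n)"
      using padic_divide_large by blast
    have "\<not> int p ^ M dvd 2"
    proof
      assume "int p ^ M dvd 2"
      hence "int p ^ M \<le> 2" by (rule zdvd_imp_le) simp
      moreover have "(2 :: int) ^ 3 \<le> int p ^ 3" using prime_ge_2_nat[OF prime_p] by (intro power_mono) auto
      moreover have "int p ^ 3 \<le> int p ^ M" using p_gt_1 by (intro power_increasing) (auto simp: M_def)
      ultimately show False by simp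
    qed
    moreover have "coh p (\<lambda>n. t n - \<tau>)" by (intro coh_intros t)
    moreover have "int p ^ M dvd t n - \<tau>" if "n \<ge> M" for n
      using coh_le[OF t that] by (simp add: \<tau>_def cong_iff_dvd_diff)
    ultimately obtain e where e: "coh p e" "\<And>n. [2 * e n = t n - \<tau>] (mod int p ^ n)"
      using padic_divide_large by blast
    obtain w where w: "coh p w" "\<And>n. int p dvd w n" "\<And>n. [w n ^ 2 + w n = int p * z n] (mod int p ^ n)"
      using hensel[OF z(1)] by blast
    let ?s = "\<lambda>n. 1 + 2 * w n" and ?c = "\<lambda>n. e n - w n * \<tau>"
    have cs: "coh p ?c" "coh p ?s" by (intro coh_intros e w)+
    have tr: "[2 * ?c n + ?s n * \<tau> = t n] (mod int p ^ n)" for n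
    proof -
      have "2 * ?c n + ?s n * \<tau> = 2 * e n + \<tau>" by (simp add: algebra_simps)
      also have "[\<dots> = t n - \<tau> + \<tau>] (mod int p ^ n)" by (intro cong_add cong_refl e)
      finally show ?thesis by simp
    qed
    have disc: "[?s n ^ 2 * (\<tau>^2 - 4 * \<delta>) = D n] (mod int p ^ n)" for n
    proof -
      have "?s n ^ 2 * (\<tau>^2 - 4 * \<delta>) = D0 + 4 * D0 * (w n ^ 2 + w n)"
        by (simp add: D0 algebra_simps power2_eq_square)
      also have "[\<dots> = D0 + 4 * D0 * (int p * z n)] (mod int p ^ n)"
        by (intro cong_add cong_mult cong_refl w)
      also have "D0 + 4 * D0 * (int p * z n) = D0 + 4 * int p * D0 * z n" by (simp add: algebra_simps)
      also have "[\<dots> = D0 + (D n - D0)] (mod int p ^ n)" by (intro cong_add cong_refl z)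
      finally show ?thesis by simp
    qed
    have "\<not> int p dvd ?s n" for n
    proof
      assume "int p dvd 1 + 2 * w n"
      moreover have "int p dvd 2 * w n" using w(2) by (rule dvd_mult)
      ultimately show False using not_dvd_1 by (simp only: dvd_add_left_iff)
    qed
    thus thesis using that[OF cs _ tr det[OF cs tr disc]] by blast
  qed
qed

text \<open>The scalar part is split off and the rest divided by the highest possible
  \<open>p ^ k\<close>. What remains is not scalar modulo \<open>p\<close>, so it has a cyclic
  vector and is conjugate to some \<open>c + s C\<close> with integral \<open>C\<close>;
  reassembling keeps the matrix in the torus of \<open>C\<close>.\<close>

lemma torus_representative:
  assumes A: "A \<in> GLs"
  shows "\<exists>\<tau> \<delta> E H. E \<in> torus \<tau> \<delta> \<and> H \<in> GLs \<and> (\<forall>n. proj_eq n (E n * H n) (H n * A n))"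
proof (cases "\<forall>n. scalar_mod (int p ^ n) (A n)")
  case True
  have "(\<lambda>n. 1) \<in> torus 0 0" by (simp add: torus_def GLs_one tor_closed)
  moreover have "proj_eq n (1 * 1) (1 * A n)" for n
    using scalar_mod_proj_one proj_eq_sym True GLsD(2)[OF A] by simp
  ultimately show ?thesis using GLs_one by blast
next
  case False
  define k0 where "k0 = (LEAST k. \<not> scalar_mod (int p ^ k) (A k))"
  have k0: "\<not> scalar_mod (int p ^ k0) (A k0)" unfolding k0_def using False by (metis (mono_tags, lifting) LeastI)
  have "k0 \<noteq> 0" using k0 by (intro notI) (simp add: scalar_mod_def)
  then obtain k where k: "k0 = Suc k" by (cases k0) auto
  have sk: "scalar_mod (int p ^ k) (A k)"
    using not_less_Least[of k "\<lambda>k. \<not> scalar_mod (int p ^ k) (A k)"] k by (simp add: k0_def[symmetric])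
  \<comment> \<open>The shift by \<open>Suc k\<close> prepares the division by \<open>p ^ k\<close>:
    afterwards the entry of index \<open>n\<close> is known modulo \<open>p ^ Suc n\<close>, so even
    \<open>B 0\<close> determines the residue modulo \<open>p\<close>.\<close>
  let ?A = "\<lambda>n. A (n + Suc k)"
  have s1: "scalar_mod (int p ^ k) (?A n)" for n using scalar_mod_mcong[OF GLs_le[OF A, of k "n + Suc k"]] sk by simp
  have s2: "\<not> scalar_mod (int p ^ Suc k) (?A n)" for n
    using scalar_mod_mcong[OF GLs_le[OF A, of "Suc k" "n + Suc k"]] k0 k by simp
  \<comment> \<open>Taking the upper left entry as scalar part makes that entry of \<open>B\<close>
    vanish, which fixes \<open>B\<close> and makes it coherent.\<close>
  define a where "a n = m11 (?A n)" for n
  have "\<exists>B. ?A n = of_int (a n) + of_int (int p ^ k) * B" for n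
    using s1[of n] unfolding scalar_mod_iff a_def mcong_iff .
  then obtain B where B: "\<And>n. ?A n = of_int (a n) + of_int (int p ^ k) * B n" by metis
  have Ac: "mcong (int p ^ (k + Suc n)) (?A (Suc n)) (?A n)" for n
    using GLsD(1)[OF A, of "n + Suc k"] by (simp only: add_Suc add_Suc_right add.commute)
  have "m11 (?A n) = a n" for n by (simp add: a_def)
  hence B11: "m11 (B n) = 0" for n using B[of n] by (auto simp: imat_eqI dest: arg_cong[where f = m11])
  have Bc: "mcong (int p ^ Suc n) (B (Suc n)) (B n)" for n
  proof -
    let ?N = "int p ^ (k + Suc n)" and ?X = "?A (Suc n)" and ?Y = "?A n"
    have d: "?N dvd m12 ?X - m12 ?Y" "?N dvd m21 ?X - m21 ?Y" "?N dvd (m22 ?X - m22 ?Y) - (m11 ?X - m11 ?Y)"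
      using Ac[of n] unfolding mcong_def by (blast intro: dvd_diff)+
    have e: "m12 ?X - m12 ?Y = int p ^ k * (m12 (B (Suc n)) - m12 (B n))"
      "m21 ?X - m21 ?Y = int p ^ k * (m21 (B (Suc n)) - m21 (B n))"
      "(m22 ?X - m22 ?Y) - (m11 ?X - m11 ?Y) = int p ^ k * (m22 (B (Suc n)) - m22 (B n))"
      unfolding B by (simp_all add: B11 algebra_simps)
    show ?thesis using d unfolding e power_add by (simp add: mcong_def B11 del: power_Suc)
  qed
  have Bcoh: "cohM B" unfolding cohM_def using mcong_dvd[OF Bc] by (simp add: le_imp_power_dvd)
  have Bp: "mcong (int p) (B n) (B 0)" for n
  proof (induction n)
    case (Suc n)
    have "mcong (int p) (B (Suc n)) (B n)" by (rule mcong_dvd[OF Bc]) simp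
    thus ?case using Suc mcong_trans by blast
  qed simp
  have Bs: "\<not> scalar_mod (int p) (B n)" for n
  proof
    assume "scalar_mod (int p) (B n)"
    hence "scalar_mod (int p ^ Suc k) (?A n)"
      unfolding B scalar_mod_def by (simp add: right_diff_distrib[symmetric] mult.commute[of "int p"])
    thus False using s2 by blast
  qed
  have tc: "coh p (\<lambda>n. mtr (B n))" and dc: "coh p (\<lambda>n. mdet (B n))"
    using Bcoh unfolding cohM_iff mtr_def mdet_def by (auto intro!: coh_intros)
  obtain \<tau> \<delta> c s where cs: "coh p c" "coh p s" "\<And>n. \<not> int p dvd s n"
    "\<And>n. [2 * c n + s n * \<tau> = mtr (B n)] (mod int p ^ n)"
    "\<And>n. [c n ^ 2 + c n * s n * \<tau> + s n ^ 2 * \<delta> = mdet (B n)] (mod int p ^ n)"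
  proof (rule quadratic_normal_form[OF tc dc])
    fix \<tau> \<delta> c s
    assume "coh p c" "coh p s" "\<And>n. \<not> int p dvd s n"
      "\<And>n. [2 * c n + s n * \<tau> = mtr (B n)] (mod int p ^ n)"
      "\<And>n. [c n ^ 2 + c n * s n * \<tau> + s n ^ 2 * \<delta> = mdet (B n)] (mod int p ^ n)"
    thus thesis by (rule that)
  qed
  define F where "F n = of_int (c n) + of_int (s n) * companion \<tau> \<delta>" for n
  have Fcoh: "cohM F" unfolding cohM_iff F_def using cs(1,2) by (auto intro!: coh_intros)
  obtain u where u: "\<not> int p dvd vdet u (mapp (B 0) u)" using cyclic_vector[OF Bs[of 0]] by blast
  have bu: "\<not> int p dvd mdet (basis_mat u (B n))" for n
  proof -
    have "vdet u (mapp (B n) u) - vdet u (mapp (B 0) u) = vdet u (mapp (B n - B 0) u)"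
      by (simp add: vdet_def mapp_def algebra_simps)
    moreover have "int p dvd vdet u (mapp (B n - B 0) u)"
      using Bp[of n] by (simp add: vdet_def mapp_def mcong_def)
    ultimately have "[vdet u (mapp (B n) u) = vdet u (mapp (B 0) u)] (mod int p)" by (simp add: cong_iff_dvd_diff)
    thus ?thesis using u cong_dvd_iff unfolding mdet_basis_mat by blast
  qed
  have bF: "mdet (basis_mat (1, 0) (F n)) = s n" for n
    by (simp add: mdet_basis_mat vdet_def mapp_def F_def)
  define H where "H n = basis_mat (1, 0) (F n) * madj (basis_mat u (B n))" for n
  have HB: "mcong (int p ^ n) (H n * B n) (F n * H n)" for n
  proof (rule cyclic_conj(1)[OF mcong_companion _ H_def])
    show "[mtr (B n) = mtr (F n)] (mod int p ^ n)" "[mdet (B n) = mdet (F n)] (mod int p ^ n)"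
      using cs(4,5)[of n] unfolding F_def mtr_shift_companion mdet_shift_companion by (simp_all add: cong_sym)
    show "mdet (basis_mat u (B n)) \<noteq> 0" using bu[of n] by auto
  qed
  have HG: "H \<in> GLs"
  proof -
    have "cohM (\<lambda>n. basis_mat v (X n))" if "cohM X" for v X
      using that unfolding cohM_iff basis_mat_def Let_def mapp_def by (auto intro!: coh_intros)
    from this[OF Fcoh, of "(1, 0)"] this[OF Bcoh, of u] have "cohM H"
      unfolding H_def cohM_def by (intro allI mcong_mult mcong_madj) auto
    moreover have "\<not> int p dvd mdet (H n)" for n
      using bu cs(3) bF by (simp add: H_def mdet_mult prime_dvd_mult_int)
    ultimately show ?thesis by (simp add: GLs_iff)
  qed
  define E where "E n = of_int (a n) + of_int (int p ^ k) * F n" for n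
  have "coh p a"
  proof (rule cohI)
    fix n
    have "[m11 (?A (Suc n)) = m11 (?A n)] (mod int p ^ n)"
      using mcong_dvd[OF Ac[of n], of "int p ^ n"] by (simp add: le_imp_power_dvd mcong_def cong_iff_dvd_diff)
    thus "[a (Suc n) = a n] (mod int p ^ n)" by (simp add: a_def)
  qed
  hence Ecoh: "cohM E" using Fcoh unfolding cohM_iff E_def by (auto intro!: coh_intros)
  have HA: "mcong (int p ^ n) (H n * A n) (E n * H n)" for n
  proof -
    have "mcong (int p ^ n) (H n * A n) (H n * ?A n)"
      by (intro mcong_mult mcong_refl mcong_sym[OF GLs_le[OF A]]) simp
    also have "H n * ?A n = of_int (a n) * H n + of_int (int p ^ k) * (H n * B n)"
      unfolding B by (intro imat_eqI) (simp_all add: algebra_simps)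
    also have "mcong (int p ^ n) \<dots> (of_int (a n) * H n + of_int (int p ^ k) * (F n * H n))"
      by (intro mcong_add mcong_mult mcong_refl HB)
    also have "of_int (a n) * H n + of_int (int p ^ k) * (F n * H n) = E n * H n"
      unfolding E_def by (intro imat_eqI) (simp_all add: algebra_simps)
    finally show ?thesis .
  qed
  \<comment> \<open>At index 0 the congruence \<open>HA\<close> is modulo 1 and says nothing about
    the determinant; hence the final sequences are shifted by one.\<close>
  have Edet: "\<not> int p dvd mdet (E (Suc n))" for n
  proof -
    have "\<not> int p dvd mdet (H (Suc n) * A (Suc n))"
      using GLsD(2)[OF A] GLsD(2)[OF HG] by (simp add: mdet_mult prime_dvd_mult_int)
    hence "\<not> int p dvd mdet (E (Suc n) * H (Suc n))" using not_dvd_cong[OF mcong_mdet[OF HA]] by blast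
    thus ?thesis by (simp add: mdet_mult prime_dvd_mult_int)
  qed
  have sh: "cohM (\<lambda>n. X (Suc n))" if "cohM X" for X using that unfolding cohM_iff using coh_Suc by blast
  have "(\<lambda>n. E (Suc n)) \<in> torus \<tau> \<delta>"
    using sh[OF Ecoh] Edet by (simp add: torus_def GLs_iff) (simp add: tor_def E_def F_def algebra_simps)
  moreover have "(\<lambda>n. H (Suc n)) \<in> GLs" using sh HG by (simp add: GLs_iff)
  moreover have "proj_eq n (E (Suc n) * H (Suc n)) (H (Suc n) * A n)" for n
  proof -
    have "mcong (int p ^ n) (E (Suc n) * H (Suc n)) (H (Suc n) * A (Suc n))"
      by (rule mcong_dvd[OF mcong_sym[OF HA]]) (simp add: le_imp_power_dvd)
    also have "mcong (int p ^ n) (H (Suc n) * A (Suc n)) (H (Suc n) * A n)"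
      by (intro mcong_mult mcong_refl GLsD(1)[OF A])
    finally show ?thesis unfolding proj_eq_def by (intro exI[of _ 1]) simp
  qed
  ultimately show ?thesis by blast
qed

end

section \<open>Codes for isometry types\<close>

instance imat :: countable by countable_datatype

text \<open>Codes form a relation: an element may have many codes, but elements that share one must
  have the same image.\<close>

lemma countable_by_code:
  fixes R :: "'a \<Rightarrow> 'c :: countable \<Rightarrow> bool"
  assumes "\<And>A. A \<in> S \<Longrightarrow> \<exists>c. R A c"
    and "\<And>A B c. A \<in> S \<Longrightarrow> B \<in> S \<Longrightarrow> R A c \<Longrightarrow> R B c \<Longrightarrow> f A = f B"
  shows "countable (f ` S)"
proof (rule countable_subset)
  show "f ` S \<subseteq> range (\<lambda>c. f (SOME A. A \<in> S \<and> R A c))"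
  proof
    fix y assume "y \<in> f ` S"
    then obtain A c where A: "A \<in> S" "y = f A" "R A c" using assms(1) by blast
    hence "(SOME A. A \<in> S \<and> R A c) \<in> S \<and> R (SOME A. A \<in> S \<and> R A c) c" by (intro someI[of "\<lambda>A. A \<in> S \<and> R A c"]) blast
    hence "y = f (SOME A. A \<in> S \<and> R A c)" using A assms(2) by blast
    thus "y \<in> range (\<lambda>c. f (SOME A. A \<in> S \<and> R A c))" by blast
  qed
qed simp

lemma countable_lesspoll_real: "countable A \<Longrightarrow> A \<prec> (UNIV :: real set)"
proof -
  assume A: "countable A"
  then obtain f :: "'a \<Rightarrow> nat" where f: "inj_on f A" by (auto simp: countable_def)
  hence "inj_on (\<lambda>x. real (f x)) A" by (auto simp: inj_on_def)
  hence "A \<lesssim> (UNIV :: real set)" unfolding lepoll_def by blast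
  moreover have "\<not> A \<approx> (UNIV :: real set)"
    using A uncountable_UNIV_real eqpoll_sym lepoll_def eqpoll_imp_lepoll countable_image_inj_on
    by (metis countable_lepoll)
  ultimately show ?thesis by (simp add: lesspoll_def)
qed

text \<open>A sequence is recovered from its graph, encoded as a set of natural numbers.\<close>

lemma sequences_lepoll_real: "(UNIV :: (nat \<Rightarrow> 'a :: countable) set) \<lesssim> (UNIV :: real set)"
proof -
  define F :: "(nat \<Rightarrow> 'a) \<Rightarrow> nat set" where "F f = range (\<lambda>n. prod_encode (n, to_nat (f n)))" for f
  have "inj F"
  proof (rule injI, rule ext)
    fix f g :: "nat \<Rightarrow> 'a" and n assume "F f = F g"
    hence "prod_encode (n, to_nat (f n)) \<in> F g" unfolding F_def by blast
    thus "f n = g n" by (auto simp: F_def)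
  qed
  hence "(UNIV :: (nat \<Rightarrow> 'a) set) \<lesssim> (UNIV :: nat set set)" unfolding lepoll_def by blast
  thus ?thesis using nat_sets_eqpoll_reals eqpoll_imp_lepoll lepoll_trans by blast
qed

context prime_tree
begin

abbreviation iso_conj where "iso_conj \<equiv> conj_rel (Iso (tr UNIV)) (carrier (Iso (tr UNIV)))"
abbreviation gl_conj where "gl_conj \<equiv> conj_rel (Iso (tr UNIV)) (act ` GLs)"

lemma conj_rel_act_iff:
  assumes A: "A \<in> GLs" and B: "B \<in> GLs"
  shows "(act A, act B) \<in> gl_conj \<longleftrightarrow> (\<exists>H\<in>GLs. \<forall>n. proj_eq n (B n * H n) (H n * A n))"
proof -
  interpret G: group "Iso (tr UNIV)" by (rule group_tr) simp
  have S: "subgroup (act ` GLs) (Iso (tr UNIV))" using subgroup_ract[of UNIV] by simp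
  have I: "act A \<in> carrier (Iso (tr UNIV))" if "A \<in> GLs" for A using ract_Iso[of UNIV A] that by simp
  have M: "act A \<otimes>\<^bsub>Iso (tr UNIV)\<^esub> act B = act (\<lambda>n. A n * B n)" if "A \<in> GLs" "B \<in> GLs" for A B
    using ract_mult[of UNIV A B] that by simp
  have "(act A, act B) \<in> gl_conj \<longleftrightarrow> (\<exists>H\<in>GLs. act (\<lambda>n. B n * H n) = act (\<lambda>n. H n * A n))"
    using A B I by (simp add: G.conj_rel_iff[OF S] M)
  also have "\<dots> \<longleftrightarrow> (\<exists>H\<in>GLs. \<forall>n. proj_eq n (B n * H n) (H n * A n))"
    using act_eq_iff GLs_mult A B by (intro bex_cong refl) blast
  finally show ?thesis .
qed

lemma gl_conj_sub_iso_conj: "gl_conj \<subseteq> iso_conj"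
proof -
  have "act ` GLs \<subseteq> carrier (Iso (tr UNIV))" using ract_Iso[of UNIV] by auto
  thus ?thesis unfolding conj_rel_def by blast
qed

lemma conj_rels: "sym iso_conj" "trans iso_conj" "sym gl_conj" "trans gl_conj"
proof -
  interpret G: group "Iso (tr UNIV)" by (rule group_tr) simp
  have S: "subgroup (act ` GLs) (Iso (tr UNIV))" using subgroup_ract[of UNIV] by simp
  show "sym iso_conj" "trans iso_conj" "sym gl_conj" "trans gl_conj"
    using G.sym_conj_rel[OF G.subgroup_self] G.trans_conj_rel[OF G.subgroup_self]
      G.sym_conj_rel[OF S] G.trans_conj_rel[OF S] by blast+
qed

lemma gl_conj_refl: "A \<in> GLs \<Longrightarrow> (act A, act A) \<in> gl_conj"
  using conj_rel_act_iff[of A A] GLs_one proj_eq_refl by (metis mult_1 mult_1_right)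

lemma iso_conj_refl: "A \<in> GLs \<Longrightarrow> (act A, act A) \<in> iso_conj"
  using gl_conj_refl gl_conj_sub_iso_conj by blast

lemma types_eq:
  "types_meeting (tr UNIV) (carrier (Iso (tr UNIV))) (act ` GLs) = (\<lambda>A. iso_conj `` {act A}) ` GLs"
  "types_meeting (tr UNIV) (act ` GLs) (act ` GLs) = (\<lambda>A. gl_conj `` {act A}) ` GLs"
proof -
  have "act ` GLs \<subseteq> carrier (Iso (tr UNIV))" using ract_Iso[of UNIV] by auto
  thus "types_meeting (tr UNIV) (carrier (Iso (tr UNIV))) (act ` GLs) = (\<lambda>A. iso_conj `` {act A}) ` GLs"
    "types_meeting (tr UNIV) (act ` GLs) (act ` GLs) = (\<lambda>A. gl_conj `` {act A}) ` GLs"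
    unfolding types_meeting_def using conj_rels iso_conj_refl gl_conj_refl
    by (subst classes_meeting_eq; auto simp: image_image)+
qed

definition residues_at :: "nat \<Rightarrow> imat \<Rightarrow> int \<times> int \<times> int \<times> int" where
  "residues_at n A = (m11 A mod int p ^ n, m12 A mod int p ^ n, m21 A mod int p ^ n, m22 A mod int p ^ n)"

lemma residues_at_eq_iff: "residues_at n A = residues_at n B \<longleftrightarrow> mcong (int p ^ n) A B"
  by (simp add: residues_at_def mcong_def mod_eq_dvd_iff)

text \<open>The code consists of an integral companion matrix, an exponent \<open>m\<close>, the valuation \<open>j\<close> of the \<open>m\<close>-th power of the
  representative in its torus (\<open>j = 0\<close> if that power is scalar) and an approximation of the representative.\<close>
definition coded :: "(nat \<Rightarrow> imat) \<Rightarrow> (int \<times> int) \<times> (nat \<times> nat) \<times> (int \<times> int \<times> int \<times> int) \<Rightarrow> bool" where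
  "coded A = (\<lambda>((\<tau>, \<delta>), (m, j), x). \<exists>E\<in>torus \<tau> \<delta>. (act A, act E) \<in> iso_conj \<and> m > 0 \<and>
     (if j = 0 then (\<forall>n. int p ^ n dvd m21 (E n ^ m)) \<and> residues_at 2 (E 2) = x
      else j \<ge> 2 \<and> has_val j (m21 (E (Suc j) ^ m)) \<and> residues_at (Suc j) (E (Suc j)) = x))"

text \<open>The exponent \<open>m\<close> is a period modulo \<open>p ^ 2\<close>. The C-coordinate
  of the m-th power is thus divisible by \<open>p ^ 2\<close>, and its valuation, if finite, is at
  least 2.\<close>

lemma coded_exists:
  assumes A: "A \<in> GLs" shows "\<exists>c. coded A c"
proof -
  obtain \<tau> \<delta> E H where E: "E \<in> torus \<tau> \<delta>" "H \<in> GLs" "\<And>n. proj_eq n (E n * H n) (H n * A n)"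
    using torus_representative[OF A] by blast
  have EG: "E \<in> GLs" using E(1) by (simp add: torus_def)
  have r: "(act A, act E) \<in> iso_conj" using conj_rel_act_iff[OF A EG] E gl_conj_sub_iso_conj by blast
  obtain m where m: "m > 0" "mcong (int p ^ 2) (E 2 ^ m) 1" using pow_period[OF GLsD(2)[OF EG]] .
  have m2: "int p ^ 2 dvd m21 (E 2 ^ m)" using m(2) by (simp add: mcong_def)
  have c: "[m21 (E n ^ m) = m21 (E k ^ m)] (mod int p ^ k)" if "k \<le> n" for n k
    using mcong_m21[OF mcong_power[OF GLs_le[OF EG that]]] .
  show ?thesis
  proof (cases "\<forall>n. int p ^ n dvd m21 (E n ^ m)")
    case True
    hence "coded A ((\<tau>, \<delta>), (m, 0), residues_at 2 (E 2))" using E(1) r m(1) by (auto simp: coded_def)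
    thus ?thesis by blast
  next
    case False
    then obtain n where n: "\<not> int p ^ n dvd m21 (E n ^ m)" by blast
    then obtain j where j: "has_val j (m21 (E n ^ m))" "j < n" using has_val_exists by blast
    have "n > 2"
    proof (rule ccontr)
      assume "\<not> n > 2"
      hence "[m21 (E 2 ^ m) = m21 (E n ^ m)] (mod int p ^ n)" "int p ^ n dvd int p ^ 2"
        using c by (auto intro: le_imp_power_dvd)
      thus False using m2 n cong_dvd_iff dvd_trans by blast
    qed
    hence "int p ^ 2 dvd m21 (E n ^ m)" using c[of 2 n] m2 cong_dvd_iff by (metis less_imp_le)
    hence j2: "j \<ge> 2" using j(1) by (metis has_val_def dvd_trans le_imp_power_dvd not_less_eq_eq)
    have "has_val j (m21 (E (Suc j) ^ m))" by (rule has_val_cong[OF j(1) c]) (use j(2) in auto)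
    hence "coded A ((\<tau>, \<delta>), (m, j), residues_at (Suc j) (E (Suc j)))" using E(1) r m(1) j2 by (auto simp: coded_def)
    thus ?thesis by blast
  qed
qed

lemma coded_unique:
  assumes A: "A \<in> GLs" and B: "B \<in> GLs" and c: "coded A c" "coded B c"
  shows "iso_conj `` {act A} = iso_conj `` {act B}"
proof -
  obtain \<tau> \<delta> m j x where cx: "c = ((\<tau>, \<delta>), (m, j), x)" by (metis prod.collapse)
  obtain E F where EF: "E \<in> torus \<tau> \<delta>" "(act A, act E) \<in> iso_conj" "F \<in> torus \<tau> \<delta>" "(act B, act F) \<in> iso_conj" "m > 0"
    and E: "if j = 0 then (\<forall>n. int p ^ n dvd m21 (E n ^ m)) \<and> residues_at 2 (E 2) = x
      else j \<ge> 2 \<and> has_val j (m21 (E (Suc j) ^ m)) \<and> residues_at (Suc j) (E (Suc j)) = x"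
    and F: "if j = 0 then (\<forall>n. int p ^ n dvd m21 (F n ^ m)) \<and> residues_at 2 (F 2) = x
      else j \<ge> 2 \<and> has_val j (m21 (F (Suc j) ^ m)) \<and> residues_at (Suc j) (F (Suc j)) = x"
    using c unfolding cx coded_def by auto
  have EG: "E \<in> GLs" using EF(1) by (simp add: torus_def)
  have "(act E, act F) \<in> iso_conj"
  proof (cases "j = 0")
    case True
    have "mcong (int p ^ 2) (E 2) (F 2)" using E F True by (simp add: residues_at_eq_iff[symmetric])
    hence "act E = act F" using torus_torsion_eq[OF EF(1,3,5)] E F True by simp
    thus ?thesis using iso_conj_refl[OF EG] by simp
  next
    case False
    have "mcong (int p ^ Suc j) (E (Suc j)) (F (Suc j))" using E F False unfolding residues_at_eq_iff[symmetric] by simp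
    thus ?thesis using torus_conj[OF EF(1,3)] E False by auto
  qed
  hence "(act A, act B) \<in> iso_conj" using EF(2,4) conj_rels by (meson symD transD)
  thus ?thesis using class_eq_iff[OF conj_rels(1,2) iso_conj_refl[OF A] iso_conj_refl[OF B]] by simp
qed

lemma small_types: "small_isometry_types (lattice_tree p) (PGL2_Iso p)"
proof -
  have "countable ((\<lambda>A. iso_conj `` {act A}) ` GLs)"
    using countable_by_code[of GLs coded "\<lambda>A. iso_conj `` {act A}"] coded_exists coded_unique by blast
  thus ?thesis unfolding small_isometry_types_def lattice_tree_eq PGL2_Iso_eq types_eq
    by (rule countable_lesspoll_real)
qed

section \<open>Continuum many types under the projective linear group\<close>

text \<open>Partial sums of a p-adic unit whose digit of order \<open>i + 1\<close> records whether
  \<open>i \<in> S\<close>; the leading 1 makes it a unit.\<close>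

definition dsum :: "nat set \<Rightarrow> nat \<Rightarrow> int" where
  "dsum S n = 1 + (\<Sum>i<n. if i \<in> S then int p ^ Suc i else 0)"

lemma dsum_Suc: "dsum S (Suc n) = dsum S n + (if n \<in> S then int p ^ Suc n else 0)"
  by (simp add: dsum_def)

lemma dsum_unit: "\<not> int p dvd dsum S n"
proof (induction n)
  case 0 show ?case by (simp add: dsum_def)
next
  case (Suc n)
  have "int p dvd (if n \<in> S then int p ^ Suc n else 0)" by simp
  thus ?case using Suc unfolding dsum_Suc by (simp only: dvd_add_left_iff) simp
qed

lemma dsum_inj:
  assumes "\<And>n. [dsum S n = dsum S' n] (mod int p ^ n)" shows "S = S'"
proof -
  have "\<forall>i<n. i \<in> S \<longleftrightarrow> i \<in> S'" for n
  proof (induction n)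
    case (Suc n)
    have eq: "dsum S n = dsum S' n" using Suc by (simp add: dsum_def cong: sum.cong_simp)
    \<comment> \<open>The digit for \<open>n\<close> stands at \<open>p ^ Suc n\<close>, so it
      becomes visible modulo \<open>p ^ Suc (Suc n)\<close>; the next summand vanishes to that
      modulus.\<close>
    have "int p ^ Suc (Suc n) dvd dsum S (Suc (Suc n)) - dsum S' (Suc (Suc n))"
      using assms[of "Suc (Suc n)"] by (simp only: cong_iff_dvd_diff)
    moreover have "int p ^ Suc (Suc n) dvd (if Suc n \<in> S then int p ^ Suc (Suc n) else 0) - (if Suc n \<in> S' then int p ^ Suc (Suc n) else 0)"
      by (intro dvd_diff) auto
    ultimately have "int p ^ Suc (Suc n) dvd dsum S (Suc (Suc n)) - dsum S' (Suc (Suc n)) -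
        ((if Suc n \<in> S then int p ^ Suc (Suc n) else 0) - (if Suc n \<in> S' then int p ^ Suc (Suc n) else 0))"
      by (rule dvd_diff)
    also have "\<dots> = (if n \<in> S then int p ^ Suc n else 0) - (if n \<in> S' then int p ^ Suc n else 0)"
      unfolding dsum_Suc eq by simp
    finally have "n \<in> S \<longleftrightarrow> n \<in> S'" by (auto split: if_splits)
    thus ?case using Suc by (auto simp: less_Suc_eq)
  qed simp
  thus ?thesis by blast
qed

definition dmat :: "nat set \<Rightarrow> nat \<Rightarrow> imat" where "dmat S n = companion 1 (dsum S n)"

lemma dmat_GLs: "dmat S \<in> GLs"
proof -
  have "[dsum S (Suc n) = dsum S n] (mod int p ^ n)" for n
    by (simp add: dsum_Suc cong_iff_dvd_diff)
  hence "mcong (int p ^ n) (dmat S (Suc n)) (dmat S n)" for n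
    unfolding dmat_def by (intro mcong_companion cong_refl)
  moreover have "mdet (dmat S n) = dsum S n" for n by (simp add: dmat_def mdet_def)
  ultimately show ?thesis using dsum_unit by (simp add: GLs_def)
qed

text \<open>Conjugacy up to a factor \<open>k\<close> multiplies the trace by \<open>k\<close>. As
  both traces are 1, \<open>k\<close> is 1 modulo \<open>p ^ n\<close>, and then the determinants
  agree.\<close>

lemma dmat_inj:
  assumes "(act (dmat S), act (dmat S')) \<in> gl_conj" shows "S = S'"
proof (rule dsum_inj)
  fix n
  obtain H where H: "H \<in> GLs" "\<And>n. proj_eq n (dmat S' n * H n) (H n * dmat S n)"
    using assms conj_rel_act_iff[OF dmat_GLs dmat_GLs] by blast
  let ?N = "int p ^ n" and ?H = "H n"
  obtain k where k: "mcong ?N (dmat S' n * ?H) (of_int k * (?H * dmat S n))"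
    using H(2)[of n] by (auto simp: proj_eq_def)
  have cop: "coprime (mdet ?H) ?N" using coprime_pow GLsD(2)[OF H(1)] by blast
  have "mcong ?N (madj ?H * (dmat S' n * ?H)) (madj ?H * (of_int k * (?H * dmat S n)))"
    by (intro mcong_mult mcong_refl k)
  moreover have "mtr (madj ?H * (dmat S' n * ?H)) = mdet ?H * 1"
    "mtr (madj ?H * (of_int k * (?H * dmat S n))) = mdet ?H * k"
    by (simp_all add: mtr_def mdet_def dmat_def algebra_simps)
  ultimately have "[mdet ?H * 1 = mdet ?H * k] (mod ?N)" using mcong_mtr by metis
  hence k1: "[k = 1] (mod ?N)" using cop by (simp only: cong_mult_lcancel) (rule cong_sym)
  have "[mdet ?H * dsum S' n = mdet ?H * (k^2 * dsum S n)] (mod ?N)"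
    using mcong_mdet[OF k] by (simp add: mdet_mult dmat_def) (simp add: mdet_def[of "companion _ _"] ac_simps)
  hence "[dsum S' n = k^2 * dsum S n] (mod ?N)" using cop by (simp only: cong_mult_lcancel)
  also have "[k^2 * dsum S n = 1^2 * dsum S n] (mod ?N)" by (intro cong_mult cong_pow cong_refl k1)
  finally show "[dsum S n = dsum S' n] (mod ?N)" by (simp add: cong_sym)
qed

lemma continuum_types: "types_meeting (lattice_tree p) (PGL2_Iso p) (PGL2_Iso p) \<approx> (UNIV :: real set)"
proof -
  let ?f = "\<lambda>A. gl_conj `` {act A}"
  have "?f ` GLs \<lesssim> GLs" by (rule image_lepoll)
  also have "GLs \<lesssim> (UNIV :: (nat \<Rightarrow> imat) set)" by (rule subset_imp_lepoll) simp
  also have "(UNIV :: (nat \<Rightarrow> imat) set) \<lesssim> (UNIV :: real set)" by (rule sequences_lepoll_real)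
  finally have le: "?f ` GLs \<lesssim> (UNIV :: real set)" .
  have "inj (\<lambda>S. ?f (dmat S))"
  proof (rule injI)
    fix S S' assume "?f (dmat S) = ?f (dmat S')"
    hence "(act (dmat S), act (dmat S')) \<in> gl_conj"
      using class_eq_iff[OF conj_rels(3,4) gl_conj_refl[OF dmat_GLs] gl_conj_refl[OF dmat_GLs]] by blast
    thus "S = S'" by (rule dmat_inj)
  qed
  hence "(UNIV :: nat set set) \<lesssim> ?f ` GLs"
    unfolding lepoll_def using dmat_GLs by (intro exI[of _ "\<lambda>S. ?f (dmat S)"]) blast
  hence "(UNIV :: real set) \<lesssim> ?f ` GLs"
    using nat_sets_eqpoll_reals eqpoll_sym eqpoll_imp_lepoll lepoll_trans by blast
  with le have "?f ` GLs \<approx> (UNIV :: real set)" by (rule lepoll_antisym)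
  thus ?thesis unfolding lattice_tree_eq PGL2_Iso_eq types_eq .
qed

end

theorem theorem3p4:
  fixes p :: nat
  assumes "Factorial_Ring.prime p"
  shows
    "Q_rational (zeta_series (lattice_tree p) (PGL2_Iso p) (PGL2_Iso p)) \<and>
     small_isometry_types (lattice_tree p) (PGL2_Iso p) \<and>
     types_meeting (lattice_tree p) (PGL2_Iso p) (PGL2_Iso p) \<approx> (UNIV :: real set)"
proof -
  interpret prime_tree p by unfold_locales (rule assms)
  show ?thesis using Q_rational_zeta small_types continuum_types by blast
qed

end
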